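(* Let $0<\zeta<\pi$ and let $N$ be an arbitrary non-negative integer. Let $\mu$ and $\nu$ be complex numbers satisfying $|\Re\mu | < N + \frac{1}{2}$ and $\Re\nu > N - \frac{1}{2}$. Put $\alpha_{\mu,\nu,n}= \left( \nu - n + \tfrac{1}{2} \right)\zeta + \left( \mu + n - \tfrac{1}{2}\right)\tfrac{\pi }{2}$. Then $$\mathsf{P}_\nu ^\mu (\cos \zeta )=\frac{\sqrt{\frac{2}{\pi \sin \zeta }}}{\Gamma (\nu - \mu + 1)} \left( \sum_{n = 0}^{N - 1} a_n (\mu ) \Gamma \left( \nu - n + \tfrac{1}{2} \right) \frac{\cos (\alpha_{\mu,\nu,n})}{\sin ^n \zeta} + R_N^{(\mathsf{P})} (\zeta ,\mu ,\nu ) \right),$$ $$\mathsf{Q}_\nu ^\mu (\cos \zeta ) = \frac{-\sqrt{\frac{\pi}{2 \sin \zeta }}}{\Gamma (\nu - \mu + 1)} \left( \sum_{n = 0}^{N - 1} a_n (\mu )\Gamma \left( \nu - n + \tfrac{1}{2} \right)\frac{\sin (\alpha _{\mu ,\nu ,n} )}{\sin ^n \zeta } + R_N^{(\mathsf{Q})} (\zeta ,\mu ,\nu ) \right),$$ where both remainder terms satisfy $$\left| R_N^{(\mathsf{P})} (\zeta ,\mu ,\nu ) \right|,\ \left| R_N^{(\mathsf{Q})} (\zeta ,\mu ,\nu ) \right| \le \left|\frac{\cos (\pi \mu )}{\cos (\pi \Re\mu )}\right|\left| a_N (\Re\mu )\right| \Gamma \left( \Re\nu - N + \tfrac{1}{2}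 \right) \frac{\cosh ( \Im(\alpha_{\mu,\nu,N}))}{\sin ^N \zeta } .$$ With the modified conditions $|\Re\mu | < N + \frac{1}{2}$ and $\Re\nu > N + \frac{1}{2}$, one also has $$\begin{aligned}\left| R_N^{(\mathsf{P})} (\zeta ,\mu ,\nu ) \right| \le \; & \left|\frac{\cos (\pi \mu )}{\cos (\pi\Re\mu)}\right|\left| a_N (\Re\mu )\right| \Gamma \left( \Re\nu - N + \tfrac{1}{2} \right) \frac{|\cos (\alpha _{\mu ,\nu ,N} )|}{\sin ^N \zeta } \\ & +\left|\frac{\cos (\pi \mu )}{\cos (\pi \Re\mu )}\right|\left| a_{N+1} (\Re\mu )\right| \Gamma \left( \Re\nu - N - \tfrac{1}{2} \right) \frac{|\sin (\alpha _{\mu ,\nu ,N} )|}{\sin ^{N+1} \zeta }\end{aligned}$$ and $$\begin{aligned}\left| R_N^{(\mathsf{Q})} (\zeta ,\mu ,\nu ) \right| \le \; &\left|\frac{\cos (\pi \mu )}{\cos (\pi \Re\mu )}\right|\left| a_N (\Re\mu )\right| \Gamma \left( \Re\nu - N + \tfrac{1}{2} \right) \frac{|\sin (\alpha _{\mu ,\nu ,N} )|}{\sin ^N \zeta } \\ & +\left|\frac{\cos (\pi \mu )}{\cos (\pi \Re\mu )}\right|\left| a_{N+1} (\Re\mu )\right| \Gamma \left( \Re\nu - N - \tfrac{1}{2} \right) \frac{|\cos (\alpha _{\mu ,\nu ,N} )|}{\sin ^{N+1} \zeta } .\end{aligned}$$ If $2\Re\mu $ is an odd integer, then the limiting values have to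 be taken in these bounds.
   Context: The Ferrers functions are defined for $-1<x<1$ by $$\mathsf{P}_\nu ^\mu (x) = \left( \frac{1 + x}{1 - x} \right)^{\mu /2} \mathbf{F}\left(\nu+1,-\nu;1-\mu;\tfrac{1-x}{2}\right)$$ and, for $\nu+\mu\notin\mathbb{Z}_{<0}$, $$\mathsf{Q}_\nu ^\mu (x) = \frac{\pi }{2\sin (\pi \mu )}\left( \cos (\pi \mu )\left( \frac{1 + x}{1 - x}\right)^{\mu /2} \mathbf{F}\left(\nu+1,-\nu;1-\mu;\tfrac{1-x}{2}\right)- \frac{\Gamma (\nu + \mu + 1)}{\Gamma (\nu - \mu + 1)}\left( \frac{1 - x}{1 + x} \right)^{\mu /2} \mathbf{F}\left(\nu+1,-\nu;1+\mu;\tfrac{1-x}{2}\right)\right)$$ (limiting value when $\mu$ is an integer), where $\mathbf{F}(a,b;c;w)=\sum_{n\ge 0}\frac{(a)_n(b)_n}{\Gamma(c+n)\,n!}w^n$ ($|w|<1$) is the regularised hypergeometric function. $a_n (\mu ) = \frac{(4\mu ^2 - 1^2 )(4\mu ^2 - 3^2 ) \cdots (4\mu ^2 - (2n - 1)^2 )}{8^n n!}=\frac{(\frac12-\mu)_n(\frac12+\mu)_n}{(-2)^n n!}$, with $(\cdot)_n$ the Pochhammer symbol. "Limiting value" in the bounds means that $|a_k(\Re\mu)|/|\cos(\pi\Re\mu)|$ is replaced by $\lim_{x\to\Re\mu}|a_k(x)|/|\cos(\pi x)|$. *)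

theory Defs
  imports "HOL-Analysis.Analysis"
begin

text \<open>
  The regularised hypergeometric function, on the disc \<open>\<bar>w\<bar> < 1\<close> where the series converges.
  Since \<open>rGamma\<close> vanishes at the poles of \<open>Gamma\<close>, non-positive integers \<open>c\<close> are allowed.
\<close>

definition hypergeo_reg :: "complex \<Rightarrow> complex \<Rightarrow> complex \<Rightarrow> complex \<Rightarrow> complex" where
  "hypergeo_reg a b c w =
     (\<Sum>n. pochhammer a n * pochhammer b n * rGamma (c + of_nat n) / fact n * w ^ n)"

text \<open>The Ferrers functions, with the degree \<open>\<nu>\<close> as first and the order \<open>\<mu>\<close> as second argument.\<close>

definition ferrers_P :: "complex \<Rightarrow> complex \<Rightarrow> real \<Rightarrow> complex" where
  "ferrers_P \<nu> \<mu> x =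
     of_real ((1 + x) / (1 - x)) powr (\<mu> / 2) *
       hypergeo_reg (\<nu> + 1) (- \<nu>) (1 - \<mu>) (of_real ((1 - x) / 2))"

definition ferrers_Q_nonint :: "complex \<Rightarrow> complex \<Rightarrow> real \<Rightarrow> complex" where
  "ferrers_Q_nonint \<nu> \<mu> x =
     of_real pi / (2 * sin (of_real pi * \<mu>)) *
       (cos (of_real pi * \<mu>) * of_real ((1 + x) / (1 - x)) powr (\<mu> / 2) *
          hypergeo_reg (\<nu> + 1) (- \<nu>) (1 - \<mu>) (of_real ((1 - x) / 2))
        - Gamma (\<nu> + \<mu> + 1) / Gamma (\<nu> - \<mu> + 1) *
          of_real ((1 - x) / (1 + x)) powr (\<mu> / 2) *
          hypergeo_reg (\<nu> + 1) (- \<nu>) (1 + \<mu>) (of_real ((1 - x) / 2)))"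

text \<open>Only meaningful when \<open>\<nu> + \<mu>\<close> is not a negative integer.\<close>

definition ferrers_Q :: "complex \<Rightarrow> complex \<Rightarrow> real \<Rightarrow> complex" where
  "ferrers_Q \<nu> \<mu> x =
     (if \<mu> \<in> \<int> then Lim (at \<mu>) (\<lambda>m. ferrers_Q_nonint \<nu> m x) else ferrers_Q_nonint \<nu> \<mu> x)"

definition a_coeff :: "nat \<Rightarrow> 'a::field_char_0 \<Rightarrow> 'a" where
  "a_coeff n \<mu> = (\<Prod>k=1..n. 4 * \<mu>\<^sup>2 - (2 * of_nat k - 1)\<^sup>2) / (8 ^ n * fact n)"

text \<open>
  The quotient \<open>\<bar>a\<^sub>n(x)\<bar> / \<bar>cos (\<pi>x)\<bar>\<close>, with its limiting value at the zeros of the denominator,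
  that is, where \<open>2x\<close> is an odd integer.
\<close>

definition a_cos_ratio :: "nat \<Rightarrow> real \<Rightarrow> real" where
  "a_cos_ratio n x =
     (if \<exists>m::int. odd m \<and> 2 * x = of_int m
      then Lim (at x) (\<lambda>t. \<bar>a_coeff n t\<bar> / \<bar>cos (pi * t)\<bar>)
      else \<bar>a_coeff n x\<bar> / \<bar>cos (pi * x)\<bar>)"

definition ferrers_phase :: "real \<Rightarrow> complex \<Rightarrow> complex \<Rightarrow> nat \<Rightarrow> complex" where
  "ferrers_phase \<zeta> \<mu> \<nu> n =
     (\<nu> - of_nat n + 1 / 2) * of_real \<zeta> + (\<mu> + of_nat n - 1 / 2) * (of_real pi / 2)"

end

theory Submission
  imports Defs "HOL-Complex_Analysis.Complex_Analysis" "HOL-Real_Asymp.Real_Asymp"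
begin

text \<open>
  For \<open>Re w > 0\<close> let \<open>g(w)\<close> be the integral over the real line of
  \<open>e\<^sup>\<mu>\<^sup>b (cosh b - 1 + w)\<^sup>-\<^sup>\<nu>\<^sup>-\<^sup>1\<close>.  At \<open>w = 1 \<plusminus> i cot \<zeta>\<close>, up to a power of \<open>sin \<zeta>\<close>, it
  solves the associated Legendre equation, so it is a combination of the Ferrers functions of orders
  \<open>\<mu>\<close> and \<open>-\<mu>\<close>.  The coefficients are Wronskians: for \<open>Re \<mu> < 0\<close> they are read off from the limit
  \<open>\<zeta> \<rightarrow> 0\<close>, and in general they follow by analytic continuation in \<open>\<mu>\<close>.  This expresses \<open>P\<close> and \<open>Q\<close>
  through \<open>g(1 + i cot \<zeta>)\<close> and \<open>g(1 - i cot \<zeta>)\<close>.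

  For \<open>w > 0\<close> the substitution \<open>cosh b - 1 = w e\<^sup>x\<close> turns \<open>g\<close> into an integral of
  \<open>cosh (\<mu>b) / cosh (b / 2)\<close> against a Beta kernel.  As a function of \<open>z = cosh b - 1\<close> this quotient is
  \<open>cos (\<pi>\<mu>) / \<pi>\<close> times a Stieltjes transform, with moments proportional to \<open>a\<^sub>n(\<mu>) / cos (\<pi>\<mu>)\<close>.
  Expanding the geometric kernel \<open>1 / (1 + z\<kappa>)\<close> gives the expansion with an explicit remainder, and
  analytic continuation in \<open>w\<close> carries it to \<open>Re w > 0\<close>.  On the line \<open>Re w = 1\<close> the denominators
  \<open>1 + w e\<^sup>x \<kappa>\<close> have modulus at least 1, which gives the bounds.
\<close>

section \<open>Parameter integrals and Beta integrals\<close>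

text \<open>The points w = 1 + i \<sigma> cot \<zeta> with \<sigma> = 1 or -1 are exp(i \<sigma>
  (pi/2 - \<zeta>)) / sin \<zeta>. So w^n advances the phase by n (pi/2 - \<zeta>) and divides by
  sin^n \<zeta>, and combining both signs gives the cosines of P and the sines of Q.

  The Stieltjes integral itself converges only for |Re \<mu>| < 1/2. Splitting off N moments leaves
  one that converges for |Re \<mu>| < N + 1/2, and the identity is continued to that strip. The
  quotient a_N / cos degenerates at half-odd integers, but the N-th moment, a product of two Gamma
  functions, is regular there; so the estimates use moments, which \<open>a_cos_ratio_eq\<close>
  translates.

  The second pair of bounds separates the parts of the remainder integral that are even and odd in
  \<sigma>. The odd part is a difference of values at distance 2 |cot \<zeta>|; it costs one more
  power of the kernel, whence N + 1 and Re \<nu> > N + 1/2.\<close>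

lemma has_field_derivative_lebesgue_integral:
  fixes f :: "complex \<Rightarrow> 'a \<Rightarrow> complex"
  assumes S: "open S" and z: "z \<in> S"
    and meas: "\<And>z. z \<in> S \<Longrightarrow> f z \<in> borel_measurable M"
    and hol: "\<And>x. x \<in> space M \<Longrightarrow> (\<lambda>z. f z x) holomorphic_on S"
    and dom: "\<exists>r>0. \<exists>g. cball z r \<subseteq> S \<and> integrable M g \<and>
                (\<forall>u\<in>cball z r. \<forall>x\<in>space M. norm (f u x) \<le> g x)"
  shows "((\<lambda>z. \<integral>x. f z x \<partial>M) has_field_derivative (\<integral>x. deriv (\<lambda>z. f z x) z \<partial>M)) (at z)"
proof -
  obtain r g where r: "r > 0" "cball z r \<subseteq> S" and g: "integrable M g"
    and fg: "\<And>u x. u \<in> cball z r \<Longrightarrow> x \<in> space M \<Longrightarrow> norm (f u x) \<le> g x"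
    using dom by blast
  have int: "integrable M (f u)" if "u \<in> cball z r" for u
    by (rule Bochner_Integration.integrable_bound[OF g])
       (use that r meas fg in \<open>auto intro!: AE_I2 intro: order_trans[OF _ abs_ge_self]\<close>)
  \<comment> \<open>Cauchy's inequality on discs of half the radius turns the majorant of the
    functions into one of their derivatives. The difference quotients inherit it from the mean value
    inequality, and dominated convergence along sequences applies.\<close>
  have der_bound: "norm (deriv (\<lambda>z. f z x) u) \<le> g x / (r / 2)"
    if "u \<in> cball z (r / 2)" "x \<in> space M" for u x
  proof -
    have sub: "cball u (r / 2) \<subseteq> cball z r"
    proof
      fix v assume "v \<in> cball u (r / 2)"
      then show "v \<in> cball z r"
        using that(1) dist_triangle[of z v u] by (auto simp: dist_commute)
    qed
    then have "cball u (r / 2) \<subseteq> S" using r by auto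
    then have "(\<lambda>z. f z x) holomorphic_on cball u (r / 2)"
      using hol[OF that(2)] holomorphic_on_subset by blast
    then have "norm ((deriv ^^ 1) (\<lambda>z. f z x) u) \<le> fact 1 * g x / (r / 2) ^ 1"
      using r sub that
      by (intro Cauchy_inequality holomorphic_on_imp_continuous_on)
         (auto intro!: fg intro: holomorphic_on_subset simp: dist_norm subset_iff)
    then show ?thesis by simp
  qed
  have quot_bound: "norm ((f u x - f z x) / (u - z)) \<le> g x / (r / 2)"
    if "u \<in> cball z (r / 2)" "x \<in> space M" for u x
  proof (cases "u = z")
    case True
    then show ?thesis
      using order_trans[OF norm_ge_zero der_bound[OF that]] by simp
  next
    case False
    have "norm (f u x - f z x) \<le> g x / (r / 2) * norm (u - z)"
    proof (rule field_differentiable_bound[of "cball z (r / 2)" _ "deriv (\<lambda>z. f z x)"])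
      fix v assume v: "v \<in> cball z (r / 2)"
      then have "v \<in> S" using r by auto
      then show "((\<lambda>z. f z x) has_field_derivative deriv (\<lambda>z. f z x) v) (at v within cball z (r / 2))"
        using hol[OF that(2)] S
        by (meson has_field_derivative_at_within holomorphic_derivI)
    qed (use that r der_bound in auto)
    then show ?thesis using False by (simp add: norm_divide field_simps)
  qed
  have lim: "((\<lambda>u. (f u x - f z x) / (u - z)) \<longlongrightarrow> deriv (\<lambda>z. f z x) z) (at z)"
    if "x \<in> space M" for x
    using holomorphic_derivI[OF hol[OF that] S z] by (simp add: has_field_derivative_iff)
  show ?thesis
    unfolding has_field_derivative_iff tendsto_at_iff_sequentially comp_def
  proof safe
    fix X assume X: "\<forall>i. X i \<in> UNIV - {z}" "X \<longlonglongrightarrow> z"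
    have "eventually (\<lambda>i. X i \<in> ball z (r / 2)) sequentially"
      using X(2) r by (intro topological_tendstoD) auto
    then obtain n0 where "\<And>i. i \<ge> n0 \<Longrightarrow> X i \<in> ball z (r / 2)"
      unfolding eventually_sequentially by blast
    then have n0: "\<And>i. i \<ge> n0 \<Longrightarrow> X i \<in> cball z (r / 2)"
      using ball_subset_cball by blast
    define Y where "Y = (\<lambda>i. X (i + n0))"
    have Y: "Y i \<in> cball z (r / 2)" "Y i \<noteq> z" for i
      using n0[of "i + n0"] X by (auto simp: Y_def)
    have Y': "Y i \<in> cball z r" for i using Y(1)[of i] r by auto
    have Ylim: "Y \<longlonglongrightarrow> z" using X(2) unfolding Y_def by (rule LIMSEQ_ignore_initial_segment)
    have qlim: "(\<lambda>i. (f (Y i) x - f z x) / (Y i - z)) \<longlonglongrightarrow> deriv (\<lambda>z. f z x) z"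
      if "x \<in> space M" for x
      using lim[OF that] Ylim Y(2) unfolding tendsto_at_iff_sequentially comp_def by auto
    have qmeas: "(\<lambda>x. (f (Y i) x - f z x) / (Y i - z)) \<in> borel_measurable M" for i
      using Y' r by (intro borel_measurable_divide borel_measurable_diff meas) (auto simp: z)
    have "(\<lambda>i. \<integral>x. (f (Y i) x - f z x) / (Y i - z) \<partial>M) \<longlonglongrightarrow> (\<integral>x. deriv (\<lambda>z. f z x) z \<partial>M)"
    proof (rule integral_dominated_convergence[where w = "\<lambda>x. g x / (r / 2)"])
      show "(\<lambda>x. deriv (\<lambda>z. f z x) z) \<in> borel_measurable M"
        using qlim qmeas by (rule borel_measurable_LIMSEQ_metric[rotated])
    qed (use g qmeas qlim quot_bound Y in \<open>auto intro!: AE_I2\<close>)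
    moreover have "(\<integral>x. (f (Y i) x - f z x) / (Y i - z) \<partial>M) =
        ((\<integral>x. f (Y i) x \<partial>M) - (\<integral>x. f z x \<partial>M)) / (Y i - z)" for i
      using int[OF Y'[of i]] int[of z] r by simp
    ultimately have "(\<lambda>i. ((\<integral>x. f (Y i) x \<partial>M) - (\<integral>x. f z x \<partial>M)) / (Y i - z))
        \<longlonglongrightarrow> (\<integral>x. deriv (\<lambda>z. f z x) z \<partial>M)"
      by (simp only:)
    then show "(\<lambda>i. ((\<integral>x. f (X i) x \<partial>M) - (\<integral>x. f z x \<partial>M)) / (X i - z))
        \<longlonglongrightarrow> (\<integral>x. deriv (\<lambda>z. f z x) z \<partial>M)"
      unfolding Y_def by (rule LIMSEQ_offset)
  qed
qed

lemma holomorphic_on_lebesgue_integral: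
  fixes f :: "complex \<Rightarrow> 'a \<Rightarrow> complex"
  assumes "open S"
    and "\<And>z. z \<in> S \<Longrightarrow> f z \<in> borel_measurable M"
    and "\<And>x. x \<in> space M \<Longrightarrow> (\<lambda>z. f z x) holomorphic_on S"
    and "\<And>z. z \<in> S \<Longrightarrow> \<exists>r>0. \<exists>g. cball z r \<subseteq> S \<and> integrable M g \<and>
                (\<forall>u\<in>cball z r. \<forall>x\<in>space M. norm (f u x) \<le> g x)"
  shows "(\<lambda>z. \<integral>x. f z x \<partial>M) holomorphic_on S"
  using has_field_derivative_lebesgue_integral[OF assms(1) _ assms(2,3,4)] assms(1)
  by (auto simp: holomorphic_on_open)

lemma integrable_exp_neg_abs:
  fixes c :: real
  assumes "c > 0"
  shows "integrable lborel (\<lambda>x::real. exp (- c * \<bar>x\<bar>))"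
proof -
  have "((\<lambda>x::real. exp (- c * x)) has_integral exp (- c * 0) / c) {0..}"
    using assms by (rule has_integral_exp_minus_to_infinity)
  then have "(\<lambda>x::real. exp (- c * x)) absolutely_integrable_on {0..}"
    by (intro nonnegative_absolutely_integrable_1) (auto simp: integrable_on_def)
  then have "set_integrable lborel {0..} (\<lambda>x::real. exp (- c * x))"
    unfolding set_integrable_def by (subst (asm) integrable_completion) auto
  then have "integrable lborel (\<lambda>x. indicator {0..} x *\<^sub>R exp (- c * \<bar>x\<bar>))"
    unfolding set_integrable_def
    by (rule Bochner_Integration.integrable_cong[THEN iffD1, rotated 2]) (auto split: split_indicator)
  then show ?thesis
    using has_bochner_integral_even_function[of "\<lambda>x. exp (- c * \<bar>x\<bar>)"]
    by (metis (no_types, lifting) abs_minus_cancel has_bochner_integral_iff)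
qed

lemma integrable_exp_dominated:
  fixes f :: "real \<Rightarrow> 'a::{banach, second_countable_topology}"
  assumes "f \<in> borel_measurable borel" "c > 0" "\<And>x. norm (f x) \<le> C * exp (- c * \<bar>x\<bar>)"
  shows "integrable lborel f"
  by (rule Bochner_Integration.integrable_bound[where f = "\<lambda>x. C * exp (- c * \<bar>x\<bar>)"])
     (use assms integrable_exp_neg_abs[of c] in
       \<open>auto intro!: AE_I2 intro: order_trans[OF _ abs_ge_self]\<close>)

text \<open>The exponential factor is crude, but it does not depend on \<open>x\<close>; that
  suffices for the majorants in dominated convergence.\<close>

lemma norm_powr_le:
  fixes x y :: complex
  shows "norm (x powr y) \<le> norm x powr Re y * exp (pi * \<bar>Im y\<bar>)"
proof -
  have "- Im y * Arg x \<le> \<bar>Im y\<bar> * \<bar>Arg x\<bar>"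
    by (metis abs_ge_self abs_minus_cancel abs_mult)
  also have "\<dots> \<le> \<bar>Im y\<bar> * pi"
    using Arg_bounded[of x] by (intro mult_left_mono) auto
  finally have "exp (- Im y * Arg x) \<le> exp (pi * \<bar>Im y\<bar>)" by (simp add: mult.commute)
  then show ?thesis
    unfolding norm_powr_complex by (intro mult_left_mono) auto
qed

section \<open>Euler's integrals over the whole real line\<close>

lemma not_nonpos_Ints_Re_pos: "Re z > 0 \<Longrightarrow> z \<notin> \<int>\<^sub>\<le>\<^sub>0"
  by (auto elim!: nonpos_Ints_cases)

lemma Gamma_nonzero_Re_pos: "Re z > 0 \<Longrightarrow> Gamma z \<noteq> (0::complex)"
  using not_nonpos_Ints_Re_pos by (simp add: Gamma_eq_zero_iff)

lemma has_bochner_integral_Gamma_exp: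
  fixes p :: complex
  assumes "Re p > 0"
  shows "has_bochner_integral lborel (\<lambda>x. exp (p * of_real x - of_real (exp x))) (Gamma p)"
proof -
  define f where "f = (\<lambda>t. complex_of_real t powr (p - 1) / of_real (exp t))"
  have range_exp: "range exp = {0::real<..}"
    by (force simp: image_iff intro: exp_ln[symmetric])
  have "f absolutely_integrable_on range exp \<and> integral (range exp) f = Gamma p"
    using absolutely_integrable_Gamma_integral'[OF assms] Gamma_integral_complex'[OF assms]
    by (auto simp: f_def range_exp integral_unique)
  moreover have "inj (exp :: real \<Rightarrow> real)" by (simp add: inj_def)
  ultimately have "(\<lambda>x. \<bar>exp x\<bar> *\<^sub>R f (exp x)) absolutely_integrable_on UNIV \<and>
      integral UNIV (\<lambda>x. \<bar>exp x\<bar> *\<^sub>R f (exp x)) = Gamma p"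
    by (subst has_absolute_integral_change_of_variables_real[where h = exp])
       (auto intro!: derivative_eq_intros)
  moreover have "\<bar>exp x\<bar> *\<^sub>R f (exp x) = exp (p * of_real x - of_real (exp x))" for x
    by (simp add: f_def powr_def scaleR_conv_of_real Ln_of_real exp_diff exp_of_real
          flip: exp_of_real)
       (simp add: algebra_simps exp_add exp_diff exp_of_real)
  ultimately have "(\<lambda>x. exp (p * of_real x - of_real (exp x))) absolutely_integrable_on UNIV"
      "integral UNIV (\<lambda>x::real. exp (p * of_real x - of_real (exp x))) = Gamma p"
    by simp_all
  moreover from this(1) have "integrable lborel (\<lambda>x::real. exp (p * of_real x - of_real (exp x)))"
    unfolding set_integrable_def by (subst (asm) integrable_completion) auto
  ultimately show ?thesis
    by (simp add: has_bochner_integral_iff integral_lborel)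
qed

text \<open>Multiply the integrals of Gamma p and Gamma r and translate the second variable by the
  first. By \<open>shift\<close> the inner integral for fixed \<open>y\<close> is a translate of the
  integral of Gamma (p + r), with a weight that depends on \<open>y\<close> alone; Fubini's theorem
  gives the product formula.\<close>

lemma has_bochner_integral_Beta_exp:
  fixes p r :: complex
  assumes p: "Re p > 0" and r: "Re r > 0"
  shows "has_bochner_integral lborel
           (\<lambda>y. exp (r * of_real y) * of_real (1 + exp y) powr (- (p + r))) (Gamma p * Gamma r / Gamma (p + r))"
proof -
  define G where "G = (\<lambda>p (x::real). exp (p * complex_of_real x - of_real (exp x)))"
  have G: "integrable lborel (G q)" "integral\<^sup>L lborel (G q) = Gamma q" if "Re q > 0" for q
    using has_bochner_integral_Gamma_exp[OF that] by (auto simp: has_bochner_integral_iff G_def)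
  have meas [measurable]: "G q \<in> borel_measurable borel" for q
    unfolding G_def by simp
  define B where "B = (\<lambda>y::real. exp (r * of_real y) * of_real (1 + exp y) powr (- (p + r)))"
  have shift: "G p x * G r (y + x) = B y * G (p + r) (ln (1 + exp y) + x)" for x y
  proof -
    have "B y = exp (r * of_real y - (p + r) * of_real (ln (1 + exp y)))"
    proof -
      have "1 + exp y > 0" by (simp add: add_pos_pos)
      then have "Ln (of_real (1 + exp y)) = of_real (ln (1 + exp y))" by (rule Ln_of_real)
      moreover have "of_real (1 + exp y) \<noteq> (0::complex)"
        using \<open>1 + exp y > 0\<close> by (metis less_irrefl of_real_eq_0_iff)
      ultimately show ?thesis unfolding B_def powr_def by (simp add: exp_diff exp_minus exp_add field_simps)
    qed
    moreover have "exp (ln (1 + exp y) + x) = exp x + exp (y + x)"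
      by (simp add: exp_add add_pos_pos algebra_simps)
    ultimately show ?thesis
      unfolding G_def by (simp flip: exp_add) (simp add: algebra_simps)
  qed
  have Gshift: "integrable lborel (\<lambda>x. G q (t + x))" "(\<integral>x. G q (t + x) \<partial>lborel) = Gamma q"
    if "Re q > 0" for q t
    using lborel_integrable_real_affine[OF G(1)[OF that], of 1 t]
      lborel_integral_real_affine[of 1 "G q" t] G(2)[OF that] by simp_all
  have pair: "integrable (lborel \<Otimes>\<^sub>M lborel) (\<lambda>(x, y). G p x * G r (y + x))"
  proof (rule lborel_pair.Fubini_integrable)
    have "(\<integral>y. norm (G p x * G r (y + x)) \<partial>lborel) = norm (G p x) * (\<integral>y. norm (G r y) \<partial>lborel)" for x
      using lborel_integral_real_affine[of 1 "\<lambda>y. norm (G r y)" x]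
      by (simp add: norm_mult add.commute)
    then show "integrable lborel (\<lambda>x. \<integral>y. norm (case (x, y) of (x, y) \<Rightarrow> G p x * G r (y + x)) \<partial>lborel)"
      using G(1)[OF p] by simp
    show "AE x in lborel. integrable lborel (\<lambda>y. case (x, y) of (x, y) \<Rightarrow> G p x * G r (y + x))"
      using Gshift(1)[OF r] by (auto simp: add.commute)
  qed simp
  have pr: "Re (p + r) > 0" using p r by simp
  have nz: "Gamma (p + r) \<noteq> 0"
    using pr by (rule Gamma_nonzero_Re_pos)
  have "integrable lborel (\<lambda>y. \<integral>x. G p x * G r (y + x) \<partial>lborel)"
    using lborel_pair.integrable_snd[OF pair] by simp
  moreover have inner: "(\<integral>x. G p x * G r (y + x) \<partial>lborel) = B y * Gamma (p + r)" for y
    unfolding shift using Gshift(2)[OF pr] by simp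
  ultimately have "integrable lborel (\<lambda>y. B y * Gamma (p + r))" by simp
  then have "integrable lborel (\<lambda>y. B y * Gamma (p + r) / Gamma (p + r))"
    by (rule integrable_divide)
  then have int: "integrable lborel B" using nz by simp
  have "integral\<^sup>L lborel B * Gamma (p + r) = (\<integral>y. (\<integral>x. G p x * G r (y + x) \<partial>lborel) \<partial>lborel)"
    unfolding inner using int by simp
  also have "\<dots> = (\<integral>x. (\<integral>y. G p x * G r (y + x) \<partial>lborel) \<partial>lborel)"
    using lborel_pair.Fubini_integral[OF pair] by simp
  also have "\<dots> = Gamma p * Gamma r"
    using Gshift(2)[OF r] G[OF p] by (simp add: add.commute)
  finally show ?thesis
    using int nz unfolding has_bochner_integral_iff B_def[symmetric] by (simp add: field_simps)
qed

text \<open>Real substitutions prove identities for positive parameters only; this carries them into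
  a complex domain.\<close>

lemma analytic_continuation_pos_real:
  assumes "f holomorphic_on S" "g holomorphic_on S" "open S" "connected S"
    and pos: "\<And>x. x > 0 \<Longrightarrow> complex_of_real x \<in> S"
    and eq: "\<And>x. x > 0 \<Longrightarrow> f (complex_of_real x) = g (complex_of_real x)"
    and w: "w \<in> S"
  shows "f w = g w"
proof -
  have "1 islimpt (complex_of_real ` {0<..})"
    unfolding islimpt_approachable
  proof safe
    fix e :: real assume "e > 0"
    then show "\<exists>x'\<in>complex_of_real ` {0<..}. x' \<noteq> 1 \<and> dist x' 1 < e"
      by (intro bexI[OF _ imageI[of "1 + e / 2"]]) (auto simp: dist_norm norm_divide)
  qed
  moreover have "(\<lambda>z. f z - g z) holomorphic_on S"
    using assms(1,2) by (rule holomorphic_on_diff)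
  moreover have "1 \<in> S" using pos[of 1] by simp
  moreover have "complex_of_real ` {0<..} \<subseteq> S" using pos by auto
  ultimately have "f w - g w = 0"
    using analytic_continuation[of "\<lambda>z. f z - g z" S "complex_of_real ` {0<..}" 1 w] eq w assms(3,4)
    by (metis (no_types, lifting) eq_iff_diff_eq_0 greaterThan_iff imageE)
  then show ?thesis by simp
qed

text \<open>For z > 0, translating \<open>y\<close> by - ln z reduces the integral with
  \<open>1 + z exp y\<close> to the Beta integral times \<open>z powr (- r)\<close>. Both sides are
  holomorphic in z on a half-plane that contains the positive axis and \<sigma> i, which carries the
  identity to the imaginary axis.\<close>

lemma has_bochner_integral_Beta_rotated:
  fixes p r :: complex and \<sigma> :: real
  assumes p: "Re p > 0" and r: "Re r > 0" and \<sigma>: "\<sigma> = 1 \<or> \<sigma> = -1"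
  shows "has_bochner_integral lborel
           (\<lambda>y. exp (r * of_real y) * (1 + \<sigma> * \<i> * of_real (exp y)) powr (- (p + r)))
           ((\<sigma> * \<i>) powr (- r) * (Gamma p * Gamma r / Gamma (p + r)))"
proof -
  define f where "f = (\<lambda>z y. exp (r * complex_of_real y) * (1 + z * of_real (exp y)) powr (- (p + r)))"
  \<comment> \<open>The right half-plane turned by \<sigma> pi/4 has both the positive reals and
    \<sigma> i in its interior; on it the positive functional \<open>Re z + \<sigma> Im z\<close>
    keeps \<open>1 + z exp y\<close> off the branch cut.\<close>
  define S where "S = {z::complex. Re z + \<sigma> * Im z > 0}"
  have S_alt: "S = {z. Complex 1 \<sigma> \<bullet> z > 0}"
    by (auto simp: S_def inner_complex_def)
  have S: "open S" "connected S"
    unfolding S_alt by (auto intro!: open_halfspace_gt convex_connected convex_halfspace_gt)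
  have lower: "1 + e * exp y \<le> 2 * norm (1 + z * complex_of_real (exp y))"
    if "e \<le> Re z + \<sigma> * Im z" for e z y
  proof -
    define D where "D = 1 + z * complex_of_real (exp y)"
    have "1 + e * exp y \<le> 1 + (Re z + \<sigma> * Im z) * exp y" using that by simp
    also have "\<dots> = Re D + \<sigma> * Im D" by (simp add: D_def algebra_simps)
    also have "\<dots> \<le> \<bar>Re D\<bar> + \<bar>Im D\<bar>" using \<sigma> by auto
    also have "\<dots> \<le> 2 * norm D" using abs_Re_le_cmod[of D] abs_Im_le_cmod[of D] by simp
    finally show ?thesis by (simp add: D_def)
  qed
  have nonpos: "1 + z * complex_of_real (exp y) \<notin> \<real>\<^sub>\<le>\<^sub>0" if "z \<in> S" for z y
  proof -
    have "0 < 1 + (Re z + \<sigma> * Im z) * exp y" using that by (simp add: S_def add_pos_pos)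
    then have "Re (1 + z * complex_of_real (exp y)) + \<sigma> * Im (1 + z * complex_of_real (exp y)) > 0"
      by (simp add: algebra_simps)
    then show ?thesis by (auto simp: complex_nonpos_Reals_iff)
  qed
  have real_beta: "integrable lborel (\<lambda>y. exp (Re r * y) * (1 + exp y) powr (- (Re p + Re r)))"
    using has_bochner_integral_Beta_exp[OF p r, THEN integrable.intros, THEN integrable_norm]
    by (simp add: norm_mult norm_powr_real_powr add_pos_pos add_nonneg_nonneg del: of_real_add)
  have bound: "norm (f z y) \<le> (d / 2) powr (- (Re p + Re r)) * exp (pi * \<bar>Im (p + r)\<bar>) *
        (exp (Re r * y) * (1 + exp y) powr (- (Re p + Re r)))"
    if d: "0 < d" "d \<le> 1" "d \<le> Re z + \<sigma> * Im z" for d z y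
  proof -
    have "d * (1 + exp y) \<le> 1 + d * exp y" using d by (simp add: algebra_simps)
    also have "\<dots> \<le> 2 * norm (1 + z * complex_of_real (exp y))" using lower[OF d(3)] .
    finally have le: "d / 2 * (1 + exp y) \<le> norm (1 + z * complex_of_real (exp y))" by simp
    have pos: "0 < d / 2 * (1 + exp y)" using d by (simp add: add_pos_pos)
    have "norm (f z y) \<le> exp (Re r * y) *
        (norm (1 + z * complex_of_real (exp y)) powr (- (Re p + Re r)) * exp (pi * \<bar>Im (p + r)\<bar>))"
      using norm_powr_le[of "1 + z * complex_of_real (exp y)" "- (p + r)"]
      by (simp add: f_def norm_mult abs_minus_commute[of "- Im p"] add.commute)
    also have "\<dots> \<le> exp (Re r * y) *
        ((d / 2 * (1 + exp y)) powr (- (Re p + Re r)) * exp (pi * \<bar>Im (p + r)\<bar>))"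
      using le pos p r by (intro mult_left_mono mult_right_mono powr_mono2') auto
    also have "\<dots> = (d / 2) powr (- (Re p + Re r)) * exp (pi * \<bar>Im (p + r)\<bar>) *
        (exp (Re r * y) * (1 + exp y) powr (- (Re p + Re r)))"
      using d by (subst powr_mult) (auto simp: add_nonneg_nonneg)
    finally show ?thesis .
  qed
  have hol: "(\<lambda>z. integral\<^sup>L lborel (f z)) holomorphic_on S"
  proof (rule holomorphic_on_lebesgue_integral[OF S(1)])
    show "f z \<in> borel_measurable lborel" for z unfolding f_def by measurable
    show "(\<lambda>z. f z y) holomorphic_on S" for y
      unfolding f_def using nonpos by (intro holomorphic_intros) auto
    fix z assume z: "z \<in> S"
    \<comment> \<open>At most 1, as \<open>bound\<close> demands, and at most half of
      \<open>Re z + \<sigma> Im z\<close>; moving by d / 2 changes that functional by at most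
      d.\<close>
    define d where "d = min 1 ((Re z + \<sigma> * Im z) / 2)"
    have d: "d > 0" "d \<le> 1" using z by (auto simp: d_def S_def)
    have u: "d \<le> Re u + \<sigma> * Im u" if "u \<in> cball z (d / 2)" for u
    proof -
      have "\<bar>Re (z - u)\<bar> \<le> d / 2" "\<bar>Im (z - u)\<bar> \<le> d / 2"
        using that abs_Re_le_cmod[of "z - u"] abs_Im_le_cmod[of "z - u"] by (auto simp: dist_norm)
      then have "Re z + \<sigma> * Im z \<le> Re u + \<sigma> * Im u + d"
        unfolding abs_le_iff using \<sigma> by auto
      moreover have "2 * d \<le> Re z + \<sigma> * Im z"
        by (simp add: d_def min_def)
      ultimately show ?thesis by simp
    qed
    show "\<exists>r>0. \<exists>g. cball z r \<subseteq> S \<and> integrable lborel g \<and>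
        (\<forall>u\<in>cball z r. \<forall>x\<in>space lborel. norm (f u x) \<le> g x)"
    proof (intro exI conjI ballI)
      show "cball z (d / 2) \<subseteq> S" using u d by (force simp: S_def)
      show "norm (f v y) \<le> (d / 2) powr (- (Re p + Re r)) * exp (pi * \<bar>Im (p + r)\<bar>) *
        (exp (Re r * y) * (1 + exp y) powr (- (Re p + Re r)))" if "v \<in> cball z (d / 2)" for v y
        using bound d u[OF that] by blast
    qed (use d real_beta in auto)
  qed
  have real: "integral\<^sup>L lborel (f (of_real x)) =
      of_real x powr (- r) * (Gamma p * Gamma r / Gamma (p + r))" if x: "x > 0" for x
  proof -
    have "f (of_real x) (- ln x + y) = of_real x powr (- r) *
        (exp (r * of_real y) * of_real (1 + exp y) powr (- (p + r)))" for y
      using x by (simp add: f_def powr_def Ln_of_real exp_add exp_diff exp_minus exp_of_real field_simps)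
    then show ?thesis
      using lborel_integral_real_affine[of 1 "f (of_real x)" "- ln x"]
        has_bochner_integral_Beta_exp[OF p r, THEN has_bochner_integral_integral_eq] by simp
  qed
  have mem: "\<sigma> * \<i> \<in> S" using \<sigma> by (auto simp: S_def)
  have "integral\<^sup>L lborel (f (\<sigma> * \<i>)) = (\<sigma> * \<i>) powr (- r) * (Gamma p * Gamma r / Gamma (p + r))"
  proof (rule analytic_continuation_pos_real[OF hol _ S _ real mem])
    show "(\<lambda>z. z powr (- r) * (Gamma p * Gamma r / Gamma (p + r))) holomorphic_on S"
      using \<sigma> by (intro holomorphic_intros) (auto simp: S_def complex_nonpos_Reals_iff)
  qed (auto simp: S_def)
  moreover have "integrable lborel (f (\<sigma> * \<i>))"
  proof (rule Bochner_Integration.integrable_bound)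
    show "integrable lborel (\<lambda>y. (1 / 2) powr (- (Re p + Re r)) * exp (pi * \<bar>Im (p + r)\<bar>) *
        (exp (Re r * y) * (1 + exp y) powr (- (Re p + Re r))))"
      by (intro integrable_mult_right real_beta)
    have "1 \<le> Re (\<sigma> * \<i>) + \<sigma> * Im (\<sigma> * \<i>)" using \<sigma> by auto
    then show "AE y in lborel. norm (f (\<sigma> * \<i>) y) \<le> norm ((1 / 2) powr (- (Re p + Re r)) *
        exp (pi * \<bar>Im (p + r)\<bar>) * (exp (Re r * y) * (1 + exp y) powr (- (Re p + Re r))))"
      using order_trans[OF bound[of 1 "\<sigma> * \<i>"] abs_ge_self] by (intro AE_I2) simp
    show "f (\<sigma> * \<i>) \<in> borel_measurable lborel" unfolding f_def by measurable
  qed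
  ultimately show ?thesis
    unfolding has_bochner_integral_iff f_def by simp
qed

section \<open>The regularised hypergeometric series\<close>

lemma norm_pochhammer_le:
  fixes a :: complex
  assumes "norm a \<le> A"
  shows "norm (pochhammer a n) \<le> pochhammer A n"
  unfolding pochhammer_prod prod_norm[symmetric]
proof (rule prod_mono)
  fix i
  have "norm (a + of_nat i) \<le> norm a + real i" by (metis norm_of_nat norm_triangle_ineq)
  then show "0 \<le> norm (a + of_nat i) \<and> norm (a + of_nat i) \<le> A + of_nat i" using assms by simp
qed

lemma fact_le_norm_pochhammer:
  fixes a :: complex
  assumes "Re a \<ge> 1"
  shows "fact n \<le> norm (pochhammer a n)"
  unfolding pochhammer_fact pochhammer_prod prod_norm[symmetric]
proof (rule prod_mono)
  fix i
  have "1 + real i \<le> Re (a + of_nat i)" using assms by simp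
  also have "\<dots> \<le> norm (a + of_nat i)" by (rule complex_Re_le_cmod)
  finally show "0 \<le> 1 + real i \<and> 1 + real i \<le> norm (a + of_nat i)" by simp
qed

definition hypergeo_coeff :: "complex \<Rightarrow> complex \<Rightarrow> complex \<Rightarrow> nat \<Rightarrow> complex" where
  "hypergeo_coeff a b c n = pochhammer a n * pochhammer b n * rGamma (c + of_nat n) / fact n"

lemma hypergeo_reg_eq: "hypergeo_reg a b c z = (\<Sum>n. hypergeo_coeff a b c n * z ^ n)"
  by (simp add: hypergeo_reg_def hypergeo_coeff_def)

text \<open>The bound is uniform in \<open>c\<close> near \<open>c0\<close>, with the poles of Gamma
  allowed. For n \<le> K compactness suffices, and the truncated difference \<open>n - K\<close>
  makes the factorial 1. Beyond K, \<open>rGamma\<close> is divided by a Pochhammer symbol of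
  modulus at least \<open>fact (n - K)\<close>.\<close>

lemma rGamma_shift_bound:
  fixes c0 :: complex
  obtains C K where "\<And>c n. c \<in> cball c0 1 \<Longrightarrow> norm (rGamma (c + of_nat n)) \<le> C / fact (n - K)"
    and "C \<ge> 0"
proof -
  \<comment> \<open>On the ball |c| \<le> |c0| + 1, so this K ensures Re (c + K) \<ge> 1.\<close>
  define K where "K = nat \<lceil>2 + norm c0\<rceil>"
  have K: "real K \<ge> 2 + norm c0" unfolding K_def by linarith
  have "compact (\<Union>n\<le>K. (\<lambda>c. rGamma (c + of_nat n :: complex)) ` cball c0 1)"
    by (intro compact_UN compact_continuous_image holomorphic_on_imp_continuous_on holomorphic_intros) auto
  then obtain C where "\<And>x. x \<in> (\<Union>n\<le>K. (\<lambda>c. rGamma (c + of_nat n)) ` cball c0 1) \<Longrightarrow> norm x \<le> C"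
    using compact_imp_bounded bounded_iff by metis
  then have C: "norm (rGamma (c + of_nat n)) \<le> C" if "n \<le> K" "c \<in> cball c0 1" for n c
    using that by blast
  have "0 \<le> norm (rGamma (c0 + of_nat 0))" by simp
  also have "\<dots> \<le> C" by (rule C) auto
  finally have C0: "C \<ge> 0" .
  show thesis
  proof (rule that[OF _ C0])
    fix c and n :: nat assume c: "c \<in> cball c0 1"
    show "norm (rGamma (c + of_nat n)) \<le> C / fact (n - K)"
    proof (cases "n \<le> K")
      case True
      then show ?thesis using C[OF True c] by simp
    next
      case False
      then obtain m where n: "n = K + m" using le_Suc_ex nat_le_linear by metis
      have "norm c \<le> norm c0 + 1"
        using c norm_triangle_ineq2[of c c0] by (simp add: dist_norm norm_minus_commute)
      then have "Re c \<ge> - norm c0 - 1" using abs_Re_le_cmod[of c] by linarith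
      then have "Re (c + of_nat K) \<ge> 1" using K by simp
      then have p: "fact m \<le> norm (pochhammer (c + of_nat K) m)" by (rule fact_le_norm_pochhammer)
      have "fact m * norm (rGamma (c + of_nat n)) \<le>
          norm (pochhammer (c + of_nat K) m) * norm (rGamma (c + of_nat K + of_nat m))"
        unfolding n using p by (intro mult_mono) (auto simp: add.assoc)
      also have "\<dots> = norm (rGamma (c + of_nat K))"
        by (subst (2) pochhammer_rGamma[of _ m]) (simp add: norm_mult)
      also have "\<dots> \<le> C" by (rule C[OF order_refl c])
      finally show ?thesis by (simp add: n field_simps)
    qed
  qed
qed

text \<open>The shift by K changes the terms by a polynomial factor only, so the ratio of
  consecutive terms, which equals \<open>q n\<close> for n \<ge> K, still tends to \<rho> <
  1.\<close>

lemma summable_hypergeo_majorant: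
  fixes A \<rho> :: real
  assumes "A > 0" "0 \<le> \<rho>" "\<rho> < 1"
  shows "summable (\<lambda>n. pochhammer A n ^ 2 / (fact n * fact (n - K)) * \<rho> ^ n)"
proof -
  define f where "f = (\<lambda>n. pochhammer A n ^ 2 / (fact n * fact (n - K)) * \<rho> ^ n)"
  define q where "q = (\<lambda>n. (A + real n) ^ 2 / ((real n + 1) * (real n + 1 - real K)) * \<rho>)"
  have f0: "f n \<ge> 0" for n using assms by (auto simp: f_def intro!: mult_nonneg_nonneg divide_nonneg_nonneg)
  have ratio: "f (Suc n) = q n * f n" if "n \<ge> K" for n
  proof -
    have "Suc n - K = Suc (n - K)" using that by simp
    moreover have "real (Suc (n - K)) = real n + 1 - real K" using that by simp
    ultimately have "fact (Suc n - K) = (real n + 1 - real K) * fact (n - K)" by (metis fact_Suc)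
    moreover have "real n + 1 - real K \<noteq> 0" using that by linarith
    ultimately show ?thesis
      by (simp add: f_def q_def pochhammer_Suc power_mult_distrib mult_ac add_ac)
  qed
  have "q \<longlonglongrightarrow> 1 * \<rho>"
    unfolding q_def by (intro tendsto_mult tendsto_const) real_asymp
  then have "eventually (\<lambda>n. q n < (1 + \<rho>) / 2) sequentially"
    using assms by (intro order_tendstoD) auto
  then obtain n0 where n0: "\<And>n. n \<ge> n0 \<Longrightarrow> q n < (1 + \<rho>) / 2"
    unfolding eventually_sequentially by blast
  have "summable f"
  proof (rule summable_ratio_test[where c = "(1 + \<rho>) / 2" and N = "max n0 K"])
    fix n assume n: "n \<ge> max n0 K"
    then have "f (Suc n) \<le> (1 + \<rho>) / 2 * f n"
      using ratio[of n] mult_right_mono[OF less_imp_le[OF n0[of n]] f0[of n]] by simp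
    then show "norm (f (Suc n)) \<le> (1 + \<rho>) / 2 * norm (f n)" using f0 by simp
  qed (use assms in auto)
  then show ?thesis by (simp add: f_def)
qed

text \<open>One summable majorant serves all \<open>c\<close> in a ball of radius 1; this yields
  both convergence for fixed \<open>c\<close> and holomorphy in \<open>c\<close>.\<close>

lemma hypergeo_dominated:
  assumes "norm z < 1"
  obtains M where "summable M"
    "\<And>c n. c \<in> cball c0 1 \<Longrightarrow> norm (hypergeo_coeff a b c n * z ^ n) \<le> M n"
proof -
  obtain C K where CK: "\<And>c n. c \<in> cball c0 1 \<Longrightarrow> norm (rGamma (c + of_nat n)) \<le> C / fact (n - K)"
    and C0: "C \<ge> 0" by (rule rGamma_shift_bound) blast
  define A where "A = norm a + norm b + 1"
  have A: "A > 0" "norm a \<le> A" "norm b \<le> A" by (auto simp: A_def add_nonneg_pos)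
  define M where "M = (\<lambda>n. C * (pochhammer A n ^ 2 / (fact n * fact (n - K)) * norm z ^ n))"
  show thesis
  proof (rule that)
    show "summable M"
      unfolding M_def using A assms by (intro summable_mult summable_hypergeo_majorant) auto
    fix c n assume c: "c \<in> cball c0 1"
    have "norm (hypergeo_coeff a b c n * z ^ n) =
        norm (pochhammer a n) * norm (pochhammer b n) * norm (rGamma (c + of_nat n)) * (norm z ^ n / fact n)"
      by (simp add: hypergeo_coeff_def norm_mult norm_divide norm_power)
    also have "\<dots> \<le> pochhammer A n * pochhammer A n * (C / fact (n - K)) * (norm z ^ n / fact n)"
      using A CK[OF c] norm_pochhammer_le by (intro mult_right_mono mult_mono) (auto intro!: mult_nonneg_nonneg pochhammer_nonneg)
    also have "\<dots> = M n" by (simp add: M_def power2_eq_square mult_ac)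
    finally show "norm (hypergeo_coeff a b c n * z ^ n) \<le> M n" .
  qed
qed

lemma summable_hypergeo_coeff:
  assumes "norm z < 1"
  shows "summable (\<lambda>n. hypergeo_coeff a b c n * z ^ n)"
proof -
  obtain M where M: "summable M" "\<And>c' n. c' \<in> cball c 1 \<Longrightarrow> norm (hypergeo_coeff a b c' n * z ^ n) \<le> M n"
    by (rule hypergeo_dominated[OF assms]) blast
  show ?thesis by (rule summable_comparison_test'[OF M(1)], rule M(2)) simp
qed

lemma diffs_hypergeo_coeff:
  "diffs (hypergeo_coeff a b c) = (\<lambda>n. a * b * hypergeo_coeff (a + 1) (b + 1) (c + 1) n)"
  by (rule ext)
     (simp add: diffs_def hypergeo_coeff_def pochhammer_rec field_simps del: of_nat_Suc,
      simp add: algebra_simps)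

lemma suminf_diffs_hypergeo:
  assumes "norm z < 1"
  shows "(\<Sum>n. diffs (hypergeo_coeff a b c) n * z ^ n) = a * b * hypergeo_reg (a + 1) (b + 1) (c + 1) z"
  using suminf_mult[OF summable_hypergeo_coeff[OF assms], of "a * b" "a + 1" "b + 1" "c + 1"]
  by (simp add: diffs_hypergeo_coeff hypergeo_reg_eq mult.assoc)

lemma has_field_derivative_hypergeo_reg:
  assumes "norm z < 1"
  shows "(hypergeo_reg a b c has_field_derivative a * b * hypergeo_reg (a + 1) (b + 1) (c + 1) z) (at z)"
proof -
  define \<rho> where "\<rho> = (1 + norm z) / 2"
  have "norm z < \<rho>" "\<rho> < 1" "\<rho> \<ge> 0" using assms by (auto simp: \<rho>_def)
  then have K: "norm z < norm (complex_of_real \<rho>)" "norm (complex_of_real \<rho>) < 1" by simp_all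
  have "((\<lambda>z. \<Sum>n. hypergeo_coeff a b c n * z ^ n) has_field_derivative
      (\<Sum>n. diffs (hypergeo_coeff a b c) n * z ^ n)) (at z)"
    by (rule termdiffs_strong[OF summable_hypergeo_coeff[OF K(2)] K(1)])
  then show ?thesis
    using suminf_diffs_hypergeo[OF assms] by (simp add: hypergeo_reg_eq[abs_def])
qed

lemma hypergeo_coeff_Suc:
  "of_nat (Suc n) * (c + of_nat n) * hypergeo_coeff a b c (Suc n) =
     (a + of_nat n) * (b + of_nat n) * hypergeo_coeff a b c n"
proof -
  have "rGamma (c + of_nat n) = (c + of_nat n) * rGamma (c + of_nat n + 1)"
    by (rule rGamma_plus1[symmetric])
  then show ?thesis
    by (simp add: hypergeo_coeff_def pochhammer_Suc field_simps del: of_nat_Suc) (simp add: algebra_simps)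
qed

text \<open>The hypergeometric equation, with the derivatives written as series with raised
  parameters. Coefficientwise it is the two-term recurrence \<open>hypergeo_coeff_Suc\<close>, since
  applying z d/dz multiplies the n-th coefficient by n.\<close>

lemma hypergeo_reg_ode:
  assumes z: "norm z < 1"
  shows "z * (1 - z) * (a * b * ((a + 1) * (b + 1) * hypergeo_reg (a + 2) (b + 2) (c + 2) z)) +
     (c - (a + b + 1) * z) * (a * b * hypergeo_reg (a + 1) (b + 1) (c + 1) z) = a * b * hypergeo_reg a b c z"
proof -
  define h where "h = hypergeo_coeff a b c"
  define F0 where "F0 = hypergeo_reg a b c z"
  define F1 where "F1 = a * b * hypergeo_reg (a + 1) (b + 1) (c + 1) z"
  define F2 where "F2 = a * b * ((a + 1) * (b + 1) * hypergeo_reg (a + 2) (b + 2) (c + 2) z)"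
  have s0: "(\<lambda>n. h n * z ^ n) sums F0"
    unfolding h_def F0_def hypergeo_reg_eq by (rule summable_sums[OF summable_hypergeo_coeff[OF z]])
  have summ1: "summable (\<lambda>n. diffs h n * z ^ n)"
    unfolding h_def diffs_hypergeo_coeff mult.assoc
    by (intro summable_mult) (use summable_hypergeo_coeff[OF z] in auto)
  then have s1: "(\<lambda>n. diffs h n * z ^ n) sums F1"
    using suminf_diffs_hypergeo[OF z] unfolding h_def F1_def by (simp add: sums_iff)
  have s1': "(\<lambda>n. of_nat n * h n * z ^ n) sums (z * F1)"
  proof -
    have "(\<lambda>n. z * (of_nat n * h n * z ^ (n - Suc 0))) sums (z * F1)"
      using diffs_equiv[OF summ1] s1 by (intro sums_mult) (simp add: sums_iff)
    moreover have "z * (of_nat n * h n * z ^ (n - Suc 0)) = of_nat n * h n * z ^ n" for n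
      by (cases n) auto
    ultimately show ?thesis by simp
  qed
  have diffs2: "diffs (diffs h) = (\<lambda>n. a * b * ((a + 1) * (b + 1) * hypergeo_coeff (a + 2) (b + 2) (c + 2) n))"
  proof -
    have "diffs (\<lambda>n. a * b * f n) = (\<lambda>n. a * b * diffs f n)" for f
      by (simp add: diffs_def fun_eq_iff)
    then show ?thesis by (simp add: h_def diffs_hypergeo_coeff add.assoc)
  qed
  have s2: "(\<lambda>n. diffs (diffs h) n * z ^ n) sums F2"
    unfolding diffs2 F2_def hypergeo_reg_eq mult.assoc
    by (intro sums_mult summable_sums[OF summable_hypergeo_coeff[OF z]])
  have s2': "(\<lambda>n. of_nat n * diffs h n * z ^ n) sums (z * F2)"
  proof -
    have "(\<lambda>n. z * (of_nat n * diffs h n * z ^ (n - Suc 0))) sums (z * F2)"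
      using diffs_equiv[OF sums_summable[OF s2]] s2 by (intro sums_mult) (simp add: sums_iff)
    moreover have "z * (of_nat n * diffs h n * z ^ (n - Suc 0)) = of_nat n * diffs h n * z ^ n" for n
      by (cases n) auto
    ultimately show ?thesis by simp
  qed
  \<comment> \<open>The shifted series starts at n = 1; the missing term at n = 0 is 0.\<close>
  have s2'': "(\<lambda>n. of_nat n * (of_nat n - 1) * h n * z ^ n) sums (z * (z * F2))"
  proof -
    have "(\<lambda>n. z * (of_nat n * diffs h n * z ^ n)) sums (z * (z * F2))"
      by (rule sums_mult[OF s2'])
    then have "(\<lambda>n. of_nat (Suc n) * (of_nat (Suc n) - 1) * h (Suc n) * z ^ Suc n) sums (z * (z * F2))"
      by (simp add: diffs_def mult_ac)
    then show ?thesis by (subst (asm) sums_Suc_iff) simp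
  qed
  have "(\<lambda>n. of_nat n * diffs h n * z ^ n - of_nat n * (of_nat n - 1) * h n * z ^ n +
      (c * (diffs h n * z ^ n) - (a + b + 1) * (of_nat n * h n * z ^ n)) - a * b * (h n * z ^ n))
      sums (z * F2 - z * (z * F2) + (c * F1 - (a + b + 1) * (z * F1)) - a * b * F0)"
    by (intro sums_diff sums_add sums_mult s0 s1 s1' s2' s2'')
  moreover have "of_nat n * diffs h n * z ^ n - of_nat n * (of_nat n - 1) * h n * z ^ n +
      (c * (diffs h n * z ^ n) - (a + b + 1) * (of_nat n * h n * z ^ n)) - a * b * (h n * z ^ n) = 0" for n
  proof -
    have "of_nat n * diffs h n * z ^ n - of_nat n * (of_nat n - 1) * h n * z ^ n +
      (c * (diffs h n * z ^ n) - (a + b + 1) * (of_nat n * h n * z ^ n)) - a * b * (h n * z ^ n) =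
      (of_nat (Suc n) * (c + of_nat n) * h (Suc n) - (a + of_nat n) * (b + of_nat n) * h n) * z ^ n"
      by (simp add: diffs_def algebra_simps)
    then show ?thesis using hypergeo_coeff_Suc[of n c a b] by (simp add: h_def)
  qed
  ultimately have "z * F2 - z * (z * F2) + (c * F1 - (a + b + 1) * (z * F1)) - a * b * F0 = 0"
    by (simp only: sums_iff suminf_zero)
  then show ?thesis
    unfolding F0_def[symmetric] F1_def[symmetric] F2_def[symmetric] by (simp add: algebra_simps)
qed

text \<open>The series is read as an integral over the counting measure, so the theorem on parameter
  integrals covers it. Holomorphy in \<open>c\<close> is what permits continuation in the order
  \<mu> across the integers.\<close>

lemma holomorphic_hypergeo_reg_param:
  assumes z: "norm z < 1"
  shows "(\<lambda>c. hypergeo_reg a b c z) holomorphic_on S"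
proof -
  have "(\<lambda>c. integral\<^sup>L (count_space UNIV) (\<lambda>n. hypergeo_coeff a b c n * z ^ n)) holomorphic_on UNIV"
  proof (rule holomorphic_on_lebesgue_integral)
    show "(\<lambda>c. hypergeo_coeff a b c n * z ^ n) holomorphic_on UNIV" for n
      unfolding hypergeo_coeff_def by (intro holomorphic_intros) auto
    fix c0 :: complex
    obtain M where M: "summable M" "\<And>c n. c \<in> cball c0 1 \<Longrightarrow> norm (hypergeo_coeff a b c n * z ^ n) \<le> M n"
      by (rule hypergeo_dominated[OF z]) blast
    have "0 \<le> M n" for n using order_trans[OF norm_ge_zero M(2)[of c0 n]] by simp
    then have "integrable (count_space UNIV) M"
      using M(1) by (simp add: integrable_count_space_nat_iff)
    then show "\<exists>r>0. \<exists>g. cball c0 r \<subseteq> UNIV \<and> integrable (count_space UNIV) g \<and>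
        (\<forall>u\<in>cball c0 r. \<forall>x\<in>space (count_space UNIV). norm (hypergeo_coeff a b u x * z ^ x) \<le> g x)"
      using M(2) by (intro exI[of _ 1] exI[of _ M]) auto
  qed auto
  moreover have "integral\<^sup>L (count_space UNIV) (\<lambda>n. hypergeo_coeff a b c n * z ^ n) = hypergeo_reg a b c z" for c
  proof -
    obtain M where M: "summable M" "\<And>c' n. c' \<in> cball c 1 \<Longrightarrow> norm (hypergeo_coeff a b c' n * z ^ n) \<le> M n"
      by (rule hypergeo_dominated[OF z]) blast
    have "summable (\<lambda>n. norm (hypergeo_coeff a b c n * z ^ n))"
      by (rule summable_comparison_test'[OF M(1)], unfold real_norm_def abs_norm_cancel, rule M(2)) simp
    then show ?thesis
      by (simp add: integral_count_space_nat integrable_count_space_nat_iff hypergeo_reg_eq)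
  qed
  ultimately show ?thesis by (auto intro: holomorphic_on_subset)
qed

lemma hypergeo_reg_0 [simp]: "hypergeo_reg a b c 0 = rGamma c"
  using powser_zero[of "hypergeo_coeff a b c"] by (simp add: hypergeo_reg_eq) (simp add: hypergeo_coeff_def)

section \<open>A Laplace-type integral\<close>

lemma cosh_complex_of_real: "cosh (complex_of_real x) = of_real (cosh x)"
  by (simp add: cosh_def exp_of_real scaleR_conv_of_real flip: of_real_minus)

lemma sinh_complex_of_real: "sinh (complex_of_real x) = of_real (sinh x)"
  by (simp add: sinh_def exp_of_real scaleR_conv_of_real flip: of_real_minus)

lemma exp_abs_le_cosh: "exp \<bar>x\<bar> \<le> 2 * cosh (x::real)"
  by (cases "x \<ge> 0") (simp_all add: cosh_def)

lemma abs_sinh_le_exp: "\<bar>sinh x\<bar> \<le> exp \<bar>x::real\<bar>"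
proof (cases "x \<ge> 0")
  case True
  moreover have "exp (- x) \<le> exp x" using True by simp
  moreover have "exp (- x) > 0" "exp x > 0" by simp_all
  ultimately show ?thesis by (simp add: sinh_def, linarith)
next
  case False
  then have "exp x \<le> exp (- x)" by simp
  moreover have "exp x > 0" by simp
  moreover have "exp (- x) > 0" by simp
  ultimately show ?thesis using False by (simp add: sinh_def, linarith)
qed

lemma exp_times_le_exp_abs: "exp (m * x) \<le> exp (\<bar>m\<bar> * \<bar>x\<bar>)" for m x :: real
  by (metis abs_ge_self abs_mult exp_le_cancel_iff)

text \<open>Serves to integrate by parts over the whole line: the exponential decay of
  \<open>F\<close> removes the boundary terms of the truncated integrals.\<close>

lemma integral_of_derivative_eq_0:
  fixes F f :: "real \<Rightarrow> complex"
  assumes F: "\<And>x. (F has_vector_derivative f x) (at x)"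
    and cont: "continuous_on UNIV f"
    and f: "integrable lborel f"
    and bound: "\<And>x. norm (F x) \<le> C * exp (- c * \<bar>x\<bar>)" and c: "c > 0"
  shows "integral\<^sup>L lborel f = 0"
proof -
  have "(\<lambda>n. \<integral>x. indicator {- real n..real n} x *\<^sub>R f x \<partial>lborel) \<longlonglongrightarrow> integral\<^sup>L lborel f"
  proof (rule integral_dominated_convergence[where w = "\<lambda>x. norm (f x)"])
    show "AE x in lborel. (\<lambda>n. indicator {- real n..real n} x *\<^sub>R f x) \<longlonglongrightarrow> f x"
    proof (rule AE_I2)
      fix x :: real
      obtain n0 :: nat where "\<bar>x\<bar> \<le> real n0" using real_arch_simple by blast
      then have "\<forall>n\<ge>n0. indicator {- real n..real n} x *\<^sub>R f x = f x"
        by (auto simp: indicator_def abs_le_iff)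
      then show "(\<lambda>n. indicator {- real n..real n} x *\<^sub>R f x) \<longlonglongrightarrow> f x"
        by (intro tendsto_eventually) (auto simp: eventually_sequentially)
    qed
  qed (use f in \<open>auto split: split_indicator\<close>)
  moreover have "(\<integral>x. indicator {- real n..real n} x *\<^sub>R f x \<partial>lborel) = F (real n) - F (- real n)" for n
    by (rule integral_FTC_Icc)
       (use F cont in \<open>auto intro: has_vector_derivative_at_within continuous_on_subset\<close>)
  moreover have "(\<lambda>n. F (real n) - F (- real n)) \<longlonglongrightarrow> 0 - 0"
  proof (intro tendsto_diff)
    have e: "(\<lambda>n. C * exp (- c * real n)) \<longlonglongrightarrow> 0" using c by real_asymp
    show "(\<lambda>n. F (real n)) \<longlonglongrightarrow> 0" "(\<lambda>n. F (- real n)) \<longlonglongrightarrow> 0"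
      by (rule tendsto_norm_zero_cancel, rule tendsto_sandwich[OF _ _ tendsto_const e];
          use bound[of "real _"] bound[of "- real _"] in simp)+
  qed
  ultimately show ?thesis using LIMSEQ_unique by fastforce
qed

text \<open>The exponent \<open>k\<close> is kept free, although \<nu> + 1 is the value of interest,
  because each derivative in \<open>w\<close> raises it by 1.\<close>

definition laplace_kernel :: "complex \<Rightarrow> complex \<Rightarrow> complex \<Rightarrow> real \<Rightarrow> complex" where
  "laplace_kernel \<mu> k w b = exp (\<mu> * of_real b) * (of_real (cosh b - 1) + w) powr (- k)"

definition laplace_int :: "complex \<Rightarrow> complex \<Rightarrow> complex \<Rightarrow> complex" where
  "laplace_int \<mu> k w = (\<integral>b. laplace_kernel \<mu> k w b \<partial>lborel)"

text \<open>For d \<le> 1 one has d cosh b \<le> cosh b - 1 + d; hence the minimum with 1 in the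
  choices of \<open>d\<close> below.\<close>

lemma Re_laplace_base:
  assumes "d \<le> 1" "d \<le> Re w" "0 \<le> d"
  shows "d / 2 * exp \<bar>b\<bar> \<le> Re (of_real (cosh b - 1) + w)"
proof -
  have "d / 2 * exp \<bar>b\<bar> \<le> d * cosh b"
    using exp_abs_le_cosh[of b] mult_left_mono[of "exp \<bar>b\<bar>" "2 * cosh b" "d / 2"] assms by simp
  also have "\<dots> \<le> cosh b - 1 + d"
    using mult_right_mono[of d 1 "cosh b - 1"] assms cosh_real_ge_1[of b] by (simp add: algebra_simps)
  finally show ?thesis using assms by simp
qed

lemma laplace_base_Re_pos: "Re w > 0 \<Longrightarrow> Re (of_real (cosh b - 1) + w) > 0"
  using cosh_real_ge_1[of b] by simp

lemma laplace_base_nonpos: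
  assumes "Re w > 0"
  shows "of_real (cosh b - 1) + w \<notin> \<real>\<^sub>\<le>\<^sub>0"
  using assms cosh_real_ge_1[of b] by (auto simp: complex_nonpos_Reals_iff)

lemma norm_laplace_powr_le:
  assumes d: "0 < d" "d \<le> 1" "d \<le> Re w" and k: "Re k > 0"
  shows "norm ((of_real (cosh b - 1) + w) powr (- k)) \<le>
    (d / 2) powr (- Re k) * exp (pi * \<bar>Im k\<bar>) * exp (- Re k * \<bar>b\<bar>)"
proof -
  let ?D = "of_real (cosh b - 1) + w"
  have "d / 2 * exp \<bar>b\<bar> \<le> norm ?D"
    using Re_laplace_base[of d w b] d complex_Re_le_cmod[of ?D] by simp
  then have "norm ?D powr (- Re k) \<le> (d / 2 * exp \<bar>b\<bar>) powr (- Re k)"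
    using d k by (intro powr_mono2') auto
  also have "\<dots> = (d / 2) powr (- Re k) * exp (- Re k * \<bar>b\<bar>)"
    using d by (subst powr_mult) (auto simp: powr_def)
  finally have *: "norm ?D powr (- Re k) \<le> (d / 2) powr (- Re k) * exp (- Re k * \<bar>b\<bar>)" .
  have "norm (?D powr (- k)) \<le> norm ?D powr (- Re k) * exp (pi * \<bar>Im k\<bar>)"
    using norm_powr_le[of ?D "- k"] by simp
  also have "\<dots> \<le> (d / 2) powr (- Re k) * exp (- Re k * \<bar>b\<bar>) * exp (pi * \<bar>Im k\<bar>)"
    by (rule mult_right_mono[OF *]) simp
  finally show ?thesis by (simp only: mult_ac)
qed

lemma norm_laplace_kernel_le:
  assumes "0 < d" "d \<le> 1" "d \<le> Re w" "Re k > 0" "\<bar>Re \<mu>\<bar> \<le> m"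
  shows "norm (laplace_kernel \<mu> k w b) \<le>
    (d / 2) powr (- Re k) * exp (pi * \<bar>Im k\<bar>) * exp (- (Re k - m) * \<bar>b\<bar>)"
proof -
  have "norm (exp (\<mu> * of_real b)) \<le> exp (m * \<bar>b\<bar>)"
  proof -
    have "exp (\<bar>Re \<mu>\<bar> * \<bar>b\<bar>) \<le> exp (m * \<bar>b\<bar>)" using assms(5) by (simp add: mult_right_mono)
    with exp_times_le_exp_abs[of "Re \<mu>" b] have "exp (Re \<mu> * b) \<le> exp (m * \<bar>b\<bar>)" by linarith
    then show ?thesis by (simp add: norm_exp_eq_Re)
  qed
  then have "norm (laplace_kernel \<mu> k w b) \<le>
      exp (m * \<bar>b\<bar>) * ((d / 2) powr (- Re k) * exp (pi * \<bar>Im k\<bar>) * exp (- Re k * \<bar>b\<bar>))"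
    unfolding laplace_kernel_def norm_mult
    using norm_laplace_powr_le[OF assms(1-4)] by (intro mult_mono) auto
  also have "exp (m * \<bar>b\<bar>) * ((d / 2) powr (- Re k) * exp (pi * \<bar>Im k\<bar>) * exp (- Re k * \<bar>b\<bar>)) =
      (d / 2) powr (- Re k) * exp (pi * \<bar>Im k\<bar>) * (exp (m * \<bar>b\<bar>) * exp (- Re k * \<bar>b\<bar>))"
    by (simp only: mult_ac)
  also have "exp (m * \<bar>b\<bar>) * exp (- Re k * \<bar>b\<bar>) = exp (- (Re k - m) * \<bar>b\<bar>)"
    by (simp add: algebra_simps flip: exp_add)
  finally show ?thesis .
qed

lemma laplace_kernel_measurable [measurable]: "laplace_kernel \<mu> k w \<in> borel_measurable borel"
  unfolding laplace_kernel_def[abs_def] cosh_def by measurable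

lemma integrable_laplace_kernel:
  assumes "Re w > 0" "\<bar>Re \<mu>\<bar> < Re k"
  shows "integrable lborel (laplace_kernel \<mu> k w)"
  by (rule integrable_exp_dominated[OF _ _ norm_laplace_kernel_le[of "min 1 (Re w)" w k \<mu> "\<bar>Re \<mu>\<bar>"]])
     (use assms in auto)

lemma laplace_kernel_minus: "laplace_kernel (- \<mu>) k w b = laplace_kernel \<mu> k w (- b)"
  by (simp add: laplace_kernel_def)

text \<open>Evenness in the order comes from the reflection of b. It supplies the second Wronskian
  in \<open>ferrers_connection\<close>.\<close>

lemma laplace_int_minus: "laplace_int (- \<mu>) k w = laplace_int \<mu> k w"
  using lborel_integral_real_affine[of "-1" "laplace_kernel \<mu> k w" 0]
  by (simp add: laplace_int_def laplace_kernel_minus)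

lemma has_field_derivative_laplace_int:
  assumes w: "Re w > 0" and \<mu>: "\<bar>Re \<mu>\<bar> < Re k"
  shows "(laplace_int \<mu> k has_field_derivative - k * laplace_int \<mu> (k + 1) w) (at w)"
proof -
  let ?S = "{w. Re w > 0}"
  have "((\<lambda>w. \<integral>b. laplace_kernel \<mu> k w b \<partial>lborel) has_field_derivative
      (\<integral>b. deriv (\<lambda>w. laplace_kernel \<mu> k w b) w \<partial>lborel)) (at w)"
  proof (rule has_field_derivative_lebesgue_integral[where S = ?S])
    show "open ?S" by (rule open_halfspace_Re_gt)
    show "(\<lambda>w. laplace_kernel \<mu> k w b) holomorphic_on ?S" for b
      unfolding laplace_kernel_def by (intro holomorphic_intros) (auto simp del: of_real_diff dest: laplace_base_nonpos)
    define d where "d = min 1 (Re w / 2)"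
    have d: "0 < d" "d \<le> 1" "d \<le> Re w / 2" using w by (auto simp: d_def)
    have u: "d \<le> Re u" if "u \<in> cball w d" for u
    proof -
      have "\<bar>Re (w - u)\<bar> \<le> d" using that abs_Re_le_cmod[of "w - u"] by (simp add: dist_norm)
      then show ?thesis using d by simp
    qed
    show "\<exists>r>0. \<exists>g. cball w r \<subseteq> ?S \<and> integrable lborel g \<and>
        (\<forall>u\<in>cball w r. \<forall>x\<in>space lborel. norm (laplace_kernel \<mu> k u x) \<le> g x)"
    proof (intro exI conjI ballI)
      show "d > 0" by fact
      show "cball w d \<subseteq> ?S" using u d by force
      show "integrable lborel (\<lambda>b. (d / 2) powr (- Re k) * exp (pi * \<bar>Im k\<bar>) * exp (- (Re k - \<bar>Re \<mu>\<bar>) * \<bar>b\<bar>))"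
        using \<mu> by (intro integrable_mult_right integrable_exp_neg_abs) auto
      show "norm (laplace_kernel \<mu> k v x) \<le>
          (d / 2) powr (- Re k) * exp (pi * \<bar>Im k\<bar>) * exp (- (Re k - \<bar>Re \<mu>\<bar>) * \<bar>x\<bar>)"
        if "v \<in> cball w d" for v x
        using u[OF that] d \<mu> by (intro norm_laplace_kernel_le) auto
    qed
  qed (use w in auto)
  moreover have "deriv (\<lambda>w. laplace_kernel \<mu> k w b) w = - k * laplace_kernel \<mu> (k + 1) w b" for b
    unfolding laplace_kernel_def
    by (rule DERIV_imp_deriv)
       (rule derivative_eq_intros refl laplace_base_nonpos[OF w] | simp add: algebra_simps minus_diff_commute)+
  ultimately show ?thesis by (simp add: laplace_int_def[abs_def])
qed

lemma holomorphic_laplace_int_order: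
  assumes w: "Re w > 0"
  shows "(\<lambda>\<mu>. laplace_int \<mu> k w) holomorphic_on {\<mu>. \<bar>Re \<mu>\<bar> < Re k}"
  unfolding laplace_int_def
proof (rule holomorphic_on_lebesgue_integral)
  show "open {\<mu>. \<bar>Re \<mu>\<bar> < Re k}" by (intro open_Collect_less continuous_intros)
  show "(\<lambda>\<mu>. laplace_kernel \<mu> k w b) holomorphic_on {\<mu>. \<bar>Re \<mu>\<bar> < Re k}" for b
    unfolding laplace_kernel_def by (intro holomorphic_intros)
  fix \<mu> assume "\<mu> \<in> {\<mu>. \<bar>Re \<mu>\<bar> < Re k}"
  then have \<mu>: "\<bar>Re \<mu>\<bar> < Re k" by simp
  \<comment> \<open>The midpoint between |Re \<mu>| and Re k: on the disc of radius m - |Re \<mu>|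
    all orders have real part at most \<open>m\<close> in modulus, which leaves the decay rate Re k
    - m.\<close>
  define m where "m = (\<bar>Re \<mu>\<bar> + Re k) / 2"
  have m: "m - \<bar>Re \<mu>\<bar> > 0" "m < Re k" using \<mu> by (auto simp: m_def field_simps)
  have u: "\<bar>Re v\<bar> \<le> m" if "v \<in> cball \<mu> (m - \<bar>Re \<mu>\<bar>)" for v
    using that abs_Re_le_cmod[of "\<mu> - v"] by (simp add: dist_norm)
  show "\<exists>r>0. \<exists>g. cball \<mu> r \<subseteq> {\<mu>. \<bar>Re \<mu>\<bar> < Re k} \<and> integrable lborel g \<and>
      (\<forall>u\<in>cball \<mu> r. \<forall>x\<in>space lborel. norm (laplace_kernel u k w x) \<le> g x)"
  proof (intro exI conjI ballI)
    show "m - \<bar>Re \<mu>\<bar> > 0" by fact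
    show "cball \<mu> (m - \<bar>Re \<mu>\<bar>) \<subseteq> {\<mu>. \<bar>Re \<mu>\<bar> < Re k}" using u m by force
    show "integrable lborel (\<lambda>b. (min 1 (Re w) / 2) powr (- Re k) * exp (pi * \<bar>Im k\<bar>) * exp (- (Re k - m) * \<bar>b\<bar>))"
      using m by (intro integrable_mult_right integrable_exp_neg_abs) auto
    show "norm (laplace_kernel v k w x) \<le>
        (min 1 (Re w) / 2) powr (- Re k) * exp (pi * \<bar>Im k\<bar>) * exp (- (Re k - m) * \<bar>x\<bar>)"
      if "v \<in> cball \<mu> (m - \<bar>Re \<mu>\<bar>)" for v x
      using u[OF that] w m \<mu> by (intro norm_laplace_kernel_le) auto
  qed
qed simp

text \<open>With D = cosh b - 1 + w, two integrations by parts trade \<mu>^2 for the second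
  derivative of D^(-k). That derivative involves cosh and sinh^2, which are polynomials in D, so
  only the exponents k, k + 1 and k + 2 occur. As differentiation in \<open>w\<close> raises the
  exponent, this is a second-order differential equation in \<open>w\<close>.\<close>

lemma laplace_int_recurrence:
  assumes w: "Re w > 0" and \<mu>: "\<bar>Re \<mu>\<bar> < Re k"
  shows "(\<mu>\<^sup>2 - k\<^sup>2) * laplace_int \<mu> k w + k * (2 * k + 1) * (w - 1) * laplace_int \<mu> (k + 1) w
     = k * (k + 1) * w * (w - 2) * laplace_int \<mu> (k + 2) w"
proof -
  define D where "D = (\<lambda>t::complex. cosh t - 1 + w)"
  \<comment> \<open>This is exp (\<mu> t) (\<mu> D^(-k) - (D^(-k))'), whose derivative is exp (\<mu>
    t) (\<mu>^2 D^(-k) - (D^(-k))'').\<close>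
  define \<Phi> where "\<Phi> = (\<lambda>t. exp (\<mu> * t) * (\<mu> * D t powr (- k) + k * sinh t * D t powr (- k - 1)))"
  have D_real: "D (of_real b) = of_real (cosh b - 1) + w" for b
    by (simp add: D_def cosh_complex_of_real)
  have Dn: "D (of_real b) \<notin> \<real>\<^sub>\<le>\<^sub>0" for b
    unfolding D_real using laplace_base_nonpos[OF w] .
  have D0: "D (of_real b) \<noteq> 0" for b using Dn[of b] by auto
  define \<phi> where "\<phi> = (\<lambda>b. (\<mu>\<^sup>2 - k\<^sup>2) * laplace_kernel \<mu> k w b
      + k * (2 * k + 1) * (w - 1) * laplace_kernel \<mu> (k + 1) w b
      - k * (k + 1) * w * (w - 2) * laplace_kernel \<mu> (k + 2) w b)"
  have der: "(\<Phi> has_field_derivative \<phi> b) (at (of_real b))" for b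
  proof -
    define p where "p = D (of_real b) powr (- k)"
    define s where "s = sinh (complex_of_real b)"
    define c where "c = cosh (complex_of_real b)"
    define x where "x = D (of_real b)"
    have x0: "x \<noteq> 0" using D0 by (simp add: x_def)
    have p1: "D (of_real b) powr (- k - 1) = p / x"
      using x0 by (simp add: p_def x_def powr_diff)
    have p2: "D (of_real b) powr (- k - 2) = p / x\<^sup>2"
      using x0 by (simp add: p_def x_def powr_diff powr_numeral)
    have "(\<Phi> has_field_derivative
        exp (\<mu> * of_real b) * (\<mu> * ((- k) * (D (of_real b) powr (- k - 1) * s)) +
          (k * c * D (of_real b) powr (- k - 1) + k * s * ((- k - 1) * (D (of_real b) powr (- k - 2) * s)))) +
        \<mu> * exp (\<mu> * of_real b) * (\<mu> * D (of_real b) powr (- k) + k * s * D (of_real b) powr (- k - 1)))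
        (at (of_real b))"
      unfolding \<Phi>_def s_def c_def D_def
      by (rule derivative_eq_intros refl Dn[unfolded D_def] | simp add: algebra_simps)+
    also have "exp (\<mu> * of_real b) * (\<mu> * ((- k) * (D (of_real b) powr (- k - 1) * s)) +
          (k * c * D (of_real b) powr (- k - 1) + k * s * ((- k - 1) * (D (of_real b) powr (- k - 2) * s)))) +
        \<mu> * exp (\<mu> * of_real b) * (\<mu> * D (of_real b) powr (- k) + k * s * D (of_real b) powr (- k - 1))
      = exp (\<mu> * of_real b) * p * (\<mu>\<^sup>2 + k * c / x - k * (k + 1) * s\<^sup>2 / x\<^sup>2)"
      unfolding p1 p2 p_def[symmetric] using x0 by (simp add: field_simps power2_eq_square)
    also have "c = x + 1 - w" by (simp add: x_def c_def D_def)
    \<comment> \<open>This is cosh^2 - 1 expanded in powers of x; its constant term w (w - 2)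
      becomes - cosh^2 t at the points w = 1 - \<sigma> i sinh t used later.\<close>
    also have "s\<^sup>2 = x\<^sup>2 - 2 * (w - 1) * x + w * (w - 2)"
    proof -
      have "s\<^sup>2 = c\<^sup>2 - 1" unfolding s_def c_def by (simp add: sinh_square_eq)
      also have "c = x + 1 - w" by (simp add: x_def c_def D_def)
      finally show ?thesis by (simp add: power2_eq_square algebra_simps)
    qed
    also have "exp (\<mu> * of_real b) * p *
        (\<mu>\<^sup>2 + k * (x + 1 - w) / x - k * (k + 1) * (x\<^sup>2 - 2 * (w - 1) * x + w * (w - 2)) / x\<^sup>2) =
        exp (\<mu> * of_real b) * ((\<mu>\<^sup>2 - k\<^sup>2) * p + k * (2 * k + 1) * (w - 1) * (p / x)
          - k * (k + 1) * w * (w - 2) * (p / x\<^sup>2))"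
      using x0 by (simp add: field_simps power2_eq_square)
    also have "\<dots> = \<phi> b"
    proof -
      have "- (k + 1) = - k - 1" "- (k + 2) = - k - 2" by simp_all
      then show ?thesis
        unfolding \<phi>_def laplace_kernel_def D_real[symmetric]
        by (simp only: p1 p2 p_def[symmetric]) (simp only: algebra_simps)
    qed
    finally show ?thesis .
  qed
  have int: "integrable lborel (laplace_kernel \<mu> k w)" "integrable lborel (laplace_kernel \<mu> (k + 1) w)"
      "integrable lborel (laplace_kernel \<mu> (k + 2) w)"
    using \<mu> by (auto intro!: integrable_laplace_kernel[OF w])
  have cont: "continuous_on UNIV (laplace_kernel \<mu> k' w)" for k'
    unfolding laplace_kernel_def[abs_def]
  proof (intro continuous_intros)
    show "UNIV \<subseteq> {x. 0 \<le> Re (of_real (cosh x - 1) + w) \<or> Im (of_real (cosh x - 1) + w) \<noteq> 0}"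
      using less_imp_le[OF laplace_base_Re_pos[OF w]] by blast
    show "0 < Re (- k')" if "complex_of_real (cosh x - 1) + w = 0" for x
      using laplace_base_Re_pos[OF w, of x] unfolding that by simp
  qed
  define d where "d = min 1 (Re w)"
  have d: "0 < d" "d \<le> 1" "d \<le> Re w" using w by (auto simp: d_def)
  have k: "Re k > 0" using \<mu> by linarith
  have k1: "Re (k + 1) > 0" using k by simp
  define C0 where "C0 = norm \<mu> * ((d / 2) powr (- Re k) * exp (pi * \<bar>Im k\<bar>))"
  define C1 where "C1 = norm k * ((d / 2) powr (- Re (k + 1)) * exp (pi * \<bar>Im (k + 1)\<bar>))"
  have "integral\<^sup>L lborel \<phi> = 0"
  proof (rule integral_of_derivative_eq_0[where F = "\<lambda>x. \<Phi> (of_real x)"])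
    show "((\<lambda>x. \<Phi> (of_real x)) has_vector_derivative \<phi> b) (at b)" for b
      using der by (rule has_vector_derivative_real_field)
    show "continuous_on UNIV \<phi>" unfolding \<phi>_def by (intro continuous_intros cont)
    show "integrable lborel \<phi>" unfolding \<phi>_def using int by auto
    show "Re k - \<bar>Re \<mu>\<bar> > 0" using \<mu> by simp
    fix b
    have A: "norm (laplace_kernel \<mu> k w b) \<le> (d / 2) powr (- Re k) * exp (pi * \<bar>Im k\<bar>) * exp (- (Re k - \<bar>Re \<mu>\<bar>) * \<bar>b\<bar>)"
      by (rule norm_laplace_kernel_le) (use d k in auto)
    have "norm (of_real (sinh b) * laplace_kernel \<mu> (k + 1) w b) \<le>
        exp \<bar>b\<bar> * ((d / 2) powr (- Re (k + 1)) * exp (pi * \<bar>Im (k + 1)\<bar>) * exp (- (Re (k + 1) - \<bar>Re \<mu>\<bar>) * \<bar>b\<bar>))"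
      unfolding norm_mult using abs_sinh_le_exp[of b] d k1
      by (intro mult_mono norm_laplace_kernel_le) auto
    also have "\<dots> = (d / 2) powr (- Re (k + 1)) * exp (pi * \<bar>Im (k + 1)\<bar>) *
        (exp \<bar>b\<bar> * exp (- (Re (k + 1) - \<bar>Re \<mu>\<bar>) * \<bar>b\<bar>))" by (simp only: mult_ac)
    also have "exp \<bar>b\<bar> * exp (- (Re (k + 1) - \<bar>Re \<mu>\<bar>) * \<bar>b\<bar>) = exp (- (Re k - \<bar>Re \<mu>\<bar>) * \<bar>b\<bar>)"
      by (simp add: algebra_simps flip: exp_add)
    finally have B: "norm (of_real (sinh b) * laplace_kernel \<mu> (k + 1) w b) \<le>
        (d / 2) powr (- Re (k + 1)) * exp (pi * \<bar>Im (k + 1)\<bar>) * exp (- (Re k - \<bar>Re \<mu>\<bar>) * \<bar>b\<bar>)" .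
    have "\<Phi> (of_real b) = \<mu> * laplace_kernel \<mu> k w b + k * (of_real (sinh b) * laplace_kernel \<mu> (k + 1) w b)"
      by (simp add: \<Phi>_def laplace_kernel_def D_def cosh_complex_of_real sinh_complex_of_real algebra_simps minus_diff_commute)
    also have "norm \<dots> \<le> norm \<mu> * norm (laplace_kernel \<mu> k w b) +
        norm k * norm (of_real (sinh b) * laplace_kernel \<mu> (k + 1) w b)"
      by (rule order_trans[OF norm_triangle_ineq]) (simp add: norm_mult)
    also have "\<dots> \<le> norm \<mu> * ((d / 2) powr (- Re k) * exp (pi * \<bar>Im k\<bar>) * exp (- (Re k - \<bar>Re \<mu>\<bar>) * \<bar>b\<bar>)) +
        norm k * ((d / 2) powr (- Re (k + 1)) * exp (pi * \<bar>Im (k + 1)\<bar>) * exp (- (Re k - \<bar>Re \<mu>\<bar>) * \<bar>b\<bar>))"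
      by (intro add_mono mult_left_mono A B) auto
    also have "\<dots> = (C0 + C1) * exp (- (Re k - \<bar>Re \<mu>\<bar>) * \<bar>b\<bar>)"
      unfolding C0_def C1_def by (simp only: distrib_right mult.assoc)
    finally show "norm (\<Phi> (of_real b)) \<le> (C0 + C1) * exp (- (Re k - \<bar>Re \<mu>\<bar>) * \<bar>b\<bar>)" .
  qed
  then show ?thesis
    using int unfolding \<phi>_def laplace_int_def by simp
qed

section \<open>The Legendre equation in hyperbolic form\<close>

text \<open>In the absence of a first-order term the derivative of f g' - f' g cancels. Derivatives
  are complex but taken at real points only, where the hypergeometric argument stays inside the unit
  disc.\<close>

lemma wronskian_constant:
  fixes f f' g g' q :: "complex \<Rightarrow> complex"
  assumes f: "\<And>t::real. (f has_field_derivative f' (of_real t)) (at (of_real t))"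
    and f': "\<And>t::real. (f' has_field_derivative q (of_real t) * f (of_real t)) (at (of_real t))"
    and g: "\<And>t::real. (g has_field_derivative g' (of_real t)) (at (of_real t))"
    and g': "\<And>t::real. (g' has_field_derivative q (of_real t) * g (of_real t)) (at (of_real t))"
  shows "f (of_real s) * g' (of_real s) - f' (of_real s) * g (of_real s) =
    f (of_real t) * g' (of_real t) - f' (of_real t) * g (of_real t)"
proof -
  define W where "W = (\<lambda>x::real. f (of_real x) * g' (of_real x) - f' (of_real x) * g (of_real x))"
  have "(W has_vector_derivative 0) (at x)" for x
  proof -
    have "((\<lambda>z. f z * g' z - f' z * g z) has_field_derivative
        (f' (of_real x) * g' (of_real x) + q (of_real x) * g (of_real x) * f (of_real x))
        - (q (of_real x) * f (of_real x) * g (of_real x) + g' (of_real x) * f' (of_real x))) (at (of_real x))"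
      by (intro DERIV_diff DERIV_mult' f f' g g' DERIV_mult)
    then have "((\<lambda>z. f z * g' z - f' z * g z) has_field_derivative 0) (at (of_real x))"
      by (simp add: mult_ac)
    then show ?thesis unfolding W_def by (rule has_vector_derivative_real_field)
  qed
  then have "W s = W t"
    using has_vector_derivative_zero_constant[of UNIV W]
    by (metis UNIV_I convex_UNIV)
  then show ?thesis by (simp add: W_def)
qed

text \<open>
  With \<open>tan (\<zeta> / 2) = e\<^sup>t\<close> the associated Legendre equation becomes
  \<open>y'' = (\<mu>\<^sup>2 - \<nu>(\<nu> + 1) / cosh\<^sup>2 t) y\<close>, which has no first-order term, so Wronskians are constant.
\<close>

definition legendre_potential :: "complex \<Rightarrow> complex \<Rightarrow> complex \<Rightarrow> complex" where
  "legendre_potential \<nu> \<mu> t = \<mu>\<^sup>2 - \<nu> * (\<nu> + 1) / (cosh t)\<^sup>2"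

text \<open>P of order \<mu> at cos \<zeta> = - tanh t: there (1 + cos \<zeta>) / (1 - cos \<zeta>)
  is exp (- 2 t), and the argument of the series is the logistic function of 2 t.\<close>

definition ferrers_sol :: "complex \<Rightarrow> complex \<Rightarrow> complex \<Rightarrow> complex" where
  "ferrers_sol \<nu> \<mu> t = exp (- \<mu> * t) * hypergeo_reg (\<nu> + 1) (- \<nu>) (1 - \<mu>) (exp t / (2 * cosh t))"

definition ferrers_sol' :: "complex \<Rightarrow> complex \<Rightarrow> complex \<Rightarrow> complex" where
  "ferrers_sol' \<nu> \<mu> t = exp (- \<mu> * t) * (- \<mu> * hypergeo_reg (\<nu> + 1) (- \<nu>) (1 - \<mu>) (exp t / (2 * cosh t))
     + (\<nu> + 1) * (- \<nu>) * hypergeo_reg (\<nu> + 2) (1 - \<nu>) (2 - \<mu>) (exp t / (2 * cosh t)) / (2 * (cosh t)\<^sup>2))"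

lemma cosh_of_real_nonzero [simp]: "cosh (complex_of_real t) \<noteq> 0"
  by (simp add: cosh_complex_of_real)

lemma sigmoid_real: "exp (complex_of_real t) / (2 * cosh (of_real t)) = of_real (exp t / (2 * cosh t))"
  by (simp add: cosh_complex_of_real exp_of_real)

lemma sigmoid_less_1: "norm (exp (complex_of_real t) / (2 * cosh (of_real t))) < 1"
proof -
  have "exp t < 2 * cosh t" by (simp add: cosh_def)
  then have "exp t / (2 * cosh t) < 1" using cosh_real_pos[of t] by simp
  then show ?thesis unfolding sigmoid_real norm_of_real using cosh_real_pos[of t] by simp
qed

lemma has_field_derivative_sigmoid:
  "((\<lambda>t. exp t / (2 * cosh t)) has_field_derivative 1 / (2 * (cosh (of_real t))\<^sup>2)) (at (complex_of_real t))"
proof -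
  define c where "c = cosh (complex_of_real t)"
  define s where "s = sinh (complex_of_real t)"
  define e where "e = exp (complex_of_real t)"
  have c0: "c \<noteq> 0" by (simp add: c_def)
  have "((\<lambda>t. exp t / (2 * cosh t)) has_field_derivative
      (e * (2 * c) - e * (2 * s)) / (2 * c * (2 * c))) (at (complex_of_real t))"
    unfolding c_def s_def e_def by (rule derivative_eq_intros refl | simp)+
  also have "e * (2 * c) - e * (2 * s) = 2 * (e * (c - s))" by (simp add: algebra_simps)
  also have "c - s = exp (- complex_of_real t)" by (simp add: c_def s_def cosh_minus_sinh)
  also have "e * \<dots> = 1" by (simp add: e_def flip: exp_add)
  finally show ?thesis using c0 by (simp add: c_def power2_eq_square)
qed

lemma has_field_derivative_ferrers_sol:
  "(ferrers_sol \<nu> \<mu> has_field_derivative ferrers_sol' \<nu> \<mu> (of_real t)) (at (of_real t))"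
proof -
  define z where "z = (\<lambda>t::complex. exp t / (2 * cosh t))"
  define c where "c = cosh (complex_of_real t)"
  have z: "norm (z (of_real t)) < 1" using sigmoid_less_1 by (simp add: z_def)
  have dz: "(z has_field_derivative 1 / (2 * c\<^sup>2)) (at (of_real t))"
    unfolding z_def c_def by (rule has_field_derivative_sigmoid)
  have "((\<lambda>t. hypergeo_reg (\<nu> + 1) (- \<nu>) (1 - \<mu>) (z t)) has_field_derivative
      ((\<nu> + 1) * - \<nu> * hypergeo_reg (\<nu> + 1 + 1) (- \<nu> + 1) (1 - \<mu> + 1) (z (of_real t))) * (1 / (2 * c\<^sup>2))) (at (of_real t))"
    by (rule DERIV_chain2[OF has_field_derivative_hypergeo_reg[OF z] dz])
  note [derivative_intros] = this
  show ?thesis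
    unfolding ferrers_sol_def[abs_def] ferrers_sol'_def z_def[symmetric]
      z_def[unfolded fun_eq_iff, rule_format, symmetric]
    by (rule derivative_eq_intros refl)+
       (simp add: c_def algebra_simps add_divide_distrib diff_divide_distrib)
qed

text \<open>At z = (1 + tanh t) / 2 one has z (1 - z) = 1 / (4 cosh^2 t), so the hypergeometric
  equation can be solved for the second derivative \<open>H2\<close>. After its elimination all
  terms in \<open>H1\<close> cancel, and the potential times \<open>H0\<close> remains.\<close>

lemma has_field_derivative_ferrers_sol':
  "(ferrers_sol' \<nu> \<mu> has_field_derivative legendre_potential \<nu> \<mu> (of_real t) * ferrers_sol \<nu> \<mu> (of_real t))
     (at (of_real t))"
proof -
  define z where "z = (\<lambda>t::complex. exp t / (2 * cosh t))"
  define c where "c = cosh (complex_of_real t)"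
  define s where "s = sinh (complex_of_real t)"
  define e where "e = exp (- \<mu> * of_real t)"
  have c0: "c \<noteq> 0" by (simp add: c_def)
  have z: "norm (z (of_real t)) < 1" using sigmoid_less_1 by (simp add: z_def)
  have dz: "(z has_field_derivative 1 / (2 * c\<^sup>2)) (at (of_real t))"
    unfolding z_def c_def by (rule has_field_derivative_sigmoid)
  define ab where "ab = (\<nu> + 1) * - \<nu>"
  define H0 where "H0 = hypergeo_reg (\<nu> + 1) (- \<nu>) (1 - \<mu>) (z (of_real t))"
  define H1 where "H1 = ab * hypergeo_reg (\<nu> + 2) (1 - \<nu>) (2 - \<mu>) (z (of_real t))"
  define H2 where "H2 = ab * ((\<nu> + 2) * (1 - \<nu>) * hypergeo_reg (\<nu> + 3) (2 - \<nu>) (3 - \<mu>) (z (of_real t)))"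
  have d0: "((\<lambda>t. hypergeo_reg (\<nu> + 1) (- \<nu>) (1 - \<mu>) (z t)) has_field_derivative
      H1 * (1 / (2 * c\<^sup>2))) (at (of_real t))"
    using DERIV_chain2[OF has_field_derivative_hypergeo_reg[OF z] dz, of "\<nu> + 1" "- \<nu>" "1 - \<mu>"]
    by (simp add: H1_def ab_def algebra_simps)
  have d1: "((\<lambda>t. ab * hypergeo_reg (\<nu> + 2) (1 - \<nu>) (2 - \<mu>) (z t)) has_field_derivative
      H2 * (1 / (2 * c\<^sup>2))) (at (of_real t))"
    using DERIV_cmult[OF DERIV_chain2[OF has_field_derivative_hypergeo_reg[OF z] dz, of "\<nu> + 2" "1 - \<nu>" "2 - \<mu>"], of ab]
    by (simp add: H2_def algebra_simps)
  have d2: "((\<lambda>t. 1 / (2 * (cosh t)\<^sup>2)) has_field_derivative - s / c ^ 3) (at (of_real t))"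
    using c0 unfolding c_def s_def
    by - (rule derivative_eq_intros refl | simp add: power2_eq_square power3_eq_cube field_simps)+
  have ode: "z (of_real t) * (1 - z (of_real t)) * H2 + (1 - \<mu> - 2 * z (of_real t)) * H1 = ab * H0"
    using hypergeo_reg_ode[OF z, of "\<nu> + 1" "- \<nu>" "1 - \<mu>"]
    by (simp add: H0_def H1_def H2_def ab_def algebra_simps)
  have zval: "z (of_real t) = (1 + s / c) / 2"
  proof -
    have "exp (complex_of_real t) = c + s" by (simp add: c_def s_def cosh_plus_sinh)
    then show ?thesis using c0 by (simp add: z_def c_def[symmetric] field_simps)
  qed
  have cs: "s\<^sup>2 = c\<^sup>2 - 1" unfolding c_def s_def by (rule sinh_square_eq)
  have zz: "z (of_real t) * (1 - z (of_real t)) = 1 / (4 * c\<^sup>2)"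
  proof -
    have "z (of_real t) * (1 - z (of_real t)) = (c\<^sup>2 - s\<^sup>2) / (4 * c\<^sup>2)"
      unfolding zval using c0 by (simp add: field_simps power2_eq_square)
    then show ?thesis by (simp add: cs)
  qed
  have "1 - \<mu> - 2 * z (of_real t) = - (\<mu> + s / c)"
    by (simp add: zval add_divide_distrib)
  then have "1 / (4 * c\<^sup>2) * H2 + - (\<mu> + s / c) * H1 = ab * H0"
    using ode unfolding zz by (simp only:)
  then have H2: "H2 = 4 * c\<^sup>2 * (ab * H0 + (\<mu> + s / c) * H1)"
    using c0 by (simp add: field_simps)
  have "((\<lambda>t. exp (- \<mu> * t) * (- \<mu> * hypergeo_reg (\<nu> + 1) (- \<nu>) (1 - \<mu>) (z t)
     + (ab * hypergeo_reg (\<nu> + 2) (1 - \<nu>) (2 - \<mu>) (z t)) * (1 / (2 * (cosh t)\<^sup>2)))) has_field_derivative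
      (- \<mu> * e) * (- \<mu> * H0 + H1 * (1 / (2 * c\<^sup>2))) +
      (- \<mu> * (H1 * (1 / (2 * c\<^sup>2))) + (H2 * (1 / (2 * c\<^sup>2)) * (1 / (2 * c\<^sup>2)) + (- s / c ^ 3) * H1)) * e) (at (of_real t))"
    unfolding e_def H0_def H1_def c_def s_def
    by (intro DERIV_mult DERIV_add DERIV_cmult d0[unfolded H1_def c_def] d1[unfolded H1_def c_def] d2[unfolded c_def s_def])
       (rule derivative_eq_intros refl | simp)+
  also have "(- \<mu> * e) * (- \<mu> * H0 + H1 * (1 / (2 * c\<^sup>2))) +
      (- \<mu> * (H1 * (1 / (2 * c\<^sup>2))) + (H2 * (1 / (2 * c\<^sup>2)) * (1 / (2 * c\<^sup>2)) + (- s / c ^ 3) * H1)) * e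
      = (\<mu>\<^sup>2 + ab / c\<^sup>2) * (e * H0)"
    unfolding H2 using c0 by (simp add: field_simps power2_eq_square power3_eq_cube)
  also have "\<dots> = legendre_potential \<nu> \<mu> (of_real t) * ferrers_sol \<nu> \<mu> (of_real t)"
  proof -
    have "ab = - (\<nu> * (\<nu> + 1))" by (simp add: ab_def)
    then show ?thesis by (simp add: legendre_potential_def ferrers_sol_def e_def H0_def z_def c_def)
  qed
  finally show ?thesis
    unfolding ferrers_sol'_def[abs_def] z_def ab_def by simp
qed

text \<open>Since sinh t = - cot \<zeta> and cosh t = 1 / sin \<zeta>, the argument is 1 + \<sigma>
  i cot \<zeta>. The factor 1/2 removes a 2 from the Wronskian with
  \<open>ferrers_sol\<close>.\<close>

definition laplace_sol :: "real \<Rightarrow> complex \<Rightarrow> complex \<Rightarrow> complex \<Rightarrow> complex" where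
  "laplace_sol \<sigma> \<nu> \<mu> t = cosh t powr (\<nu> + 1) / 2 * laplace_int \<mu> (\<nu> + 1) (1 - \<sigma> * \<i> * sinh t)"

definition laplace_sol' :: "real \<Rightarrow> complex \<Rightarrow> complex \<Rightarrow> complex \<Rightarrow> complex" where
  "laplace_sol' \<sigma> \<nu> \<mu> t = (\<nu> + 1) * (cosh t powr (\<nu> + 1) / 2) *
     (sinh t / cosh t * laplace_int \<mu> (\<nu> + 1) (1 - \<sigma> * \<i> * sinh t)
      + \<sigma> * \<i> * cosh t * laplace_int \<mu> (\<nu> + 2) (1 - \<sigma> * \<i> * sinh t))"

lemma Re_laplace_arg: "Re (1 - complex_of_real \<sigma> * \<i> * sinh (of_real t)) > 0"
  by (simp add: sinh_complex_of_real)

lemma has_field_derivative_laplace_arg: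
  fixes \<sigma> t :: real
  assumes "\<bar>Re \<mu>\<bar> < Re k"
  shows "((\<lambda>t. laplace_int \<mu> k (1 - \<sigma> * \<i> * sinh t)) has_field_derivative
    \<sigma> * \<i> * cosh (of_real t) * k * laplace_int \<mu> (k + 1) (1 - \<sigma> * \<i> * sinh (of_real t))) (at (complex_of_real t))"
proof -
  have "((\<lambda>t. 1 - \<sigma> * \<i> * sinh t) has_field_derivative - (\<sigma> * \<i> * cosh (of_real t))) (at (complex_of_real t))"
    by (rule derivative_eq_intros refl | simp)+
  from DERIV_chain2[OF has_field_derivative_laplace_int[OF Re_laplace_arg assms] this]
  show ?thesis by (simp add: algebra_simps)
qed

lemma cosh_powr_derivative:
  "((\<lambda>t. cosh t powr n / 2) has_field_derivative
    n * (cosh (of_real t) powr n / 2) * (sinh (of_real t) / cosh (of_real t))) (at (complex_of_real t))"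
proof -
  have np: "cosh (complex_of_real t) \<notin> \<real>\<^sub>\<le>\<^sub>0"
    using cosh_real_pos[of t] by (simp add: cosh_complex_of_real not_le)
  have "((\<lambda>t. cosh t powr n / 2) has_field_derivative
      (n * cosh (of_real t) powr (n - 1) * sinh (of_real t)) / 2) (at (complex_of_real t))"
    by (rule derivative_eq_intros refl np | simp)+
  then show ?thesis by (simp add: powr_diff mult.commute[of _ "2::complex"])
qed

lemma has_field_derivative_laplace_sol:
  assumes \<mu>: "\<bar>Re \<mu>\<bar> < Re \<nu> + 1"
  shows "(laplace_sol \<sigma> \<nu> \<mu> has_field_derivative laplace_sol' \<sigma> \<nu> \<mu> (of_real t)) (at (of_real t))"
proof -
  have "\<bar>Re \<mu>\<bar> < Re (\<nu> + 1)" using \<mu> by simp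
  from DERIV_mult[OF cosh_powr_derivative[of "\<nu> + 1" t] has_field_derivative_laplace_arg[OF this, of \<sigma> t]]
  show ?thesis
    unfolding laplace_sol_def[abs_def] laplace_sol'_def by (rule DERIV_cong) (simp add: field_simps)
qed

text \<open>The recurrence in the exponent becomes the Legendre equation: two derivatives produce
  the exponents \<nu> + 1, \<nu> + 2 and \<nu> + 3, and \<open>rec\<close> eliminates the
  last.\<close>

lemma has_field_derivative_laplace_sol':
  assumes \<mu>: "\<bar>Re \<mu>\<bar> < Re \<nu> + 1" and \<sigma>: "\<sigma> = 1 \<or> \<sigma> = - 1"
  shows "(laplace_sol' \<sigma> \<nu> \<mu> has_field_derivative
      legendre_potential \<nu> \<mu> (of_real t) * laplace_sol \<sigma> \<nu> \<mu> (of_real t)) (at (of_real t))"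
proof -
  define n where "n = \<nu> + 1"
  define c where "c = cosh (complex_of_real t)"
  define s where "s = sinh (complex_of_real t)"
  define p where "p = c powr n / 2"
  define si where "si = complex_of_real \<sigma> * \<i>"
  define g where "g = (\<lambda>k. laplace_int \<mu> k (1 - si * s))"
  have si2: "si * si = - 1" using \<sigma> by (auto simp: si_def)
  have c0: "c \<noteq> 0" by (simp add: c_def)
  have cs: "s\<^sup>2 = c\<^sup>2 - 1" unfolding c_def s_def by (rule sinh_square_eq)
  have dp: "((\<lambda>t. n * (cosh t powr n / 2)) has_field_derivative n * (n * p * (s / c))) (at (of_real t))"
    unfolding p_def c_def s_def by (rule DERIV_cmult[OF cosh_powr_derivative])
  have dg: "((\<lambda>t. laplace_int \<mu> n (1 - si * sinh t)) has_field_derivative si * c * n * g (n + 1)) (at (of_real t))"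
      "((\<lambda>t. laplace_int \<mu> (n + 1) (1 - si * sinh t)) has_field_derivative si * c * (n + 1) * g (n + 2)) (at (of_real t))"
    using has_field_derivative_laplace_arg[of \<mu> n \<sigma> t] has_field_derivative_laplace_arg[of \<mu> "n + 1" \<sigma> t] \<mu>
    by (simp_all add: n_def g_def si_def c_def s_def add.assoc)
  have dt: "((\<lambda>t. sinh t / cosh t) has_field_derivative 1 / c\<^sup>2) (at (complex_of_real t))"
  proof -
    have "((\<lambda>t. sinh t / cosh t) has_field_derivative (c * c - s * s) / (c * c)) (at (complex_of_real t))"
      unfolding c_def s_def by (rule derivative_eq_intros refl | simp)+
    then show ?thesis using cs by (simp add: power2_eq_square)
  qed
  have dc: "((\<lambda>t. si * cosh t) has_field_derivative si * s) (at (complex_of_real t))"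
    unfolding s_def by (rule derivative_eq_intros refl | simp)+
  have "Re (1 - si * s) > 0" unfolding si_def s_def by (rule Re_laplace_arg)
  moreover have "\<bar>Re \<mu>\<bar> < Re n" using \<mu> by (simp add: n_def)
  ultimately have "(\<mu>\<^sup>2 - n\<^sup>2) * g n + n * (2 * n + 1) * (1 - si * s - 1) * g (n + 1)
     = n * (n + 1) * (1 - si * s) * (1 - si * s - 2) * g (n + 2)"
    unfolding g_def by (rule laplace_int_recurrence)
  \<comment> \<open>For w = 1 - \<sigma> i sinh t, with \<sigma> = 1 or -1, the product w (w - 2) is
    - sinh^2 t - 1 = - cosh^2 t.\<close>
  also have "n * (n + 1) * (1 - si * s) * (1 - si * s - 2) = n * (n + 1) * ((si * si) * s\<^sup>2 - 1)"
    by (simp add: algebra_simps power2_eq_square)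
  also have "\<dots> = - (n * (n + 1) * c\<^sup>2)" by (simp add: si2 cs algebra_simps)
  finally have rec: "n * (n + 1) * c\<^sup>2 * g (n + 2) = n * (2 * n + 1) * si * s * g (n + 1) - (\<mu>\<^sup>2 - n\<^sup>2) * g n"
    by (simp add: algebra_simps)
  have "((\<lambda>t. n * (cosh t powr n / 2) * (sinh t / cosh t * laplace_int \<mu> n (1 - si * sinh t)
      + si * cosh t * laplace_int \<mu> (n + 1) (1 - si * sinh t))) has_field_derivative
      n * (n * p * (s / c)) * (s / c * g n + si * c * g (n + 1)) +
      ((1 / c\<^sup>2 * g n + si * c * n * g (n + 1) * (s / c)) +
       (si * s * g (n + 1) + si * c * (n + 1) * g (n + 2) * (si * c))) * (n * p)) (at (of_real t))"
    unfolding g_def p_def c_def s_def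
    by (intro DERIV_mult DERIV_add dp[unfolded p_def c_def s_def] dg[unfolded g_def c_def s_def]
         dt[unfolded c_def] dc[unfolded s_def])
  also have "n * (n * p * (s / c)) * (s / c * g n + si * c * g (n + 1)) +
      ((1 / c\<^sup>2 * g n + si * c * n * g (n + 1) * (s / c)) +
       (si * s * g (n + 1) + si * c * (n + 1) * g (n + 2) * (si * c))) * (n * p)
    = p * ((n\<^sup>2 * s\<^sup>2 / c\<^sup>2 + n / c\<^sup>2) * g n + n * (2 * n + 1) * si * s * g (n + 1)
       + (si * si) * (n * (n + 1) * c\<^sup>2 * g (n + 2)))"
    using c0 by (simp add: field_simps power2_eq_square)
  also have "\<dots> = p * ((n\<^sup>2 * s\<^sup>2 / c\<^sup>2 + n / c\<^sup>2) * g n + (\<mu>\<^sup>2 - n\<^sup>2) * g n)"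
    unfolding rec si2 by (simp add: algebra_simps)
  also have "\<dots> = (\<mu>\<^sup>2 - (n - 1) * n / c\<^sup>2) * (p * g n)"
    unfolding cs using c0 by (simp add: field_simps power2_eq_square)
  also have "\<dots> = legendre_potential \<nu> \<mu> (of_real t) * laplace_sol \<sigma> \<nu> \<mu> (of_real t)"
    by (simp add: legendre_potential_def laplace_sol_def n_def p_def g_def c_def s_def si_def)
  finally show ?thesis
    unfolding laplace_sol'_def[abs_def] n_def si_def by (simp add: add.assoc)
qed

section \<open>Behaviour at the singular point\<close>

lemma powr_times_pos_real:
  fixes z s :: complex and r :: real
  assumes "r > 0" "z \<noteq> 0"
  shows "(of_real r * z) powr s = of_real r powr s * z powr s"
  using assms by (simp add: powr_def Ln_times_of_real Ln_of_real distrib_left exp_add)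

lemma powr_sigma_i:
  fixes s :: complex
  assumes "\<sigma> = 1 \<or> \<sigma> = - 1"
  shows "(complex_of_real \<sigma> * \<i>) powr s = exp (\<sigma> * \<i> * pi * s / 2)"
  using assms by (auto simp: powr_def Ln_minus_ii mult_ac)

text \<open>The base of the kernel at t = - x, after translating b by - x and dividing by cosh x.
  The limit x -> \<infinity> is the limit \<zeta> -> 0, and the translation makes the integrands
  converge.\<close>

definition laplace_ratio :: "real \<Rightarrow> real \<Rightarrow> real \<Rightarrow> complex" where
  "laplace_ratio \<sigma> x b = (of_real (cosh (b - x)) + \<sigma> * \<i> * of_real (sinh x)) / of_real (cosh x)"

lemma Re_laplace_ratio: "Re (laplace_ratio \<sigma> x b) = cosh (b - x) / cosh x"
  by (simp add: laplace_ratio_def)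

lemma Re_laplace_ratio_pos: "Re (laplace_ratio \<sigma> x b) > 0"
  by (simp add: Re_laplace_ratio)

lemma laplace_ratio_nonzero: "laplace_ratio \<sigma> x b \<noteq> 0"
  using Re_laplace_ratio_pos[of \<sigma> x b] by auto

lemma norm_laplace_ratio_ge_1:
  assumes "\<sigma> = 1 \<or> \<sigma> = - 1"
  shows "norm (laplace_ratio \<sigma> x b) \<ge> 1"
proof -
  have "(norm (laplace_ratio \<sigma> x b))\<^sup>2 = ((cosh (b - x))\<^sup>2 + (sinh x)\<^sup>2) / (cosh x)\<^sup>2"
    using assms unfolding cmod_power2 laplace_ratio_def
    by (auto simp: power_divide add_divide_distrib)
  also have "\<dots> \<ge> 1"
  proof -
    have "1\<^sup>2 \<le> (cosh (b - x))\<^sup>2" by (intro power_mono cosh_real_ge_1) auto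
    then have "(cosh x)\<^sup>2 \<le> (cosh (b - x))\<^sup>2 + (sinh x)\<^sup>2" by (simp add: sinh_square_eq)
    then show ?thesis by simp
  qed
  finally show ?thesis
    using power2_le_imp_le[of 1 "norm (laplace_ratio \<sigma> x b)"] by simp
qed

lemma norm_laplace_ratio_ge_exp:
  assumes "x \<ge> 0"
  shows "exp (- b) / 2 \<le> norm (laplace_ratio \<sigma> x b)"
proof -
  have "exp (- b) * cosh x \<le> exp (- b) * exp x"
    using assms by (simp add: cosh_def)
  also have "\<dots> \<le> 2 * cosh (b - x)"
    by (simp add: cosh_def algebra_simps flip: exp_add)
  finally have "exp (- b) / 2 \<le> cosh (b - x) / cosh x" using cosh_real_pos[of x] by (simp add: field_simps)
  also have "\<dots> \<le> norm (laplace_ratio \<sigma> x b)"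
    using complex_Re_le_cmod[of "laplace_ratio \<sigma> x b"] by (simp add: Re_laplace_ratio)
  finally show ?thesis .
qed

lemma laplace_ratio_tendsto:
  "((\<lambda>x. laplace_ratio \<sigma> x b) \<longlongrightarrow> of_real (exp (- b)) + \<sigma> * \<i>) at_top"
proof -
  have "((\<lambda>x. of_real (cosh (b - x) / cosh x) + \<sigma> * \<i> * of_real (sinh x / cosh x)) \<longlongrightarrow>
      complex_of_real (exp (- b)) + \<sigma> * \<i> * of_real 1) at_top"
  proof (intro tendsto_intros)
    show "((\<lambda>x. cosh (b - x) / cosh x) \<longlongrightarrow> exp (- b)) at_top"
    proof -
      have "((\<lambda>x. (A * exp (- x) + B * exp x) / (exp x + exp (- x))) \<longlongrightarrow> B) at_top" for A B :: real
        by real_asymp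
      moreover have "cosh (b - x) / cosh x =
          (exp b * exp (- x) + exp (- b) * exp x) / (exp x + exp (- x))" for x
      proof -
        have "exp (b - x) = exp b * exp (- x)" "exp (- (b - x)) = exp (- b) * exp x"
          by (simp_all flip: exp_add)
        moreover have "(A / 2) / (B / 2) = A / B" for A B :: real by simp
        ultimately show ?thesis by (simp only: cosh_field_def)
      qed
      ultimately show ?thesis by simp
    qed
    show "((\<lambda>x::real. sinh x / cosh x) \<longlongrightarrow> 1) at_top"
      unfolding cosh_field_def sinh_field_def by real_asymp
  qed
  then show ?thesis by (simp add: laplace_ratio_def[abs_def] add_divide_distrib)
qed

text \<open>For b \<ge> 0 the ratio has modulus at least 1 and Re \<mu> < 0 gives the decay; for b <
  0 it has modulus at least exp (- b) / 2, and the rate is Re \<mu> + Re n. The majorant, uniform in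
  x \<ge> 0, takes the smaller rate.\<close>

lemma norm_laplace_limit_kernel_le:
  assumes \<sigma>: "\<sigma> = 1 \<or> \<sigma> = - 1" and \<mu>: "Re \<mu> < 0" and n: "Re \<mu> + Re n > 0" and x: "x \<ge> 0"
  shows "norm (exp (\<mu> * of_real b) * laplace_ratio \<sigma> x b powr (- n)) \<le>
    (exp (pi * \<bar>Im n\<bar>) * 2 powr Re n) * exp (- min (- Re \<mu>) (Re \<mu> + Re n) * \<bar>b\<bar>)"
proof -
  let ?R = "laplace_ratio \<sigma> x b"
  define c where "c = min (- Re \<mu>) (Re \<mu> + Re n)"
  have n0: "Re n > 0" using \<mu> n by simp
  have "exp (Re \<mu> * b) * norm ?R powr (- Re n) \<le> 2 powr Re n * exp (- c * \<bar>b\<bar>)"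
  proof (cases "b \<ge> 0")
    case True
    have "norm ?R powr (- Re n) \<le> 1 powr (- Re n)"
      using norm_laplace_ratio_ge_1[OF \<sigma>] n0 by (intro powr_mono2') auto
    then have "exp (Re \<mu> * b) * norm ?R powr (- Re n) \<le> exp (Re \<mu> * b)" by simp
    also have "Re \<mu> * b \<le> - c * \<bar>b\<bar>"
      using True mult_right_mono[of "Re \<mu>" "- c" b] by (simp add: c_def)
    then have "exp (Re \<mu> * b) \<le> exp (- c * \<bar>b\<bar>)" by simp
    also have "\<dots> \<le> 2 powr Re n * exp (- c * \<bar>b\<bar>)"
      using n0 ge_one_powr_ge_zero[of 2 "Re n"] by simp
    finally show ?thesis .
  next
    case False
    have "norm ?R powr (- Re n) \<le> (exp (- b) / 2) powr (- Re n)"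
      using norm_laplace_ratio_ge_exp[OF x] n0 by (intro powr_mono2') auto
    also have "\<dots> = 2 powr Re n * exp (Re n * b)"
      by (simp add: powr_def ln_div flip: exp_add) (simp add: algebra_simps)
    finally have "exp (Re \<mu> * b) * norm ?R powr (- Re n) \<le> exp (Re \<mu> * b) * (2 powr Re n * exp (Re n * b))"
      by simp
    also have "\<dots> = 2 powr Re n * exp ((Re \<mu> + Re n) * b)"
      by (simp add: algebra_simps exp_add)
    also have "(Re \<mu> + Re n) * b \<le> - c * \<bar>b\<bar>"
      using False mult_right_mono_neg[of c "Re \<mu> + Re n" b] by (simp add: c_def)
    then have "2 powr Re n * exp ((Re \<mu> + Re n) * b) \<le> 2 powr Re n * exp (- c * \<bar>b\<bar>)" by simp
    finally show ?thesis .
  qed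
  moreover have "norm (exp (\<mu> * of_real b) * ?R powr (- n)) \<le>
      exp (Re \<mu> * b) * (norm ?R powr (- Re n) * exp (pi * \<bar>Im n\<bar>))"
    using norm_powr_le[of ?R "- n"] by (simp add: norm_mult norm_exp_eq_Re)
  ultimately have "norm (exp (\<mu> * of_real b) * ?R powr (- n)) \<le>
      2 powr Re n * exp (- c * \<bar>b\<bar>) * exp (pi * \<bar>Im n\<bar>)"
    unfolding mult.assoc[symmetric] by (meson exp_ge_zero mult_right_mono order_trans)
  then show ?thesis by (simp only: c_def mult_ac)
qed

text \<open>The bounded factor \<open>q\<close> lets one limit theorem serve for the solution, with
  q = 1, and for its derivative.\<close>

lemma laplace_limit:
  fixes q :: "real \<Rightarrow> real \<Rightarrow> complex"
  assumes \<sigma>: "\<sigma> = 1 \<or> \<sigma> = - 1" and \<mu>: "Re \<mu> < 0" and n: "Re \<mu> + Re n > 0"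
    and q [measurable]: "\<And>x. q x \<in> borel_measurable borel" "q' \<in> borel_measurable borel"
    and B: "\<And>x b. norm (q x b) \<le> B" and lim: "\<And>b. ((\<lambda>x. q x b) \<longlongrightarrow> q' b) at_top"
  shows "((\<lambda>x. \<integral>b. exp (\<mu> * of_real b) * laplace_ratio \<sigma> x b powr (- n) * q x b \<partial>lborel) \<longlongrightarrow>
    (\<integral>b. exp (\<mu> * of_real b) * (of_real (exp (- b)) + \<sigma> * \<i>) powr (- n) * q' b \<partial>lborel)) at_top"
proof (rule integral_dominated_convergence_at_top)
  define c where "c = min (- Re \<mu>) (Re \<mu> + Re n)"
  have B0: "B \<ge> 0" using order_trans[OF norm_ge_zero B] .
  show "integrable lborel (\<lambda>b. (exp (pi * \<bar>Im n\<bar>) * 2 powr Re n) * exp (- c * \<bar>b\<bar>) * B)"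
    using \<mu> n by (intro integrable_mult_left integrable_mult_right integrable_exp_neg_abs) (auto simp: c_def)
  show "AE b in lborel. ((\<lambda>x. exp (\<mu> * of_real b) * laplace_ratio \<sigma> x b powr (- n) * q x b) \<longlongrightarrow>
      exp (\<mu> * of_real b) * (of_real (exp (- b)) + \<sigma> * \<i>) powr (- n) * q' b) at_top"
    using \<sigma> by (intro AE_I2 tendsto_intros lim laplace_ratio_tendsto) (auto simp: complex_nonpos_Reals_iff)
  show "\<forall>\<^sub>F x in at_top. AE b in lborel. norm (exp (\<mu> * of_real b) * laplace_ratio \<sigma> x b powr (- n) * q x b)
      \<le> (exp (pi * \<bar>Im n\<bar>) * 2 powr Re n) * exp (- c * \<bar>b\<bar>) * B"
    using eventually_ge_at_top[of "0::real"]
  proof eventually_elim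
    case (elim x)
    show ?case
      unfolding c_def norm_mult[of _ "q _ _"]
      by (intro AE_I2 mult_mono norm_laplace_limit_kernel_le \<sigma> \<mu> n elim B) auto
  qed
  show "(\<lambda>b. exp (\<mu> * of_real b) * laplace_ratio \<sigma> x b powr (- n) * q x b) \<in> borel_measurable lborel" for x
    unfolding laplace_ratio_def cosh_def by measurable
  show "(\<lambda>b. exp (\<mu> * of_real b) * (of_real (exp (- b)) + \<sigma> * \<i>) powr (- n) * q' b) \<in> borel_measurable lborel"
    by measurable
qed

lemma laplace_kernel_shift:
  "exp (\<mu> * of_real x) * (of_real (cosh x) powr n *
     laplace_kernel \<mu> n (1 - \<sigma> * \<i> * sinh (of_real (- x))) (- x + b)) =
   exp (\<mu> * of_real b) * laplace_ratio \<sigma> x b powr (- n)"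
proof -
  have D: "of_real (cosh (- x + b) - 1) + (1 - \<sigma> * \<i> * sinh (of_real (- x))) =
      of_real (cosh x) * laplace_ratio \<sigma> x b"
    by (simp add: laplace_ratio_def sinh_complex_of_real)
  have "(of_real (cosh x) * laplace_ratio \<sigma> x b) powr (- n) =
      of_real (cosh x) powr (- n) * laplace_ratio \<sigma> x b powr (- n)"
    by (rule powr_times_pos_real) (auto simp: laplace_ratio_nonzero)
  moreover have "complex_of_real (cosh x) powr n * of_real (cosh x) powr (- n) = 1"
    by (simp add: powr_minus)
  moreover have "exp (\<mu> * of_real x) * exp (\<mu> * of_real (- x + b)) = exp (\<mu> * of_real b)"
    by (simp add: algebra_simps flip: exp_add)
  ultimately show ?thesis
    unfolding laplace_kernel_def D by (simp add: mult_ac) (metis mult.assoc mult.commute mult_1)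
qed

lemma laplace_int_shift:
  "exp (\<mu> * of_real x) * (of_real (cosh x) powr n * laplace_int \<mu> n (1 - \<sigma> * \<i> * sinh (of_real (- x)))) =
   (\<integral>b. exp (\<mu> * of_real b) * laplace_ratio \<sigma> x b powr (- n) \<partial>lborel)"
proof -
  have "laplace_int \<mu> n w = (\<integral>b. laplace_kernel \<mu> n w (- x + b) \<partial>lborel)" for w
    using lborel_integral_real_affine[of 1 "laplace_kernel \<mu> n w" "- x"] by (simp add: laplace_int_def)
  then show ?thesis by (simp flip: laplace_kernel_shift)
qed

definition laplace_leading :: "real \<Rightarrow> complex \<Rightarrow> complex \<Rightarrow> complex" where
  "laplace_leading \<sigma> n \<mu> = (\<sigma> * \<i>) powr (- (\<mu> + n)) * (Gamma (- \<mu>) * Gamma (\<mu> + n) / Gamma n) / 2"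

lemma exp_kernel_eq:
  fixes \<sigma> :: real
  assumes "\<sigma> = 1 \<or> \<sigma> = - 1"
  shows "exp (\<mu> * of_real b) * (of_real (exp (- b)) + \<sigma> * \<i>) powr (- n) =
    exp ((\<mu> + n) * of_real b) * (1 + \<sigma> * \<i> * of_real (exp b)) powr (- n)"
proof -
  have e: "of_real (exp (- b)) + \<sigma> * \<i> = of_real (exp (- b)) * (1 + \<sigma> * \<i> * of_real (exp b))"
    by (simp add: algebra_simps exp_minus)
  have "1 + \<sigma> * \<i> * of_real (exp b) \<noteq> 0" using assms by (auto simp: complex_eq_iff)
  then have "(of_real (exp (- b)) + \<sigma> * \<i>) powr (- n) =
      of_real (exp (- b)) powr (- n) * (1 + \<sigma> * \<i> * of_real (exp b)) powr (- n)"
    unfolding e by (intro powr_times_pos_real) auto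
  moreover have "complex_of_real (exp (- b)) powr (- n) = exp (n * of_real b)"
    by (simp add: powr_def Ln_of_real)
  ultimately show ?thesis by (simp add: distrib_right exp_add)
qed

text \<open>The limit integral is the rotated Beta integral with p = - \<mu> and r = \<mu> + \<nu> +
  1; the two conditions on \<mu> are the positivity of Re p and Re r.\<close>

lemma laplace_sol_tendsto:
  assumes \<sigma>: "\<sigma> = 1 \<or> \<sigma> = - 1" and \<mu>: "Re \<mu> < 0" "Re \<mu> + Re \<nu> + 1 > 0"
  shows "((\<lambda>x. exp (\<mu> * of_real x) * laplace_sol \<sigma> \<nu> \<mu> (of_real (- x))) \<longlongrightarrow>
      laplace_leading \<sigma> (\<nu> + 1) \<mu>) at_top"
proof -
  define n where "n = \<nu> + 1"
  have n: "Re \<mu> + Re n > 0" "Re (\<mu> + n) > 0" "Re (- \<mu>) > 0" using \<mu> by (auto simp: n_def)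
  have "((\<lambda>x. (\<integral>b. exp (\<mu> * of_real b) * laplace_ratio \<sigma> x b powr (- n) * 1 \<partial>lborel) / 2) \<longlongrightarrow>
      (\<integral>b. exp (\<mu> * of_real b) * (of_real (exp (- b)) + \<sigma> * \<i>) powr (- n) * 1 \<partial>lborel) / 2) at_top"
    by (intro tendsto_divide tendsto_const laplace_limit[OF \<sigma> \<mu>(1) n(1), where B = 1]) auto
  moreover have "(\<integral>b. exp (\<mu> * of_real b) * laplace_ratio \<sigma> x b powr (- n) * 1 \<partial>lborel) / 2
      = exp (\<mu> * of_real x) * laplace_sol \<sigma> \<nu> \<mu> (of_real (- x))" for x
    using laplace_int_shift[of \<mu> x n \<sigma>] by (simp add: laplace_sol_def n_def cosh_complex_of_real)
  moreover have "(\<integral>b. exp (\<mu> * of_real b) * (of_real (exp (- b)) + \<sigma> * \<i>) powr (- n) * 1 \<partial>lborel) / 2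
      = laplace_leading \<sigma> n \<mu>"
    using has_bochner_integral_Beta_rotated[OF n(3) n(2) \<sigma>, THEN has_bochner_integral_integral_eq]
    by (simp add: exp_kernel_eq[OF \<sigma>] laplace_leading_def)
  ultimately show ?thesis by (simp add: n_def)
qed

lemma laplace_sol'_tendsto:
  assumes \<sigma>: "\<sigma> = 1 \<or> \<sigma> = - 1" and \<mu>: "Re \<mu> < 0" "Re \<mu> + Re \<nu> + 1 > 0"
  shows "((\<lambda>x. exp (\<mu> * of_real x) * laplace_sol' \<sigma> \<nu> \<mu> (of_real (- x))) \<longlongrightarrow>
      \<mu> * laplace_leading \<sigma> (\<nu> + 1) \<mu>) at_top"
proof -
  define n where "n = \<nu> + 1"
  have n: "Re \<mu> + Re n > 0" "Re (\<mu> + n) > 0" "Re (1 - \<mu>) > 0" "Re n > 0" using \<mu> by (auto simp: n_def)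
  \<comment> \<open>The derivative consists of integrals with exponents n and n + 1. Writing the
    second with exponent n and one division by \<open>laplace_ratio\<close> puts both under one
    integral, with \<open>q\<close> as the remaining factor.\<close>
  define q where "q = (\<lambda>x b. - of_real (sinh x / cosh x) + \<sigma> * \<i> / laplace_ratio \<sigma> x b)"
  define q' where "q' = (\<lambda>b. - of_real 1 + \<sigma> * \<i> / (of_real (exp (- b)) + \<sigma> * \<i>))"
  have nz: "complex_of_real (exp (- b)) + \<sigma> * \<i> \<noteq> 0" for b using \<sigma> by (auto simp: complex_eq_iff)
  have q_meas: "q x \<in> borel_measurable borel" for x
    unfolding q_def laplace_ratio_def cosh_def by measurable
  have q'_meas: "q' \<in> borel_measurable borel" unfolding q'_def by measurable
  have qB: "norm (q x b) \<le> 2" for x b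
  proof -
    have "\<bar>sinh x / cosh x\<bar> \<le> 1"
      using cosh_real_pos[of x] by (auto simp: abs_le_iff field_simps sinh_def cosh_def)
    then have "norm (- complex_of_real (sinh x / cosh x)) \<le> 1"
      unfolding norm_minus_cancel norm_of_real .
    moreover have "norm (\<sigma> * \<i> / laplace_ratio \<sigma> x b) \<le> 1"
      using norm_laplace_ratio_ge_1[OF \<sigma>, of x b] \<sigma> laplace_ratio_nonzero[of \<sigma> x b]
      by (auto simp: norm_divide norm_mult divide_le_eq_1)
    ultimately have "norm (q x b) \<le> 1 + 1" unfolding q_def by (rule norm_triangle_mono)
    then show ?thesis by simp
  qed
  have q_lim: "((\<lambda>x. q x b) \<longlongrightarrow> q' b) at_top" for b
    unfolding q_def q'_def
  proof (intro tendsto_intros laplace_ratio_tendsto nz)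
    show "((\<lambda>x::real. sinh x / cosh x) \<longlongrightarrow> 1) at_top"
      unfolding cosh_field_def sinh_field_def by real_asymp
  qed
  have lim: "((\<lambda>x. n / 2 * (\<integral>b. exp (\<mu> * of_real b) * laplace_ratio \<sigma> x b powr (- n) * q x b \<partial>lborel)) \<longlongrightarrow>
      n / 2 * (\<integral>b. exp (\<mu> * of_real b) * (of_real (exp (- b)) + \<sigma> * \<i>) powr (- n) * q' b \<partial>lborel)) at_top"
    by (intro tendsto_mult tendsto_const laplace_limit[OF \<sigma> \<mu>(1) n(1) q_meas q'_meas qB q_lim])
  have eq: "n / 2 * (\<integral>b. exp (\<mu> * of_real b) * laplace_ratio \<sigma> x b powr (- n) * q x b \<partial>lborel)
      = exp (\<mu> * of_real x) * laplace_sol' \<sigma> \<nu> \<mu> (of_real (- x))" if x: "x \<ge> 0" for x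
  proof -
    have int: "integrable lborel (\<lambda>b. exp (\<mu> * of_real b) * laplace_ratio \<sigma> x b powr (- m))"
      if "Re \<mu> + Re m > 0" for m
    proof (rule integrable_exp_dominated[OF _ _ norm_laplace_limit_kernel_le[OF \<sigma> \<mu>(1) that x]])
      show "(\<lambda>b. exp (\<mu> * of_real b) * laplace_ratio \<sigma> x b powr (- m)) \<in> borel_measurable borel"
        unfolding laplace_ratio_def cosh_def by measurable
    qed (use \<mu> that in auto)
    have "laplace_ratio \<sigma> x b powr (- (n + 1)) = laplace_ratio \<sigma> x b powr (- n) / laplace_ratio \<sigma> x b" for b
    proof -
      have "- (n + 1) = - n - 1" by simp
      then show ?thesis by (simp only: powr_diff powr_to_1 powr_one)
    qed
    then have "exp (\<mu> * of_real b) * laplace_ratio \<sigma> x b powr (- n) * q x b =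
        - of_real (sinh x / cosh x) * (exp (\<mu> * of_real b) * laplace_ratio \<sigma> x b powr (- n)) +
        \<sigma> * \<i> * (exp (\<mu> * of_real b) * laplace_ratio \<sigma> x b powr (- (n + 1)))" for b
      unfolding q_def by (simp add: algebra_simps)
    then have "(\<integral>b. exp (\<mu> * of_real b) * laplace_ratio \<sigma> x b powr (- n) * q x b \<partial>lborel) =
        - of_real (sinh x / cosh x) * (\<integral>b. exp (\<mu> * of_real b) * laplace_ratio \<sigma> x b powr (- n) \<partial>lborel) +
        \<sigma> * \<i> * (\<integral>b. exp (\<mu> * of_real b) * laplace_ratio \<sigma> x b powr (- (n + 1)) \<partial>lborel)"
      using int[of n] int[of "n + 1"] n by simp
    also have "\<dots> = exp (\<mu> * of_real x) *
        (- of_real (sinh x / cosh x) * (of_real (cosh x) powr n * laplace_int \<mu> n (1 - \<sigma> * \<i> * sinh (of_real (- x)))) +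
        \<sigma> * \<i> * (of_real (cosh x) powr (n + 1) * laplace_int \<mu> (n + 1) (1 - \<sigma> * \<i> * sinh (of_real (- x)))))"
      unfolding laplace_int_shift[symmetric] by (simp add: algebra_simps)
    also have "of_real (cosh x) powr (n + 1) = of_real (cosh x) powr n * complex_of_real (cosh x)"
      by (simp add: powr_add)
    finally have F: "(\<integral>b. exp (\<mu> * of_real b) * laplace_ratio \<sigma> x b powr (- n) * q x b \<partial>lborel) =
      exp (\<mu> * of_real x) *
        (- of_real (sinh x / cosh x) * (of_real (cosh x) powr n * laplace_int \<mu> n (1 - \<sigma> * \<i> * sinh (of_real (- x)))) +
        \<sigma> * \<i> * (of_real (cosh x) powr n * of_real (cosh x) * laplace_int \<mu> (n + 1) (1 - \<sigma> * \<i> * sinh (of_real (- x)))))" .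
    have "\<nu> + 2 = n + 1" by (simp add: n_def)
    moreover have "cosh (complex_of_real (- x)) = of_real (cosh x)"
      "sinh (complex_of_real (- x)) / of_real (cosh x) = - of_real (sinh x / cosh x)"
      by (simp_all add: cosh_complex_of_real sinh_complex_of_real)
    ultimately show ?thesis
      unfolding laplace_sol'_def F n_def[symmetric] by (simp only: algebra_simps times_divide_eq_right times_divide_eq_left)
  qed
  have val: "n / 2 * (\<integral>b. exp (\<mu> * of_real b) * (of_real (exp (- b)) + \<sigma> * \<i>) powr (- n) * q' b \<partial>lborel)
      = \<mu> * laplace_leading \<sigma> n \<mu>"
  proof -
    \<comment> \<open>Here q' b = - exp (- b) / (exp (- b) + \<sigma> i). This lowers \<mu> by 1 and
      raises n by 1, so r = \<mu> + n is unchanged and p = 1 - \<mu>; Gamma (1 - \<mu>) = - \<mu>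
      Gamma (- \<mu>) then yields the factor \<mu> of the limit.\<close>
    have pt: "exp (\<mu> * of_real b) * (of_real (exp (- b)) + \<sigma> * \<i>) powr (- n) * q' b =
        - (exp ((\<mu> + n) * of_real b) * (1 + \<sigma> * \<i> * of_real (exp b)) powr (- (1 - \<mu> + (\<mu> + n))))" for b
    proof -
      have "exp (\<mu> * of_real b) * (of_real (exp (- b)) + \<sigma> * \<i>) powr (- n) * q' b =
        - (exp ((\<mu> - 1) * of_real b) * (of_real (exp (- b)) + \<sigma> * \<i>) powr (- (n + 1)))"
      proof -
        have "- (n + 1) = - n - 1" by simp
        moreover have "q' b = - (exp (- of_real b) / (of_real (exp (- b)) + \<sigma> * \<i>))"
          unfolding q'_def using nz[of b] by (simp add: field_simps exp_of_real flip: of_real_minus)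
        moreover have "exp ((\<mu> - 1) * of_real b) = exp (\<mu> * of_real b) * exp (- of_real b)"
          by (simp add: algebra_simps flip: exp_add)
        ultimately show ?thesis
          by (simp only: powr_diff powr_to_1 powr_one) (simp add: mult_ac)
      qed
      also have "\<dots> = - (exp ((\<mu> - 1 + (n + 1)) * of_real b) * (1 + \<sigma> * \<i> * of_real (exp b)) powr (- (n + 1)))"
        by (simp only: exp_kernel_eq[OF \<sigma>])
      finally show ?thesis by (simp add: algebra_simps)
    qed
    have G: "Gamma (1 - \<mu>) = - \<mu> * Gamma (- \<mu>)"
      using Gamma_plus1[of "- \<mu>"] \<mu> not_nonpos_Ints_Re_pos[of "- \<mu>"] by simp
    have G': "Gamma (1 + n) = n * Gamma n"
      using Gamma_plus1[of n] n not_nonpos_Ints_Re_pos[of n] by (simp add: add.commute)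
    have "n \<noteq> 0" using n by auto
    then show ?thesis
      using has_bochner_integral_Beta_rotated[OF n(3) n(2) \<sigma>, THEN has_bochner_integral_integral_eq]
      unfolding pt by (simp add: laplace_leading_def G G' add.commute mult_ac)
  qed
  have "((\<lambda>x. exp (\<mu> * of_real x) * laplace_sol' \<sigma> \<nu> \<mu> (of_real (- x))) \<longlongrightarrow> \<mu> * laplace_leading \<sigma> n \<mu>) at_top"
    using lim unfolding val
    by (rule Lim_transform_eventually) (rule eventually_mono[OF eventually_ge_at_top[of 0] eq])
  then show ?thesis by (simp add: n_def)
qed

lemma sigmoid_tendsto: "((\<lambda>x. exp (complex_of_real (- x)) / (2 * cosh (of_real (- x)))) \<longlongrightarrow> 0) at_top"
proof -
  have "((\<lambda>x::real. exp (- x) / (2 * cosh (- x))) \<longlongrightarrow> 0) at_top"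
    unfolding cosh_field_def by real_asymp
  from tendsto_of_real[OF this, where ?'a = complex] show ?thesis unfolding sigmoid_real by simp
qed

lemma hypergeo_sigmoid_tendsto:
  "((\<lambda>x. hypergeo_reg a b c (exp (complex_of_real (- x)) / (2 * cosh (of_real (- x))))) \<longlongrightarrow> rGamma c) at_top"
proof -
  have "isCont (hypergeo_reg a b c) 0"
    by (rule DERIV_isCont[OF has_field_derivative_hypergeo_reg]) simp
  from isCont_tendsto_compose[OF this sigmoid_tendsto] show ?thesis by simp
qed

lemma ferrers_sol_tendsto:
  "((\<lambda>x. exp (- \<mu> * of_real x) * ferrers_sol \<nu> \<mu> (of_real (- x))) \<longlongrightarrow> rGamma (1 - \<mu>)) at_top"
proof -
  have "exp (- \<mu> * of_real x) * exp (- \<mu> * of_real (- x)) = 1" for x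
    by (simp flip: exp_add)
  then show ?thesis
    unfolding ferrers_sol_def mult.assoc[symmetric] using hypergeo_sigmoid_tendsto by simp
qed

lemma ferrers_sol'_tendsto:
  "((\<lambda>x. exp (- \<mu> * of_real x) * ferrers_sol' \<nu> \<mu> (of_real (- x))) \<longlongrightarrow> - \<mu> * rGamma (1 - \<mu>)) at_top"
proof -
  have e: "exp (- \<mu> * of_real x) * exp (- \<mu> * of_real (- x)) = 1" for x
    by (simp flip: exp_add)
  have "((\<lambda>x::real. 1 / (2 * (cosh (- x))\<^sup>2)) \<longlongrightarrow> 0) at_top"
    unfolding cosh_field_def by real_asymp
  from tendsto_of_real[OF this, where ?'a = complex]
  have c: "((\<lambda>x. 1 / (2 * (cosh (complex_of_real (- x)))\<^sup>2)) \<longlongrightarrow> 0) at_top"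
    by (simp add: cosh_complex_of_real)
  have "((\<lambda>x. - \<mu> * hypergeo_reg (\<nu> + 1) (- \<nu>) (1 - \<mu>) (exp (complex_of_real (- x)) / (2 * cosh (of_real (- x))))
     + (\<nu> + 1) * (- \<nu>) * hypergeo_reg (\<nu> + 2) (1 - \<nu>) (2 - \<mu>) (exp (complex_of_real (- x)) / (2 * cosh (of_real (- x)))) *
      (1 / (2 * (cosh (complex_of_real (- x)))\<^sup>2))) \<longlongrightarrow>
     - \<mu> * rGamma (1 - \<mu>) + (\<nu> + 1) * (- \<nu>) * rGamma (2 - \<mu>) * 0) at_top"
    by (intro tendsto_add tendsto_mult tendsto_const hypergeo_sigmoid_tendsto c)
  then show ?thesis
    unfolding ferrers_sol'_def mult.assoc[of "exp _", symmetric] e by (simp add: mult.assoc)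
qed

section \<open>Connection formulae\<close>

text \<open>Both orders solve the same equation because the potential contains only \<mu>^2. The
  constant is read off as t -> - \<infinity>, where the exponentials cancel, and the reflection
  formula turns 2 \<mu> / (Gamma (1 + \<mu>) Gamma (1 - \<mu>)) into the sine.\<close>

lemma ferrers_wronskian:
  "ferrers_sol \<nu> \<mu> (of_real t) * ferrers_sol' \<nu> (- \<mu>) (of_real t)
     - ferrers_sol' \<nu> \<mu> (of_real t) * ferrers_sol \<nu> (- \<mu>) (of_real t) = 2 * sin (of_real pi * \<mu>) / of_real pi"
proof -
  define W where "W = (\<lambda>t::real. ferrers_sol \<nu> \<mu> (of_real t) * ferrers_sol' \<nu> (- \<mu>) (of_real t)
     - ferrers_sol' \<nu> \<mu> (of_real t) * ferrers_sol \<nu> (- \<mu>) (of_real t))"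
  have const_fun: "(\<lambda>x. W (- x)) = (\<lambda>_. W t)"
    unfolding W_def
    by (rule ext, rule wronskian_constant[where q = "legendre_potential \<nu> \<mu>"])
       (use has_field_derivative_ferrers_sol has_field_derivative_ferrers_sol'[of \<nu> \<mu>]
         has_field_derivative_ferrers_sol'[of \<nu> "- \<mu>"] in \<open>auto simp: legendre_potential_def\<close>)
  have e: "(exp (- \<mu> * of_real x) * A) * (exp (- (- \<mu>) * of_real x) * B) = A * B" for A B :: complex and x :: real
  proof -
    have "exp (- \<mu> * of_real x) * exp (- (- \<mu>) * of_real x) = 1" by (simp flip: exp_add)
    then show ?thesis by (simp only: mult_ac) (simp add: mult.assoc[symmetric])
  qed
  have "((\<lambda>x. (exp (- \<mu> * of_real x) * ferrers_sol \<nu> \<mu> (of_real (- x))) *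
        (exp (- (- \<mu>) * of_real x) * ferrers_sol' \<nu> (- \<mu>) (of_real (- x))) -
      (exp (- \<mu> * of_real x) * ferrers_sol' \<nu> \<mu> (of_real (- x))) *
        (exp (- (- \<mu>) * of_real x) * ferrers_sol \<nu> (- \<mu>) (of_real (- x)))) \<longlongrightarrow>
      rGamma (1 - \<mu>) * (- (- \<mu>) * rGamma (1 - (- \<mu>))) - (- \<mu> * rGamma (1 - \<mu>)) * rGamma (1 - (- \<mu>))) at_top"
    by (intro tendsto_diff tendsto_mult ferrers_sol_tendsto ferrers_sol'_tendsto)
  then have "((\<lambda>x. W (- x)) \<longlongrightarrow> rGamma (1 - \<mu>) * (- (- \<mu>) * rGamma (1 - (- \<mu>))) - (- \<mu> * rGamma (1 - \<mu>)) * rGamma (1 - (- \<mu>))) at_top"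
    unfolding e W_def .
  then have "W t = rGamma (1 - \<mu>) * (- (- \<mu>) * rGamma (1 - (- \<mu>))) - (- \<mu> * rGamma (1 - \<mu>)) * rGamma (1 - (- \<mu>))"
    unfolding const_fun by (intro tendsto_unique[OF _ tendsto_const]) auto
  also have "\<dots> = 2 * (\<mu> * rGamma (\<mu> + 1)) * rGamma (1 - \<mu>)"
    by (simp add: algebra_simps)
  also have "\<mu> * rGamma (\<mu> + 1) = rGamma \<mu>" by (rule rGamma_plus1)
  also have "2 * rGamma \<mu> * rGamma (1 - \<mu>) = 2 * sin (of_real pi * \<mu>) / of_real pi"
    by (simp add: rGamma_reflection_complex mult.assoc)
  finally show ?thesis by (simp add: W_def)
qed

lemma open_strip: "open {\<mu>. \<bar>Re \<mu>\<bar> < c}"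
  by (intro open_Collect_less continuous_intros)

lemma connected_strip: "connected {\<mu>. \<bar>Re \<mu>\<bar> < c}"
proof -
  have "{\<mu>. \<bar>Re \<mu>\<bar> < c} = {\<mu>. Re \<mu> < c} \<inter> {\<mu>. - c < Re \<mu>}" by auto
  then show ?thesis
    by (auto intro!: convex_connected convex_Int convex_halfspace_Re_lt convex_halfspace_Re_gt)
qed

lemma holomorphic_ferrers_sol_order: "(\<lambda>\<mu>. ferrers_sol \<nu> \<mu> (of_real t)) holomorphic_on S"
proof -
  have "(\<lambda>\<mu>. hypergeo_reg (\<nu> + 1) (- \<nu>) (1 - \<mu>) (exp (of_real t) / (2 * cosh (of_real t)))) holomorphic_on S"
    by (rule holomorphic_on_compose_gen[unfolded o_def, where f = "\<lambda>\<mu>. 1 - \<mu>",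
          OF _ holomorphic_hypergeo_reg_param[OF sigmoid_less_1, where S = UNIV]])
       (auto intro!: holomorphic_intros)
  then show ?thesis unfolding ferrers_sol_def by (intro holomorphic_intros)
qed

lemma holomorphic_ferrers_sol'_order: "(\<lambda>\<mu>. ferrers_sol' \<nu> \<mu> (of_real t)) holomorphic_on S"
proof -
  have "(\<lambda>\<mu>. hypergeo_reg (\<nu> + 1) (- \<nu>) (1 - \<mu>) (exp (of_real t) / (2 * cosh (of_real t)))) holomorphic_on S"
    by (rule holomorphic_on_compose_gen[unfolded o_def, where f = "\<lambda>\<mu>. 1 - \<mu>",
          OF _ holomorphic_hypergeo_reg_param[OF sigmoid_less_1, where S = UNIV]])
       (auto intro!: holomorphic_intros)
  moreover have "(\<lambda>\<mu>. hypergeo_reg (\<nu> + 2) (1 - \<nu>) (2 - \<mu>) (exp (of_real t) / (2 * cosh (of_real t)))) holomorphic_on S"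
    by (rule holomorphic_on_compose_gen[unfolded o_def, where f = "\<lambda>\<mu>. 2 - \<mu>",
          OF _ holomorphic_hypergeo_reg_param[OF sigmoid_less_1, where S = UNIV]])
       (auto intro!: holomorphic_intros)
  ultimately show ?thesis unfolding ferrers_sol'_def by (intro holomorphic_intros) auto
qed

lemma holomorphic_laplace_sol_order:
  "(\<lambda>\<mu>. laplace_sol \<sigma> \<nu> \<mu> (of_real t)) holomorphic_on {\<mu>. \<bar>Re \<mu>\<bar> < Re \<nu> + 1}"
  unfolding laplace_sol_def
  using holomorphic_laplace_int_order[OF Re_laplace_arg[of \<sigma> t], of "\<nu> + 1"]
  by (intro holomorphic_intros) auto

lemma holomorphic_laplace_sol'_order:
  "(\<lambda>\<mu>. laplace_sol' \<sigma> \<nu> \<mu> (of_real t)) holomorphic_on {\<mu>. \<bar>Re \<mu>\<bar> < Re \<nu> + 1}"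
proof -
  have "(\<lambda>\<mu>. laplace_int \<mu> (\<nu> + 1) (1 - \<sigma> * \<i> * sinh (of_real t))) holomorphic_on {\<mu>. \<bar>Re \<mu>\<bar> < Re \<nu> + 1}"
    using holomorphic_laplace_int_order[OF Re_laplace_arg[of \<sigma> t], of "\<nu> + 1"] by simp
  moreover have "(\<lambda>\<mu>. laplace_int \<mu> (\<nu> + 2) (1 - \<sigma> * \<i> * sinh (of_real t))) holomorphic_on {\<mu>. \<bar>Re \<mu>\<bar> < Re \<nu> + 1}"
    using holomorphic_laplace_int_order[OF Re_laplace_arg[of \<sigma> t], of "\<nu> + 2"]
    by (rule holomorphic_on_subset) auto
  ultimately show ?thesis unfolding laplace_sol'_def by (intro holomorphic_intros) auto
qed

text \<open>As t -> - \<infinity> the integral behaves like exp (\<mu> t) and the Ferrers solution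
  like exp (- \<mu> t), so the products have limits. The total is - 2 \<mu>
  \<open>laplace_leading\<close> / Gamma (1 - \<mu>), where - \<mu> Gamma (- \<mu>) cancels the
  denominator.\<close>

lemma laplace_ferrers_wronskian_neg:
  assumes \<sigma>: "\<sigma> = 1 \<or> \<sigma> = - 1" and \<mu>: "\<bar>Re \<mu>\<bar> < Re \<nu> + 1" "Re \<mu> < 0"
  shows "laplace_sol \<sigma> \<nu> \<mu> (of_real t) * ferrers_sol' \<nu> \<mu> (of_real t)
     - laplace_sol' \<sigma> \<nu> \<mu> (of_real t) * ferrers_sol \<nu> \<mu> (of_real t) =
     (\<sigma> * \<i>) powr (- (\<mu> + (\<nu> + 1))) * Gamma (\<mu> + (\<nu> + 1)) / Gamma (\<nu> + 1)"
proof -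
  define W where "W = (\<lambda>t::real. laplace_sol \<sigma> \<nu> \<mu> (of_real t) * ferrers_sol' \<nu> \<mu> (of_real t)
     - laplace_sol' \<sigma> \<nu> \<mu> (of_real t) * ferrers_sol \<nu> \<mu> (of_real t))"
  have const_fun: "(\<lambda>x. W (- x)) = (\<lambda>_. W t)"
    unfolding W_def
    by (rule ext, rule wronskian_constant[where q = "legendre_potential \<nu> \<mu>"])
       (intro has_field_derivative_ferrers_sol has_field_derivative_ferrers_sol'
         has_field_derivative_laplace_sol has_field_derivative_laplace_sol' \<sigma> \<mu>)+
  have e: "(exp (\<mu> * of_real x) * A) * (exp (- \<mu> * of_real x) * B) = A * B" for A B :: complex and x :: real
  proof -
    have "exp (\<mu> * of_real x) * exp (- \<mu> * of_real x) = 1" by (simp flip: exp_add)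
    then show ?thesis by (simp only: mult_ac) (simp add: mult.assoc[symmetric])
  qed
  define l where "l = laplace_leading \<sigma> (\<nu> + 1) \<mu>"
  have \<mu>': "Re \<mu> + Re \<nu> + 1 > 0" using \<mu> by linarith
  have "((\<lambda>x. (exp (\<mu> * of_real x) * laplace_sol \<sigma> \<nu> \<mu> (of_real (- x))) *
        (exp (- \<mu> * of_real x) * ferrers_sol' \<nu> \<mu> (of_real (- x))) -
      (exp (\<mu> * of_real x) * laplace_sol' \<sigma> \<nu> \<mu> (of_real (- x))) *
        (exp (- \<mu> * of_real x) * ferrers_sol \<nu> \<mu> (of_real (- x)))) \<longlongrightarrow>
      l * (- \<mu> * rGamma (1 - \<mu>)) - \<mu> * l * rGamma (1 - \<mu>)) at_top"
    unfolding l_def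
    by (intro tendsto_diff tendsto_mult ferrers_sol_tendsto ferrers_sol'_tendsto laplace_sol_tendsto
         laplace_sol'_tendsto \<sigma> \<mu> \<mu>')
  then have "((\<lambda>x. W (- x)) \<longlongrightarrow> l * (- \<mu> * rGamma (1 - \<mu>)) - \<mu> * l * rGamma (1 - \<mu>)) at_top"
    unfolding e W_def .
  then have "W t = l * (- \<mu> * rGamma (1 - \<mu>)) - \<mu> * l * rGamma (1 - \<mu>)"
    unfolding const_fun by (intro tendsto_unique[OF _ tendsto_const]) auto
  also have "\<dots> = (\<sigma> * \<i>) powr (- (\<mu> + (\<nu> + 1))) * (Gamma (\<mu> + (\<nu> + 1)) / Gamma (\<nu> + 1)) *
      ((- \<mu> * Gamma (- \<mu>)) * rGamma (1 - \<mu>))"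
    unfolding l_def laplace_leading_def by (simp add: field_simps)
  also have "- \<mu> * Gamma (- \<mu>) = Gamma (1 - \<mu>)"
    using Gamma_plus1[of "- \<mu>"] \<mu> not_nonpos_Ints_Re_pos[of "- \<mu>"] by simp
  also have "Gamma (1 - \<mu>) * rGamma (1 - \<mu>) = 1"
    using \<mu> not_nonpos_Ints_Re_pos[of "1 - \<mu>"]
    by (simp add: rGamma_inverse_Gamma Gamma_nonzero_Re_pos)
  finally show ?thesis by (simp add: W_def)
qed

lemma laplace_ferrers_wronskian:
  assumes \<sigma>: "\<sigma> = 1 \<or> \<sigma> = - 1" and \<mu>: "\<bar>Re \<mu>\<bar> < Re \<nu> + 1"
  shows "laplace_sol \<sigma> \<nu> \<mu> (of_real t) * ferrers_sol' \<nu> \<mu> (of_real t)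
     - laplace_sol' \<sigma> \<nu> \<mu> (of_real t) * ferrers_sol \<nu> \<mu> (of_real t) =
     (\<sigma> * \<i>) powr (- (\<mu> + (\<nu> + 1))) * Gamma (\<mu> + (\<nu> + 1)) / Gamma (\<nu> + 1)"
proof (rule analytic_continuation_open[where z = \<mu> and s = "{\<mu>. \<bar>Re \<mu>\<bar> < Re \<nu> + 1} \<inter> {\<mu>. Re \<mu> < 0}"
      and s' = "{\<mu>. \<bar>Re \<mu>\<bar> < Re \<nu> + 1}"])
  show "{\<mu>. \<bar>Re \<mu>\<bar> < Re \<nu> + 1} \<inter> {\<mu>. Re \<mu> < 0} \<noteq> {}"
  proof -
    have "- of_real ((Re \<nu> + 1) / 2) \<in> {\<mu>. \<bar>Re \<mu>\<bar> < Re \<nu> + 1} \<inter> {\<mu>. Re \<mu> < 0}"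
      using \<mu> by auto
    then show ?thesis by blast
  qed
  show "(\<lambda>\<mu>. laplace_sol \<sigma> \<nu> \<mu> (of_real t) * ferrers_sol' \<nu> \<mu> (of_real t)
     - laplace_sol' \<sigma> \<nu> \<mu> (of_real t) * ferrers_sol \<nu> \<mu> (of_real t)) holomorphic_on {\<mu>. \<bar>Re \<mu>\<bar> < Re \<nu> + 1}"
    by (intro holomorphic_on_diff holomorphic_on_mult holomorphic_ferrers_sol_order
         holomorphic_ferrers_sol'_order holomorphic_laplace_sol_order holomorphic_laplace_sol'_order)
  have "u + (\<nu> + 1) \<notin> \<int>\<^sub>\<le>\<^sub>0" if "\<bar>Re u\<bar> < Re \<nu> + 1" for u
    using that by (intro not_nonpos_Ints_Re_pos) simp
  then show "(\<lambda>\<mu>. (\<sigma> * \<i>) powr (- (\<mu> + (\<nu> + 1))) * Gamma (\<mu> + (\<nu> + 1)) / Gamma (\<nu> + 1))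
      holomorphic_on {\<mu>. \<bar>Re \<mu>\<bar> < Re \<nu> + 1}"
    unfolding powr_sigma_i[OF \<sigma>] using Gamma_nonzero_Re_pos[of "\<nu> + 1"] \<mu>
    by (intro holomorphic_intros) auto
  show "laplace_sol \<sigma> \<nu> u (of_real t) * ferrers_sol' \<nu> u (of_real t)
     - laplace_sol' \<sigma> \<nu> u (of_real t) * ferrers_sol \<nu> u (of_real t) =
     (\<sigma> * \<i>) powr (- (u + (\<nu> + 1))) * Gamma (u + (\<nu> + 1)) / Gamma (\<nu> + 1)"
    if "u \<in> {\<mu>. \<bar>Re \<mu>\<bar> < Re \<nu> + 1} \<inter> {\<mu>. Re \<mu> < 0}" for u
    using that by (intro laplace_ferrers_wronskian_neg \<sigma>) auto
  show "open ({\<mu>. \<bar>Re \<mu>\<bar> < Re \<nu> + 1} \<inter> {\<mu>. Re \<mu> < 0})"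
    by (intro open_Int open_strip open_halfspace_Re_lt)
  show "\<mu> \<in> {\<mu>. \<bar>Re \<mu>\<bar> < Re \<nu> + 1}" using \<mu> by simp
qed (rule open_strip connected_strip Int_lower1)+

lemma laplace_sol_minus: "laplace_sol \<sigma> \<nu> (- \<mu>) t = laplace_sol \<sigma> \<nu> \<mu> t"
  "laplace_sol' \<sigma> \<nu> (- \<mu>) t = laplace_sol' \<sigma> \<nu> \<mu> t"
  by (simp_all add: laplace_sol_def laplace_sol'_def laplace_int_minus)

text \<open>The normalisation gives the solution of order - \<mu> in
  \<open>ferrers_connection\<close> the same coefficient for both signs \<sigma>. The difference of
  the two functions then contains P alone, and their sum gives Q.\<close>

definition laplace_J :: "real \<Rightarrow> complex \<Rightarrow> complex \<Rightarrow> complex \<Rightarrow> complex" where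
  "laplace_J \<sigma> \<nu> \<mu> t = 2 / of_real pi * Gamma (\<nu> + 1) * exp (\<sigma> * \<i> * pi * (\<nu> + 1 + \<mu>) / 2) * laplace_sol \<sigma> \<nu> \<mu> t"

lemma holomorphic_laplace_J_order:
  "(\<lambda>\<mu>. laplace_J \<sigma> \<nu> \<mu> (of_real t)) holomorphic_on {\<mu>. \<bar>Re \<mu>\<bar> < Re \<nu> + 1}"
  unfolding laplace_J_def by (intro holomorphic_intros holomorphic_laplace_sol_order) auto

text \<open>Cramer's rule for Wronskians: V (P Q' - P' Q) = (V Q' - V' Q) P - (V P' - V' P) Q
  expresses the Laplace solution V by the two Ferrers solutions, because all three Wronskians are
  known. The one with order - \<mu> follows from evenness of V in \<mu>.\<close>

lemma ferrers_connection:
  assumes \<sigma>: "\<sigma> = 1 \<or> \<sigma> = - 1" and \<mu>: "\<bar>Re \<mu>\<bar> < Re \<nu> + 1"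
  shows "sin (of_real pi * \<mu>) * laplace_J \<sigma> \<nu> \<mu> (of_real t) =
    exp (\<sigma> * \<i> * pi * \<mu>) * Gamma (\<nu> - \<mu> + 1) * ferrers_sol \<nu> \<mu> (of_real t)
      - Gamma (\<nu> + \<mu> + 1) * ferrers_sol \<nu> (- \<mu>) (of_real t)"
proof -
  define V where "V = laplace_sol \<sigma> \<nu> \<mu> (of_real t)"
  define V' where "V' = laplace_sol' \<sigma> \<nu> \<mu> (of_real t)"
  define P where "P = ferrers_sol \<nu> \<mu> (of_real t)"
  define P' where "P' = ferrers_sol' \<nu> \<mu> (of_real t)"
  define Q where "Q = ferrers_sol \<nu> (- \<mu>) (of_real t)"
  define Q' where "Q' = ferrers_sol' \<nu> (- \<mu>) (of_real t)"
  define G where "G = Gamma (\<nu> + 1)"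
  define E where "E = exp (\<sigma> * \<i> * pi * (\<nu> + 1 + \<mu>) / 2)"
  have G0: "G \<noteq> 0" unfolding G_def using \<mu> by (intro Gamma_nonzero_Re_pos) auto
  have VP: "V * P' - V' * P = (\<sigma> * \<i>) powr (- (\<mu> + (\<nu> + 1))) * Gamma (\<mu> + (\<nu> + 1)) / G"
    unfolding V_def V'_def P_def P'_def G_def by (rule laplace_ferrers_wronskian[OF \<sigma> \<mu>])
  have VQ: "V * Q' - V' * Q = (\<sigma> * \<i>) powr (- (- \<mu> + (\<nu> + 1))) * Gamma (- \<mu> + (\<nu> + 1)) / G"
    using laplace_ferrers_wronskian[OF \<sigma>, of "- \<mu>" \<nu> t] \<mu>
    unfolding V_def V'_def Q_def Q'_def G_def laplace_sol_minus by simp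
  have PQ: "P * Q' - P' * Q = 2 * sin (of_real pi * \<mu>) / of_real pi"
    unfolding P_def P'_def Q_def Q'_def by (rule ferrers_wronskian)
  have "V * (P * Q' - P' * Q) = (V * Q' - V' * Q) * P - (V * P' - V' * P) * Q"
    by (simp add: algebra_simps)
  then have "G * E * (V * (2 * sin (of_real pi * \<mu>) / of_real pi)) =
      (E * (\<sigma> * \<i>) powr (- (- \<mu> + (\<nu> + 1)))) * Gamma (- \<mu> + (\<nu> + 1)) * P
      - (E * (\<sigma> * \<i>) powr (- (\<mu> + (\<nu> + 1)))) * Gamma (\<mu> + (\<nu> + 1)) * Q"
    unfolding VP VQ PQ using G0 by (simp add: right_diff_distrib mult_ac)
  moreover have "E * (\<sigma> * \<i>) powr (- (- \<mu> + (\<nu> + 1))) = exp (\<sigma> * \<i> * pi * \<mu>)"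
    unfolding E_def powr_sigma_i[OF \<sigma>] by (simp add: field_simps flip: exp_add)
  moreover have "E * (\<sigma> * \<i>) powr (- (\<mu> + (\<nu> + 1))) = 1"
    unfolding E_def powr_sigma_i[OF \<sigma>] by (simp add: field_simps flip: exp_add)
  moreover have "- \<mu> + (\<nu> + 1) = \<nu> - \<mu> + 1" "\<mu> + (\<nu> + 1) = \<nu> + \<mu> + 1" by simp_all
  ultimately have "G * E * (V * (2 * sin (of_real pi * \<mu>) / of_real pi)) =
      exp (\<sigma> * \<i> * pi * \<mu>) * Gamma (\<nu> - \<mu> + 1) * P - 1 * Gamma (\<nu> + \<mu> + 1) * Q"
    by (simp only:)
  moreover have "sin (of_real pi * \<mu>) * laplace_J \<sigma> \<nu> \<mu> (of_real t) =
      G * E * (V * (2 * sin (of_real pi * \<mu>) / of_real pi))"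
    unfolding laplace_J_def V_def[symmetric] G_def[symmetric] E_def[symmetric] by simp
  ultimately show ?thesis unfolding P_def Q_def by simp
qed

text \<open>In the difference over \<sigma> the solution of order - \<mu> drops out, and exp (i pi
  \<mu>) - exp (- i pi \<mu>) supplies a factor sin (pi \<mu>). It can be cancelled for Im \<mu> >
  0, where it has no zeros; continuation then reaches the integers.\<close>

lemma ferrers_sol_laplace:
  assumes \<mu>: "\<bar>Re \<mu>\<bar> < Re \<nu> + 1"
  shows "Gamma (\<nu> - \<mu> + 1) * ferrers_sol \<nu> \<mu> (of_real t) =
    (laplace_J 1 \<nu> \<mu> (of_real t) - laplace_J (- 1) \<nu> \<mu> (of_real t)) / (2 * \<i>)"
proof (rule analytic_continuation_open[where z = \<mu> and s = "{\<mu>. \<bar>Re \<mu>\<bar> < Re \<nu> + 1} \<inter> {\<mu>. Im \<mu> > 0}"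
      and s' = "{\<mu>. \<bar>Re \<mu>\<bar> < Re \<nu> + 1}"])
  show "{\<mu>. \<bar>Re \<mu>\<bar> < Re \<nu> + 1} \<inter> {\<mu>. Im \<mu> > 0} \<noteq> {}"
  proof -
    have "\<i> \<in> {\<mu>. \<bar>Re \<mu>\<bar> < Re \<nu> + 1} \<inter> {\<mu>. Im \<mu> > 0}" using \<mu> by auto
    then show ?thesis by blast
  qed
  have "\<nu> - u + 1 \<notin> \<int>\<^sub>\<le>\<^sub>0" if "\<bar>Re u\<bar> < Re \<nu> + 1" for u
    using that by (intro not_nonpos_Ints_Re_pos) simp
  then show "(\<lambda>\<mu>. Gamma (\<nu> - \<mu> + 1) * ferrers_sol \<nu> \<mu> (of_real t)) holomorphic_on {\<mu>. \<bar>Re \<mu>\<bar> < Re \<nu> + 1}"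
    by (intro holomorphic_on_mult holomorphic_ferrers_sol_order holomorphic_intros) auto
  show "(\<lambda>\<mu>. (laplace_J 1 \<nu> \<mu> (of_real t) - laplace_J (- 1) \<nu> \<mu> (of_real t)) / (2 * \<i>))
      holomorphic_on {\<mu>. \<bar>Re \<mu>\<bar> < Re \<nu> + 1}"
    by (intro holomorphic_intros holomorphic_laplace_J_order) auto
  fix u assume "u \<in> {\<mu>. \<bar>Re \<mu>\<bar> < Re \<nu> + 1} \<inter> {\<mu>. Im \<mu> > 0}"
  then have u: "\<bar>Re u\<bar> < Re \<nu> + 1" "Im u > 0" by auto
  have nz: "sin (of_real pi * u) \<noteq> 0"
  proof
    assume "sin (of_real pi * u) = 0"
    then obtain n :: int where "of_real pi * u = of_real (real_of_int n * pi)"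
      by (auto simp: sin_eq_0)
    then have "Im (of_real pi * u) = 0" by (metis Im_complex_of_real)
    then show False using u by simp
  qed
  have eq: "sin (of_real pi * u) * (laplace_J 1 \<nu> u (of_real t) - laplace_J (- 1) \<nu> u (of_real t)) =
      (exp (\<i> * (of_real pi * u)) - exp (- (\<i> * (of_real pi * u)))) * Gamma (\<nu> - u + 1) * ferrers_sol \<nu> u (of_real t)"
  proof -
    have "sin (of_real pi * u) * laplace_J 1 \<nu> u (of_real t) =
        exp (\<i> * (of_real pi * u)) * Gamma (\<nu> - u + 1) * ferrers_sol \<nu> u (of_real t)
        - Gamma (\<nu> + u + 1) * ferrers_sol \<nu> (- u) (of_real t)"
      "sin (of_real pi * u) * laplace_J (- 1) \<nu> u (of_real t) =
        exp (- (\<i> * (of_real pi * u))) * Gamma (\<nu> - u + 1) * ferrers_sol \<nu> u (of_real t)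
        - Gamma (\<nu> + u + 1) * ferrers_sol \<nu> (- u) (of_real t)"
      using ferrers_connection[of 1 u \<nu> t] ferrers_connection[of "-1" u \<nu> t] u(1)
      by (simp_all add: mult.assoc)
    then show ?thesis by (simp only: right_diff_distrib left_diff_distrib) simp
  qed
  have ex: "exp (\<i> * (of_real pi * u)) - exp (- (\<i> * (of_real pi * u))) = 2 * \<i> * sin (of_real pi * u)"
    by (simp add: sin_exp_eq)
  have "sin (of_real pi * u) * (laplace_J 1 \<nu> u (of_real t) - laplace_J (- 1) \<nu> u (of_real t)) =
      sin (of_real pi * u) * (2 * \<i> * (Gamma (\<nu> - u + 1) * ferrers_sol \<nu> u (of_real t)))"
    using eq unfolding ex by (simp only: mult_ac)
  then have "laplace_J 1 \<nu> u (of_real t) - laplace_J (- 1) \<nu> u (of_real t) =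
      2 * \<i> * (Gamma (\<nu> - u + 1) * ferrers_sol \<nu> u (of_real t))"
    using nz mult_left_cancel by blast
  then show "Gamma (\<nu> - u + 1) * ferrers_sol \<nu> u (of_real t) =
      (laplace_J 1 \<nu> u (of_real t) - laplace_J (- 1) \<nu> u (of_real t)) / (2 * \<i>)"
    by simp
next
  show "open ({\<mu>. \<bar>Re \<mu>\<bar> < Re \<nu> + 1} \<inter> {\<mu>. Im \<mu> > 0})"
    by (intro open_Int open_strip open_halfspace_Im_gt)
  show "\<mu> \<in> {\<mu>. \<bar>Re \<mu>\<bar> < Re \<nu> + 1}" using \<mu> by simp
qed (rule open_strip connected_strip Int_lower1)+


section \<open>Back to the variable \<zeta>\<close>

lemma half_angle_substitution:
  fixes \<zeta> :: real
  assumes "0 < \<zeta>" "\<zeta> < pi"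
  defines "t \<equiv> ln (tan (\<zeta> / 2))"
  shows "cosh t = 1 / sin \<zeta>" "sinh t = - cot \<zeta>" "exp t / (2 * cosh t) = (1 - cos \<zeta>) / 2"
    "(1 + cos \<zeta>) / (1 - cos \<zeta>) = exp (- 2 * t)"
proof -
  define s c where "s = sin (\<zeta> / 2)" and "c = cos (\<zeta> / 2)"
  have pos: "s > 0" "c > 0" using assms unfolding s_def c_def by (auto intro!: sin_gt_zero cos_gt_zero)
  have sc: "s\<^sup>2 + c\<^sup>2 = 1" by (simp add: s_def c_def)
  have sin: "sin \<zeta> = 2 * s * c" using sin_double[of "\<zeta> / 2"] by (simp add: s_def c_def)
  have cos: "cos \<zeta> = c\<^sup>2 - s\<^sup>2" using cos_double[of "\<zeta> / 2"] by (simp add: s_def c_def)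
  have tan: "tan (\<zeta> / 2) = s / c" by (simp add: tan_def s_def c_def)
  have e: "exp t = s / c" "exp (- t) = c / s" using pos by (simp_all add: t_def tan exp_minus)
  have ch: "cosh t = (s\<^sup>2 + c\<^sup>2) / (2 * s * c)"
    unfolding cosh_field_def e using pos by (simp add: field_simps power2_eq_square)
  have sh: "sinh t = (s\<^sup>2 - c\<^sup>2) / (2 * s * c)"
    unfolding sinh_field_def e using pos by (simp add: field_simps power2_eq_square)
  show 1: "cosh t = 1 / sin \<zeta>" using ch sc by (simp add: sin)
  show "sinh t = - cot \<zeta>" unfolding sh cot_def sin cos by (simp add: diff_divide_distrib)
  have c1: "1 - cos \<zeta> = 2 * s\<^sup>2" "1 + cos \<zeta> = 2 * c\<^sup>2" using sc cos by simp_all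
  show "exp t / (2 * cosh t) = (1 - cos \<zeta>) / 2"
    unfolding 1 e c1 sin using pos by (simp add: power2_eq_square)
  have "exp (- 2 * t) = exp (- t) * exp (- t)" by (simp flip: exp_add)
  then show "(1 + cos \<zeta>) / (1 - cos \<zeta>) = exp (- 2 * t)"
    unfolding e c1 using pos by (simp add: power2_eq_square)
qed

lemma of_real_exp_powr: "complex_of_real (exp x) powr s = exp (s * of_real x)"
  by (simp add: powr_def Ln_of_real)

lemma ferrers_P_eq_sol:
  assumes "0 < \<zeta>" "\<zeta> < pi"
  shows "ferrers_P \<nu> \<mu> (cos \<zeta>) = ferrers_sol \<nu> \<mu> (of_real (ln (tan (\<zeta> / 2))))"
  unfolding ferrers_P_def ferrers_sol_def sigmoid_real half_angle_substitution(3,4)[OF assms] of_real_exp_powr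
  by simp

lemma ferrers_Q_nonint_eq_sol:
  assumes "0 < \<zeta>" "\<zeta> < pi"
  defines "t \<equiv> ln (tan (\<zeta> / 2))"
  shows "ferrers_Q_nonint \<nu> \<mu> (cos \<zeta>) = of_real pi / (2 * sin (of_real pi * \<mu>)) *
    (cos (of_real pi * \<mu>) * ferrers_sol \<nu> \<mu> (of_real t) -
     Gamma (\<nu> + \<mu> + 1) / Gamma (\<nu> - \<mu> + 1) * ferrers_sol \<nu> (- \<mu>) (of_real t))"
proof -
  have "(1 - cos \<zeta>) / (1 + cos \<zeta>) = inverse ((1 + cos \<zeta>) / (1 - cos \<zeta>))" by simp
  also have "\<dots> = exp (2 * t)"
    unfolding t_def half_angle_substitution[OF assms(1,2)] by (simp add: exp_minus)
  finally have "(1 - cos \<zeta>) / (1 + cos \<zeta>) = exp (2 * t)" .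
  then show ?thesis
    unfolding ferrers_Q_nonint_def ferrers_sol_def sigmoid_real t_def[symmetric]
      half_angle_substitution(3,4)[OF assms(1,2), folded t_def] of_real_exp_powr
    by (simp add: of_real_exp_powr mult.assoc)
qed

lemma sin_pi_nonzero: "\<mu> \<notin> \<int> \<Longrightarrow> sin (of_real pi * \<mu>) \<noteq> (0::complex)"
  by (auto simp: sin_eq_0)

text \<open>The sum over \<sigma> turns the exponentials into 2 cos (pi \<mu>), which is the
  combination in the definition of Q.\<close>

lemma ferrers_Q_nonint_laplace:
  assumes \<zeta>: "0 < \<zeta>" "\<zeta> < pi" and \<mu>: "\<bar>Re \<mu>\<bar> < Re \<nu> + 1" "\<mu> \<notin> \<int>"
  defines "t \<equiv> ln (tan (\<zeta> / 2))"
  shows "ferrers_Q_nonint \<nu> \<mu> (cos \<zeta>) =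
    of_real pi / 4 * (laplace_J 1 \<nu> \<mu> (of_real t) + laplace_J (- 1) \<nu> \<mu> (of_real t)) / Gamma (\<nu> - \<mu> + 1)"
proof -
  define S where "S = sin (of_real pi * \<mu>)"
  define P where "P = ferrers_sol \<nu> \<mu> (of_real t)"
  define Q where "Q = ferrers_sol \<nu> (- \<mu>) (of_real t)"
  define G where "G = Gamma (\<nu> - \<mu> + 1)"
  define H where "H = Gamma (\<nu> + \<mu> + 1)"
  define J where "J = laplace_J 1 \<nu> \<mu> (of_real t) + laplace_J (- 1) \<nu> \<mu> (of_real t)"
  have S0: "S \<noteq> 0" using \<mu> sin_pi_nonzero by (simp add: S_def)
  have G0: "G \<noteq> 0" unfolding G_def using \<mu> by (intro Gamma_nonzero_Re_pos) auto
  have "S * laplace_J 1 \<nu> \<mu> (of_real t) = exp (\<i> * (of_real pi * \<mu>)) * G * P - H * Q"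
    "S * laplace_J (- 1) \<nu> \<mu> (of_real t) = exp (- (\<i> * (of_real pi * \<mu>))) * G * P - H * Q"
    using ferrers_connection[of 1 \<mu> \<nu> t] ferrers_connection[of "-1" \<mu> \<nu> t] \<mu>(1)
    unfolding S_def G_def P_def H_def Q_def by (simp_all add: mult.assoc)
  then have "S * J = (exp (\<i> * (of_real pi * \<mu>)) + exp (- (\<i> * (of_real pi * \<mu>)))) * (G * P) - 2 * (H * Q)"
    unfolding J_def by (simp only: distrib_left distrib_right) simp
  also have "exp (\<i> * (of_real pi * \<mu>)) + exp (- (\<i> * (of_real pi * \<mu>))) = 2 * cos (of_real pi * \<mu>)"
    by (simp add: cos_exp_eq)
  finally have J: "J = 2 * (cos (of_real pi * \<mu>) * (G * P) - H * Q) / S"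
    using S0 by (simp add: field_simps)
  show ?thesis
    unfolding ferrers_Q_nonint_eq_sol[OF \<zeta>] t_def[symmetric] S_def[symmetric] P_def[symmetric]
      Q_def[symmetric] G_def[symmetric] H_def[symmetric] J_def[symmetric] J
    using S0 G0 by (simp add: field_simps)
qed

text \<open>The right-hand side is continuous in \<mu>, also at integers, and agrees with the
  quotient formula at nearby non-integers; so the limit in the definition exists and has this
  value.\<close>

lemma ferrers_Q_laplace:
  assumes \<zeta>: "0 < \<zeta>" "\<zeta> < pi" and \<mu>: "\<bar>Re \<mu>\<bar> < Re \<nu> + 1"
  defines "t \<equiv> ln (tan (\<zeta> / 2))"
  shows "ferrers_Q \<nu> \<mu> (cos \<zeta>) =
    of_real pi / 4 * (laplace_J 1 \<nu> \<mu> (of_real t) + laplace_J (- 1) \<nu> \<mu> (of_real t)) / Gamma (\<nu> - \<mu> + 1)"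
proof (cases "\<mu> \<in> \<int>")
  case False
  then show ?thesis
    using ferrers_Q_nonint_laplace[OF \<zeta> \<mu>] by (simp add: ferrers_Q_def t_def)
next
  case True
  define f where "f = (\<lambda>\<mu>. of_real pi / 4 *
    (laplace_J 1 \<nu> \<mu> (of_real t) + laplace_J (- 1) \<nu> \<mu> (of_real t)) / Gamma (\<nu> - \<mu> + 1))"
  let ?S = "{\<mu>. \<bar>Re \<mu>\<bar> < Re \<nu> + 1}"
  have "\<nu> - u + 1 \<notin> \<int>\<^sub>\<le>\<^sub>0" if "u \<in> ?S" for u
    using that by (intro not_nonpos_Ints_Re_pos) simp
  then have "(\<lambda>u. Gamma (\<nu> - u + 1)) holomorphic_on ?S" by (intro holomorphic_intros) auto
  moreover have "Gamma (\<nu> - u + 1) \<noteq> 0" if "u \<in> ?S" for u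
    using that by (intro Gamma_nonzero_Re_pos) simp
  ultimately have "f holomorphic_on ?S"
    unfolding f_def
    by (intro holomorphic_on_divide holomorphic_on_mult holomorphic_on_add holomorphic_on_const
          holomorphic_laplace_J_order)
  then have "isCont f \<mu>"
    using \<mu> open_strip[of "Re \<nu> + 1"] holomorphic_on_imp_continuous_on continuous_on_eq_continuous_at by blast
  then have "(f \<longlongrightarrow> f \<mu>) (at \<mu>)" by (simp add: isCont_def)
  moreover have "eventually (\<lambda>m. f m = ferrers_Q_nonint \<nu> m (cos \<zeta>)) (at \<mu>)"
  proof -
    have "eventually (\<lambda>m. m \<in> ?S) (at \<mu>)"
      using \<mu> open_strip[of "Re \<nu> + 1"] by (intro eventually_at_in_open') auto
    moreover have "eventually (\<lambda>m. dist m \<mu> < 1 \<and> m \<noteq> \<mu>) (at \<mu>)"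
      unfolding eventually_at by (intro exI[of _ 1]) auto
    ultimately show ?thesis
    proof eventually_elim
      case (elim m)
      have "m \<notin> \<int>"
      proof
        assume "m \<in> \<int>"
        then obtain k l :: int where "m = of_int k" "\<mu> = of_int l" using True by (auto elim!: Ints_cases)
        then have "norm (of_int (k - l) :: complex) < 1" "k \<noteq> l" using elim by (auto simp: dist_norm)
        then show False by (simp only: norm_of_int)
      qed
      then show ?case using ferrers_Q_nonint_laplace[OF \<zeta>, of m \<nu>] elim by (simp add: f_def t_def)
    qed
  qed
  ultimately have "((\<lambda>m. ferrers_Q_nonint \<nu> m (cos \<zeta>)) \<longlongrightarrow> f \<mu>) (at \<mu>)"
    by (rule Lim_transform_eventually)
  then have "Lim (at \<mu>) (\<lambda>m. ferrers_Q_nonint \<nu> m (cos \<zeta>)) = f \<mu>"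
    by (intro tendsto_Lim) auto
  then show ?thesis using True by (simp add: ferrers_Q_def f_def)
qed

lemma ferrers_P_laplace:
  assumes \<zeta>: "0 < \<zeta>" "\<zeta> < pi" and \<mu>: "\<bar>Re \<mu>\<bar> < Re \<nu> + 1"
  defines "t \<equiv> ln (tan (\<zeta> / 2))"
  shows "ferrers_P \<nu> \<mu> (cos \<zeta>) =
    (laplace_J 1 \<nu> \<mu> (of_real t) - laplace_J (- 1) \<nu> \<mu> (of_real t)) / (2 * \<i>) / Gamma (\<nu> - \<mu> + 1)"
proof -
  have "Gamma (\<nu> - \<mu> + 1) \<noteq> 0" using \<mu> by (intro Gamma_nonzero_Re_pos) auto
  then show ?thesis
    using ferrers_sol_laplace[OF \<mu>, of t] unfolding ferrers_P_eq_sol[OF \<zeta>] t_def[symmetric]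
    by (simp add: field_simps)
qed

section \<open>A Stieltjes transform\<close>

text \<open>This is 1 / (1 + cosh y), with values in (0, 1/2]. Taken as the integration variable, it
  would give the transform its usual shape; \<open>stieltjes_weight N\<close> carries its N-th
  power.\<close>

definition stieltjes_ratio :: "real \<Rightarrow> real" where
  "stieltjes_ratio y = 2 / (2 * cosh (y / 2)) ^ 2"

definition stieltjes_weight :: "nat \<Rightarrow> real \<Rightarrow> real" where
  "stieltjes_weight N y = 2 ^ N / (2 * cosh (y / 2)) ^ (2 * N + 1)"

text \<open>This is 2^N B(N + 1/2 - x, N + 1/2 + x). The complex version serves the expansion, the
  real one the bounds, where it stays finite for |x| < N + 1/2 even at points where
  \<open>a_coeff\<close> and the cosine vanish together.\<close>

definition stieltjes_moment :: "nat \<Rightarrow> 'a \<Rightarrow> 'a::Gamma" where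
  "stieltjes_moment N x = 2 ^ N * (Gamma (of_nat N + 1 / 2 - x) * Gamma (of_nat N + 1 / 2 + x) / fact (2 * N))"

definition stieltjes :: "complex \<Rightarrow> nat \<Rightarrow> complex \<Rightarrow> complex" where
  "stieltjes \<mu> N z = (\<integral>y. exp (\<mu> * of_real y) * of_real (stieltjes_weight N y) / (1 + z * of_real (stieltjes_ratio y)) \<partial>lborel)"

lemma stieltjes_ratio_pos: "stieltjes_ratio y > 0"
  by (simp add: stieltjes_ratio_def)

lemma stieltjes_weight_pos: "stieltjes_weight N y > 0"
  by (simp add: stieltjes_weight_def)

lemma stieltjes_weight_Suc: "stieltjes_weight (Suc N) y = stieltjes_ratio y * stieltjes_weight N y"
proof -
  have "2 * Suc N + 1 = 2 + (2 * N + 1)" by simp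
  then show ?thesis
    unfolding stieltjes_weight_def stieltjes_ratio_def by (simp only: power_add power_Suc times_divide_times_eq)
qed

lemma stieltjes_measurable [measurable]:
  "stieltjes_ratio \<in> borel_measurable borel" "stieltjes_weight N \<in> borel_measurable borel"
  unfolding stieltjes_ratio_def[abs_def] stieltjes_weight_def[abs_def] cosh_def by measurable

lemma stieltjes_weight_le: "stieltjes_weight N y \<le> 2 ^ N * exp (- (real N + 1 / 2) * \<bar>y\<bar>)"
proof -
  have "exp (\<bar>y\<bar> / 2) \<le> 2 * cosh (y / 2)" using exp_abs_le_cosh[of "y / 2"] by simp
  then have "exp (\<bar>y\<bar> / 2) ^ (2 * N + 1) \<le> (2 * cosh (y / 2)) ^ (2 * N + 1)"
    by (intro power_mono) auto
  then have "stieltjes_weight N y \<le> 2 ^ N / exp (\<bar>y\<bar> / 2) ^ (2 * N + 1)"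
    unfolding stieltjes_weight_def by (intro divide_left_mono) auto
  also have "exp (\<bar>y\<bar> / 2) ^ (2 * N + 1) = exp ((real N + 1 / 2) * \<bar>y\<bar>)"
    unfolding exp_of_nat_mult[symmetric] by (simp add: field_simps)
  finally show ?thesis by (simp add: exp_minus field_simps)
qed

text \<open>The factorisation 1 + exp y = 2 exp (y / 2) cosh (y / 2) turns the weight into the Beta
  kernel with p + r = 2 N + 1, hence the factorial of 2 N.\<close>

lemma has_bochner_integral_stieltjes_moment:
  assumes "\<bar>Re \<mu>\<bar> < real N + 1 / 2"
  shows "has_bochner_integral lborel (\<lambda>y. exp (\<mu> * of_real y) * of_real (stieltjes_weight N y)) (stieltjes_moment N \<mu>)"
proof -
  define p r where "p = of_nat N + 1 / 2 - \<mu>" and "r = of_nat N + 1 / 2 + \<mu>"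
  have pr: "Re p > 0" "Re r > 0" using assms by (auto simp: p_def r_def)
  have sum: "p + r = of_nat (2 * N + 1)" by (simp add: p_def r_def)
  have "exp (\<mu> * of_real y) * of_real (stieltjes_weight N y) =
      2 ^ N * (exp (r * of_real y) * of_real (1 + exp y) powr (- (p + r)))" for y
  proof -
    define s where "s = exp (y / 2)"
    have s: "s > 0" by (simp add: s_def)
    have "1 + exp y = s * (2 * cosh (y / 2))"
    proof -
      have "exp (y / 2) * exp (y / 2) = exp y" "exp (y / 2) * exp (- (y / 2)) = 1"
        by (simp_all flip: exp_add)
      then show ?thesis by (simp add: s_def cosh_field_def distrib_left)
    qed
    then have "(1 + exp y) ^ (2 * N + 1) = s ^ (2 * N + 1) * (2 * cosh (y / 2)) ^ (2 * N + 1)"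
      by (simp only: power_mult_distrib)
    then have w: "stieltjes_weight N y = 2 ^ N * (s ^ (2 * N + 1) / (1 + exp y) ^ (2 * N + 1))"
      using s by (simp add: stieltjes_weight_def)
    have ne: "complex_of_real (1 + exp y) \<noteq> 0" by (metis add_pos_pos exp_gt_zero less_irrefl of_real_eq_0_iff zero_less_one)
    have "complex_of_real (1 + exp y) powr (- (p + r)) = inverse (of_real (1 + exp y) ^ (2 * N + 1))"
      unfolding sum powr_minus using ne by (simp only: powr_nat if_False)
    moreover have "exp (r * of_real y) = exp (\<mu> * of_real y) * of_real (s ^ (2 * N + 1))"
    proof -
      have "s ^ (2 * N + 1) = exp ((real N + 1 / 2) * y)"
        unfolding s_def exp_of_nat_mult[symmetric] by (simp add: field_simps)
      then have "complex_of_real (s ^ (2 * N + 1)) = exp (of_real ((real N + 1 / 2) * y))"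
        by (simp only: exp_of_real)
      then show ?thesis
        by (simp only: exp_add[symmetric] r_def) (simp add: algebra_simps)
    qed
    ultimately show ?thesis unfolding w by (simp add: divide_inverse)
  qed
  moreover have "has_bochner_integral lborel
      (\<lambda>y. 2 ^ N * (exp (r * of_real y) * of_real (1 + exp y) powr (- (p + r)))) (2 ^ N * (Gamma p * Gamma r / Gamma (p + r)))"
    by (intro has_bochner_integral_mult_right has_bochner_integral_Beta_exp pr)
  moreover have "Gamma (p + r) = fact (2 * N)"
    unfolding sum using Gamma_fact[of "2 * N", where ?'a = complex] by (simp add: add.commute)
  ultimately show ?thesis by (simp add: stieltjes_moment_def p_def r_def)
qed

lemma stieltjes_moment_of_real: "stieltjes_moment N (complex_of_real x) = of_real (stieltjes_moment N x)"
proof -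
  have "of_nat N + 1 / 2 - complex_of_real x = of_real (real N + 1 / 2 - x)"
    "of_nat N + 1 / 2 + complex_of_real x = of_real (real N + 1 / 2 + x)" by simp_all
  then show ?thesis unfolding stieltjes_moment_def by (simp only: Gamma_complex_of_real) simp
qed

lemma has_bochner_integral_stieltjes_moment_real:
  assumes "\<bar>x\<bar> < real N + 1 / 2"
  shows "has_bochner_integral lborel (\<lambda>y. exp (x * y) * stieltjes_weight N y) (stieltjes_moment N x)"
proof -
  have "has_bochner_integral lborel (\<lambda>y. exp (of_real x * of_real y) * of_real (stieltjes_weight N y))
      (complex_of_real (stieltjes_moment N x))"
    using has_bochner_integral_stieltjes_moment[of "of_real x" N] assms by (simp add: stieltjes_moment_of_real)
  then have "has_bochner_integral lborel (\<lambda>y. Re (exp (of_real x * of_real y) * of_real (stieltjes_weight N y)))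
      (Re (complex_of_real (stieltjes_moment N x)))"
    by (rule has_bochner_integral_bounded_linear[OF bounded_linear_Re])
  moreover have "Re (exp (complex_of_real x * of_real y) * of_real (stieltjes_weight N y)) = exp (x * y) * stieltjes_weight N y" for y
    by (simp add: Re_exp)
  ultimately show ?thesis by (simp only: Re_complex_of_real)
qed

lemma norm_stieltjes_denom: "Re z \<ge> 0 \<Longrightarrow> norm (1 + z * of_real (stieltjes_ratio y)) \<ge> 1"
  using complex_Re_le_cmod[of "1 + z * of_real (stieltjes_ratio y)"] stieltjes_ratio_pos[of y]
  by (simp add: order_trans[rotated])

lemma stieltjes_denom_nonzero: "Re z \<ge> 0 \<Longrightarrow> 1 + z * of_real (stieltjes_ratio y) \<noteq> 0"
  using norm_stieltjes_denom[of z y] by auto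

lemma norm_stieltjes_kernel_le:
  assumes "Re z \<ge> 0"
  shows "norm (exp (\<mu> * of_real y) * of_real (stieltjes_weight N y) / (1 + z * of_real (stieltjes_ratio y))) \<le>
    exp (Re \<mu> * y) * stieltjes_weight N y"
proof -
  have "exp (Re \<mu> * y) * stieltjes_weight N y / norm (1 + z * of_real (stieltjes_ratio y)) \<le> exp (Re \<mu> * y) * stieltjes_weight N y / 1"
    using norm_stieltjes_denom[OF assms, of y] stieltjes_weight_pos[of N y] by (intro divide_left_mono) auto
  then show ?thesis
    using stieltjes_weight_pos[of N y] by (simp add: norm_divide norm_mult norm_exp_eq_Re)
qed

lemma integrable_stieltjes_kernel:
  assumes "Re z \<ge> 0" "\<bar>Re \<mu>\<bar> < real N + 1 / 2"
  shows "integrable lborel (\<lambda>y. exp (\<mu> * of_real y) * of_real (stieltjes_weight N y) / (1 + z * of_real (stieltjes_ratio y)))"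
proof (rule Bochner_Integration.integrable_bound)
  show "integrable lborel (\<lambda>y. exp (Re \<mu> * y) * stieltjes_weight N y)"
    using has_bochner_integral_stieltjes_moment_real[OF assms(2)] by (simp add: has_bochner_integral_iff)
  show "AE y in lborel. norm (exp (\<mu> * of_real y) * of_real (stieltjes_weight N y) / (1 + z * of_real (stieltjes_ratio y)))
      \<le> norm (exp (Re \<mu> * y) * stieltjes_weight N y)"
    using order_trans[OF norm_stieltjes_kernel_le[OF assms(1)] abs_ge_self] by (intro AE_I2) simp
qed simp

text \<open>Passing to moduli replaces exp (\<mu> y) by exp (Re \<mu> y) and the denominator by 1,
  uniformly in z. This is why the bounds contain a_N at Re \<mu>.\<close>

lemma norm_stieltjes_le:
  assumes "Re z \<ge> 0" "\<bar>Re \<mu>\<bar> < real N + 1 / 2"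
  shows "norm (stieltjes \<mu> N z) \<le> stieltjes_moment N (Re \<mu>)"
proof -
  have "norm (stieltjes \<mu> N z) \<le> (\<integral>y. exp (Re \<mu> * y) * stieltjes_weight N y \<partial>lborel)"
    unfolding stieltjes_def
    using has_bochner_integral_stieltjes_moment_real[OF assms(2)] assms
    by (intro Bochner_Integration.integral_norm_bound_integral integrable_stieltjes_kernel norm_stieltjes_kernel_le)
       (auto simp: has_bochner_integral_iff)
  then show ?thesis
    using has_bochner_integral_stieltjes_moment_real[OF assms(2)] by (simp add: has_bochner_integral_iff)
qed

text \<open>With \<kappa> the ratio, 1 / (1 + z \<kappa>) = 1 - z \<kappa> / (1 + z \<kappa>), and
  \<kappa> times a weight is the next weight. Each use splits off one term of the expansion.\<close>

lemma stieltjes_rec: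
  assumes "Re z \<ge> 0" "\<bar>Re \<mu>\<bar> < real N + 1 / 2"
  shows "stieltjes \<mu> N z = stieltjes_moment N \<mu> - z * stieltjes \<mu> (Suc N) z"
proof -
  have pt: "exp (\<mu> * of_real y) * of_real (stieltjes_weight N y) / (1 + z * of_real (stieltjes_ratio y)) =
      exp (\<mu> * of_real y) * of_real (stieltjes_weight N y) -
      z * (exp (\<mu> * of_real y) * of_real (stieltjes_weight (Suc N) y) / (1 + z * of_real (stieltjes_ratio y)))" for y
    using stieltjes_denom_nonzero[OF assms(1), of y] by (simp add: stieltjes_weight_Suc divide_simps) (simp add: algebra_simps)
  have "has_bochner_integral lborel (\<lambda>y. exp (\<mu> * of_real y) * of_real (stieltjes_weight (Suc N) y) /
      (1 + z * of_real (stieltjes_ratio y))) (stieltjes \<mu> (Suc N) z)"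
    unfolding stieltjes_def
    using integrable_stieltjes_kernel[OF assms(1), of \<mu> "Suc N"] assms(2)
    by (intro has_bochner_integral_integrable) auto
  from has_bochner_integral_diff[OF has_bochner_integral_stieltjes_moment[OF assms(2)]
      has_bochner_integral_mult_right[OF this, of z]]
  show ?thesis unfolding stieltjes_def[of \<mu> N] pt by (rule has_bochner_integral_integral_eq)
qed

lemma holomorphic_stieltjes: "\<bar>Re \<mu>\<bar> < real N + 1 / 2 \<Longrightarrow> stieltjes \<mu> N holomorphic_on {z. Re z > 0}"
  unfolding stieltjes_def[abs_def]
proof (rule holomorphic_on_lebesgue_integral)
  show "open {z. Re z > 0}" by (rule open_halfspace_Re_gt)
  show "(\<lambda>z. exp (\<mu> * of_real y) * of_real (stieltjes_weight N y) / (1 + z * of_real (stieltjes_ratio y)))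
      holomorphic_on {z. Re z > 0}" for y
    using stieltjes_denom_nonzero[of _ y] by (intro holomorphic_intros) (auto simp: less_imp_le)
  fix z assume \<mu>: "\<bar>Re \<mu>\<bar> < real N + 1 / 2" and "z \<in> {z. Re z > 0}"
  then have z: "Re z > 0" by simp
  have "cball z (Re z / 2) \<subseteq> {z. Re z > 0}"
  proof
    fix u assume "u \<in> cball z (Re z / 2)"
    then have "\<bar>Re (z - u)\<bar> \<le> Re z / 2" using abs_Re_le_cmod[of "z - u"] by (simp add: dist_norm)
    then show "u \<in> {z. Re z > 0}" using z unfolding abs_le_iff by simp
  qed
  then show "\<exists>r>0. \<exists>g. cball z r \<subseteq> {z. Re z > 0} \<and> integrable lborel g \<and>
      (\<forall>u\<in>cball z r. \<forall>y\<in>space lborel. norm (exp (\<mu> * of_real y) * of_real (stieltjes_weight N y) / (1 + u * of_real (stieltjes_ratio y))) \<le> g y)"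
    using z has_bochner_integral_stieltjes_moment_real[OF \<mu>] norm_stieltjes_kernel_le[of _ \<mu> _ N]
    by (intro exI[of _ "Re z / 2"] exI[of _ "\<lambda>y. exp (Re \<mu> * y) * stieltjes_weight N y"])
       (auto simp: has_bochner_integral_iff less_imp_le subset_iff)
qed auto

lemma holomorphic_stieltjes_order:
  assumes "Re z \<ge> 0"
  shows "(\<lambda>\<mu>. stieltjes \<mu> N z) holomorphic_on {\<mu>. \<bar>Re \<mu>\<bar> < real N + 1 / 2}"
  unfolding stieltjes_def
proof (rule holomorphic_on_lebesgue_integral)
  show "open {\<mu>. \<bar>Re \<mu>\<bar> < real N + 1 / 2}" by (rule open_strip)
  show "(\<lambda>\<mu>. exp (\<mu> * of_real y) * of_real (stieltjes_weight N y) / (1 + z * of_real (stieltjes_ratio y)))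
      holomorphic_on {\<mu>. \<bar>Re \<mu>\<bar> < real N + 1 / 2}" for y
    using stieltjes_denom_nonzero[OF assms, of y] by (intro holomorphic_intros) auto
  fix \<mu> assume "\<mu> \<in> {\<mu>. \<bar>Re \<mu>\<bar> < real N + 1 / 2}"
  then have \<mu>: "\<bar>Re \<mu>\<bar> < real N + 1 / 2" by simp
  \<comment> \<open>Halfway between |Re \<mu>| and N + 1/2, the decay rate of the weight.\<close>
  define m where "m = (\<bar>Re \<mu>\<bar> + (real N + 1 / 2)) / 2"
  have m: "m - \<bar>Re \<mu>\<bar> > 0" "m < real N + 1 / 2" using \<mu> by (auto simp: m_def field_simps)
  have u: "\<bar>Re v\<bar> \<le> m" if "v \<in> cball \<mu> (m - \<bar>Re \<mu>\<bar>)" for v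
    using that abs_Re_le_cmod[of "\<mu> - v"] by (simp add: dist_norm)
  show "\<exists>r>0. \<exists>g. cball \<mu> r \<subseteq> {\<mu>. \<bar>Re \<mu>\<bar> < real N + 1 / 2} \<and> integrable lborel g \<and>
      (\<forall>u\<in>cball \<mu> r. \<forall>y\<in>space lborel. norm (exp (u * of_real y) * of_real (stieltjes_weight N y) / (1 + z * of_real (stieltjes_ratio y))) \<le> g y)"
  proof (intro exI conjI ballI)
    show "m - \<bar>Re \<mu>\<bar> > 0" by fact
    show "cball \<mu> (m - \<bar>Re \<mu>\<bar>) \<subseteq> {\<mu>. \<bar>Re \<mu>\<bar> < real N + 1 / 2}" using u m by force
    show "integrable lborel (\<lambda>y. 2 ^ N * exp (- (real N + 1 / 2 - m) * \<bar>y\<bar>))"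
      using m by (intro integrable_mult_right integrable_exp_neg_abs) auto
    fix v y assume "v \<in> cball \<mu> (m - \<bar>Re \<mu>\<bar>)"
    then have v: "\<bar>Re v\<bar> \<le> m" by (rule u)
    have "exp (\<bar>Re v\<bar> * \<bar>y\<bar>) \<le> exp (m * \<bar>y\<bar>)" using v by (simp add: mult_right_mono)
    with exp_times_le_exp_abs[of "Re v" y] have "exp (Re v * y) \<le> exp (m * \<bar>y\<bar>)" by linarith
    then have "exp (Re v * y) * stieltjes_weight N y \<le> exp (m * \<bar>y\<bar>) * (2 ^ N * exp (- (real N + 1 / 2) * \<bar>y\<bar>))"
      using stieltjes_weight_le[of N y] stieltjes_weight_pos[of N y] by (intro mult_mono) auto
    also have "\<dots> = 2 ^ N * (exp (m * \<bar>y\<bar>) * exp (- (real N + 1 / 2) * \<bar>y\<bar>))" by (simp only: mult_ac)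
    also have "exp (m * \<bar>y\<bar>) * exp (- (real N + 1 / 2) * \<bar>y\<bar>) = exp (- (real N + 1 / 2 - m) * \<bar>y\<bar>)"
      by (simp add: algebra_simps flip: exp_add)
    finally show "norm (exp (v * of_real y) * of_real (stieltjes_weight N y) / (1 + z * of_real (stieltjes_ratio y)))
        \<le> 2 ^ N * exp (- (real N + 1 / 2 - m) * \<bar>y\<bar>)"
      using norm_stieltjes_kernel_le[OF assms, of v y N] by linarith
  qed
qed simp

section \<open>The coefficients a_n as moments\<close>

lemma a_coeff_pochhammer:
  fixes x :: "'a::field_char_0"
  shows "a_coeff n x = (-1) ^ n * (pochhammer (1 / 2 - x) n * pochhammer (1 / 2 + x) n) / (2 ^ n * fact n)"
proof -
  have "(\<Prod>k=1..n. 4 * x\<^sup>2 - (2 * of_nat k - 1)\<^sup>2) = (-4) ^ n * (pochhammer (1 / 2 - x) n * pochhammer (1 / 2 + x) n)"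
  proof (induction n)
    case (Suc n)
    have "4 * x\<^sup>2 - (2 * of_nat (Suc n) - 1)\<^sup>2 = (-4) * ((1 / 2 - x + of_nat n) * (1 / 2 + x + of_nat n))"
      by (simp add: field_simps power2_eq_square)
    then show ?case using Suc by (simp add: pochhammer_Suc)
  qed simp
  moreover have "(8::'a) ^ n = 4 ^ n * 2 ^ n" "(-4::'a) ^ n = (-1) ^ n * 4 ^ n"
    by (simp_all flip: power_mult_distrib)
  ultimately show ?thesis
    unfolding a_coeff_def by simp
qed

lemma fact_double_pochhammer_half: "fact (2 * n) = (4 ^ n * pochhammer (1 / 2) n * fact n :: 'a::field_char_0)"
proof -
  have "(2::'a) ^ (2 * n) = 4 ^ n" by (simp add: power_mult)
  then show ?thesis using fact_double[of n, where ?'a = 'a] by simp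
qed

lemma pochhammer_half_nonzero: "pochhammer (1 / 2 :: 'a::field_char_0) n \<noteq> 0"
proof
  assume "pochhammer (1 / 2 :: 'a) n = 0"
  then have "fact (2 * n) = (0 :: 'a)" by (simp add: fact_double_pochhammer_half)
  then show False by simp
qed

text \<open>By (2n)! = 4^n (1/2)_n n! the moment is a_n Gamma (1/2 - x) Gamma (1/2 + x) up to a sign
  and (1/2)_n, and the Gamma product is pi / cos (pi x). The symbol (1/2)_n will cancel against
  Gamma (n + 1/2) from the Beta integrals.\<close>

lemma stieltjes_moment_a_coeff:
  fixes x :: "'a::Gamma"
  assumes "1 / 2 - x \<notin> \<int>\<^sub>\<le>\<^sub>0" "1 / 2 + x \<notin> \<int>\<^sub>\<le>\<^sub>0"
  shows "pochhammer (1 / 2) n * stieltjes_moment n x = (-1) ^ n * a_coeff n x * (Gamma (1 / 2 - x) * Gamma (1 / 2 + x))"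
proof -
  have "Gamma (of_nat n + 1 / 2 - x) = pochhammer (1 / 2 - x) n * Gamma (1 / 2 - x)"
    "Gamma (of_nat n + 1 / 2 + x) = pochhammer (1 / 2 + x) n * Gamma (1 / 2 + x)"
    using assms pochhammer_Gamma[of "1 / 2 - x" n] pochhammer_Gamma[of "1 / 2 + x" n]
    by (simp_all add: algebra_simps Gamma_eq_zero_iff)
  moreover have "pochhammer (1 / 2 :: 'a) n \<noteq> 0" by (rule pochhammer_half_nonzero)
  moreover have "(4::'a) ^ n = 2 ^ n * 2 ^ n" by (simp flip: power_mult_distrib)
  moreover have "(-1 :: 'a) ^ n * (-1) ^ n = 1" by (simp flip: power_mult_distrib)
  ultimately show ?thesis
    unfolding stieltjes_moment_def a_coeff_pochhammer fact_double_pochhammer_half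
    by (simp add: field_simps)
qed

lemma Gamma_reflection_half: "Gamma (1 / 2 - z) * Gamma (1 / 2 + z) = of_real pi / cos (of_real pi * z)" for z :: complex
proof -
  have "Gamma (1 / 2 + z) * Gamma (1 - (1 / 2 + z)) = of_real pi / sin (of_real pi * (1 / 2 + z))"
    by (rule Gamma_reflection_complex)
  moreover have "sin (of_real pi * (1 / 2 + z)) = cos (of_real pi * z)"
    using sin_add[of "of_real pi / 2" "of_real pi * z"] by (simp add: distrib_left)
  ultimately show ?thesis by (simp add: mult.commute)
qed

text \<open>At z = cosh b - 1 the denominator factors as cosh ((y - b) / 2) cosh ((y + b) / 2) /
  cosh^2 (y / 2). The two factors in the numerator add up to 2 cosh (y / 2) cosh (b / 2), so partial
  fractions give two translates of the weight.\<close>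

lemma stieltjes_weight_0_split:
  "stieltjes_weight 0 y / (1 + (cosh b - 1) * stieltjes_ratio y) =
    (stieltjes_weight 0 (y - b) + stieltjes_weight 0 (y + b)) / (2 * cosh (b / 2))"
proof -
  define u v p q where "u = cosh (y / 2)" and "v = cosh (b / 2)"
    and "p = cosh ((y - b) / 2)" and "q = cosh ((y + b) / 2)"
  have pos: "u > 0" "v > 0" "p > 0" "q > 0" by (simp_all add: u_def v_def p_def q_def)
  have pq: "p = u * v - sinh (y / 2) * sinh (b / 2)" "q = u * v + sinh (y / 2) * sinh (b / 2)"
    unfolding p_def q_def u_def v_def using cosh_diff[of "y / 2" "b / 2"] cosh_add[of "y / 2" "b / 2"]
    by (simp_all add: diff_divide_distrib add_divide_distrib)
  have sum: "p + q = 2 * u * v" by (simp add: pq)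
  have "p * q = u\<^sup>2 * v\<^sup>2 - (sinh (y / 2))\<^sup>2 * (sinh (b / 2))\<^sup>2"
    unfolding pq by (simp add: algebra_simps power2_eq_square)
  also have "\<dots> = u\<^sup>2 + v\<^sup>2 - 1" by (simp add: sinh_square_eq u_def v_def algebra_simps)
  finally have prod: "p * q = u\<^sup>2 + v\<^sup>2 - 1" .
  have "cosh b = 2 * v\<^sup>2 - 1" using cosh_double_cosh[of "b / 2"] by (simp add: v_def)
  moreover have "1 + (2 * v\<^sup>2 - 1 - 1) * (2 / (2 * u)\<^sup>2) = (u\<^sup>2 + v\<^sup>2 - 1) / u\<^sup>2"
    using pos by (simp add: field_simps power2_eq_square)
  ultimately have den: "1 + (cosh b - 1) * stieltjes_ratio y = p * q / u\<^sup>2"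
    unfolding prod stieltjes_ratio_def u_def[symmetric] by (simp only:)
  have "stieltjes_weight 0 y / (1 + (cosh b - 1) * stieltjes_ratio y) = u / (2 * (p * q))"
    unfolding den stieltjes_weight_def u_def[symmetric] using pos by (simp add: field_simps power2_eq_square)
  also have "\<dots> = (2 * u * v) / (p * q) / (4 * v)" using pos by (simp add: field_simps)
  also have "\<dots> = (1 / (2 * p) + 1 / (2 * q)) / (2 * v)" unfolding sum[symmetric] using pos by (simp add: field_simps)
  finally show ?thesis by (simp add: stieltjes_weight_def p_def q_def v_def)
qed

text \<open>Translating the two parts of the split back by b and - b leaves the factors exp (\<mu>
  b) and exp (- \<mu> b) in front of the zeroth moment, which is pi / cos (pi \<mu>).\<close>

lemma stieltjes_0:
  assumes "\<bar>Re \<mu>\<bar> < 1 / 2"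
  shows "stieltjes \<mu> 0 (of_real (cosh b - 1)) =
    of_real pi / cos (of_real pi * \<mu>) * (cosh (\<mu> * of_real b) / of_real (cosh (b / 2)))"
proof -
  have M: "has_bochner_integral lborel (\<lambda>y. exp (\<mu> * of_real y) * of_real (stieltjes_weight 0 y)) (of_real pi / cos (of_real pi * \<mu>))"
    using has_bochner_integral_stieltjes_moment[of \<mu> 0] assms
    by (simp add: stieltjes_moment_def Gamma_reflection_half)
  have shift: "has_bochner_integral lborel (\<lambda>y. exp (\<mu> * of_real y) * of_real (stieltjes_weight 0 (y - c)))
      (exp (\<mu> * of_real c) * (of_real pi / cos (of_real pi * \<mu>)))" for c
  proof (subst lborel_has_bochner_integral_real_affine_iff[where c = 1 and t = c])
    have "has_bochner_integral lborel (\<lambda>y. exp (\<mu> * of_real c) * (exp (\<mu> * of_real y) * of_real (stieltjes_weight 0 y)))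
        (exp (\<mu> * of_real c) * (of_real pi / cos (of_real pi * \<mu>)))"
      by (rule has_bochner_integral_mult_right[OF M])
    then show "has_bochner_integral lborel
        (\<lambda>x. exp (\<mu> * of_real (c + 1 * x)) * of_real (stieltjes_weight 0 (c + 1 * x - c)))
        ((exp (\<mu> * of_real c) * (of_real pi / cos (of_real pi * \<mu>))) /\<^sub>R \<bar>1\<bar>)"
      by (simp add: distrib_left exp_add mult.assoc)
  qed simp
  have pt: "exp (\<mu> * of_real y) * of_real (stieltjes_weight 0 y) / (1 + of_real (cosh b - 1) * of_real (stieltjes_ratio y)) =
      (exp (\<mu> * of_real y) * of_real (stieltjes_weight 0 (y - b)) +
       exp (\<mu> * of_real y) * of_real (stieltjes_weight 0 (y - (- b)))) / of_real (2 * cosh (b / 2))" for y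
    using arg_cong[OF stieltjes_weight_0_split[of y b], of "\<lambda>r. exp (\<mu> * of_real y) * of_real r"]
    by (simp add: distrib_left)
  have "stieltjes \<mu> 0 (of_real (cosh b - 1)) =
      (exp (\<mu> * of_real b) * (of_real pi / cos (of_real pi * \<mu>)) +
       exp (\<mu> * of_real (- b)) * (of_real pi / cos (of_real pi * \<mu>))) / of_real (2 * cosh (b / 2))"
    unfolding stieltjes_def pt
    by (intro has_bochner_integral_integral_eq has_bochner_integral_divide has_bochner_integral_add shift)
  also have "\<dots> = of_real pi / cos (of_real pi * \<mu>) * ((exp (\<mu> * of_real b) + exp (- (\<mu> * of_real b))) / 2 / of_real (cosh (b / 2)))"
    by (simp add: distrib_left distrib_right add_divide_distrib mult_ac)
  finally show ?thesis by (simp add: cosh_field_def)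
qed

lemma cos_pi_nonzero:
  assumes "\<bar>Re \<mu>\<bar> < 1 / 2"
  shows "cos (of_real pi * \<mu>) \<noteq> (0::complex)"
proof
  assume "cos (of_real pi * \<mu>) = 0"
  then have "Gamma (1 / 2 - \<mu>) * Gamma (1 / 2 + \<mu>) = 0" by (simp add: Gamma_reflection_half)
  moreover have "Gamma (1 / 2 - \<mu>) \<noteq> 0" "Gamma (1 / 2 + \<mu>) \<noteq> 0"
    using assms by (auto intro!: Gamma_nonzero_Re_pos)
  ultimately show False by simp
qed

text \<open>For |Re \<mu>| < 1/2 induction with \<open>stieltjes_rec\<close> starts from the closed
  form \<open>stieltjes_0\<close>. That start is confined to the narrow strip, but for fixed N all
  terms are holomorphic on |Re \<mu>| < N + 1/2, and the identity continues there.\<close>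

lemma cosh_ratio_expansion:
  fixes \<mu> :: complex and b :: real
  assumes "\<bar>Re \<mu>\<bar> < real N + 1 / 2"
  defines "z \<equiv> complex_of_real (cosh b - 1)"
  shows "cosh (\<mu> * of_real b) / of_real (cosh (b / 2)) =
    (\<Sum>n<N. a_coeff n \<mu> / pochhammer (1 / 2) n * z ^ n)
      + (- z) ^ N * (cos (of_real pi * \<mu>) / of_real pi) * stieltjes \<mu> N z"
proof -
  have z: "Re z \<ge> 0" using cosh_real_ge_1[of b] by (simp add: z_def)
  have small: "cosh (u * of_real b) / of_real (cosh (b / 2)) =
    (\<Sum>n<M. a_coeff n u / pochhammer (1 / 2) n * z ^ n)
      + (- z) ^ M * (cos (of_real pi * u) / of_real pi) * stieltjes u M z" if u: "\<bar>Re u\<bar> < 1 / 2" for u M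
  proof (induction M)
    case 0
    show ?case using cos_pi_nonzero[OF u] unfolding z_def stieltjes_0[OF u] by simp
  next
    case (Suc M)
    have "pochhammer (1 / 2) M * stieltjes_moment M u = (-1) ^ M * a_coeff M u * (of_real pi / cos (of_real pi * u))"
      unfolding Gamma_reflection_half[symmetric]
      using u by (intro stieltjes_moment_a_coeff not_nonpos_Ints_Re_pos) auto
    then have mom: "cos (of_real pi * u) / of_real pi * stieltjes_moment M u = (-1) ^ M * (a_coeff M u / pochhammer (1 / 2) M)"
      using cos_pi_nonzero[OF u] pochhammer_half_nonzero[of M, where ?'a = complex] by (simp add: field_simps)
    have "(- z) ^ M * (cos (of_real pi * u) / of_real pi) * stieltjes u M z =
        (- z) ^ M * (cos (of_real pi * u) / of_real pi * stieltjes_moment M u)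
        + (- z) ^ Suc M * (cos (of_real pi * u) / of_real pi) * stieltjes u (Suc M) z"
      by (subst stieltjes_rec[OF z, of u M]) (use u in simp, simp add: algebra_simps diff_divide_distrib)
    also have "(- z) ^ M * (cos (of_real pi * u) / of_real pi * stieltjes_moment M u) = a_coeff M u / pochhammer (1 / 2) M * z ^ M"
    proof -
      have "(- z) ^ M * (-1) ^ M = z ^ M" by (simp flip: power_mult_distrib)
      then show ?thesis unfolding mom by (simp add: mult_ac)
    qed
    finally show ?case using Suc by simp
  qed
  show ?thesis
  proof (rule analytic_continuation_open[where z = \<mu> and s = "{\<mu>. \<bar>Re \<mu>\<bar> < 1 / 2}" and s' = "{\<mu>. \<bar>Re \<mu>\<bar> < real N + 1 / 2}"])
    show "{\<mu>. \<bar>Re \<mu>\<bar> < 1 / 2} \<noteq> {}" by (auto intro!: exI[of _ 0])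
    show "{\<mu>. \<bar>Re \<mu>\<bar> < 1 / 2} \<subseteq> {\<mu>. \<bar>Re \<mu>\<bar> < real N + 1 / 2}" by auto
    show "(\<lambda>\<mu>. cosh (\<mu> * of_real b) / of_real (cosh (b / 2))) holomorphic_on {\<mu>. \<bar>Re \<mu>\<bar> < real N + 1 / 2}"
      unfolding cosh_field_def by (intro holomorphic_intros) (auto simp: cosh_field_def[symmetric])
    show "(\<lambda>\<mu>. (\<Sum>n<N. a_coeff n \<mu> / pochhammer (1 / 2) n * z ^ n)
      + (- z) ^ N * (cos (of_real pi * \<mu>) / of_real pi) * stieltjes \<mu> N z) holomorphic_on {\<mu>. \<bar>Re \<mu>\<bar> < real N + 1 / 2}"
      unfolding a_coeff_def
      by (intro holomorphic_intros holomorphic_stieltjes_order z) (auto simp: pochhammer_half_nonzero)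
    show "\<mu> \<in> {\<mu>. \<bar>Re \<mu>\<bar> < real N + 1 / 2}" using assms by simp
    show "cosh (u * of_real b) / of_real (cosh (b / 2)) = (\<Sum>n<N. a_coeff n u / pochhammer (1 / 2) n * z ^ n)
      + (- z) ^ N * (cos (of_real pi * u) / of_real pi) * stieltjes u N z" if "u \<in> {\<mu>. \<bar>Re \<mu>\<bar> < 1 / 2}" for u
      by (rule small) (use that in simp)
  qed (rule open_strip connected_strip)+
qed

section \<open>From the hyperbolic integral to Beta kernels\<close>

lemma laplace_int_cosh:
  assumes w: "Re w > 0" and \<mu>: "\<bar>Re \<mu>\<bar> < Re n"
  shows "has_bochner_integral lborel (\<lambda>b. cosh (\<mu> * of_real b) * (of_real (cosh b - 1) + w) powr (- n)) (laplace_int \<mu> n w)"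
proof -
  have "has_bochner_integral lborel (\<lambda>b. (laplace_kernel \<mu> n w b + laplace_kernel (- \<mu>) n w b) / 2)
      ((laplace_int \<mu> n w + laplace_int (- \<mu>) n w) / 2)"
    unfolding laplace_int_def using \<mu>
    by (intro has_bochner_integral_divide has_bochner_integral_add has_bochner_integral_integrable integrable_laplace_kernel w) auto
  moreover have "(laplace_kernel \<mu> n w b + laplace_kernel (- \<mu>) n w b) / 2 = cosh (\<mu> * of_real b) * (of_real (cosh b - 1) + w) powr (- n)" for b
    by (simp add: laplace_kernel_def cosh_field_def distrib_right)
  ultimately show ?thesis by (simp add: laplace_int_minus)
qed

text \<open>The third identity is the reason for dividing by cosh (b / 2): the Jacobian of cosh b -
  1 = w exp x is w exp x / sinh b, and its product with cosh (b / 2) is a pure exponential in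
  x.\<close>

lemma arcosh_exp_properties:
  fixes w x :: real
  assumes w: "w > 0"
  defines "b \<equiv> arcosh (1 + w * exp x)"
  shows "cosh b - 1 = w * exp x" "b > 0"
    "cosh (b / 2) * (w * exp x / sqrt ((1 + w * exp x)\<^sup>2 - 1)) = sqrt (w / 2) * exp (x / 2)"
proof -
  have gt: "1 + w * exp x > 1" using w by simp
  then show cb: "cosh b - 1 = w * exp x" unfolding b_def by (subst cosh_arcosh_real) auto
  show bpos: "b > 0" unfolding b_def using gt w by (subst arcosh_real_gt_1_iff) auto
  define s c where "s = sinh (b / 2)" and "c = cosh (b / 2)"
  have pos: "s > 0" "c > 0" using bpos by (simp_all add: s_def c_def)
  have z: "w * exp x = 2 * s\<^sup>2"
    using cosh_double_cosh[of "b / 2"] cb by (simp add: s_def sinh_square_eq)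
  have "1 + w * exp x = cosh b" using cb by simp
  then have "(1 + w * exp x)\<^sup>2 - 1 = (sinh b)\<^sup>2" by (simp only: sinh_square_eq)
  then have "sqrt ((1 + w * exp x)\<^sup>2 - 1) = sinh b" using bpos by simp
  also have "\<dots> = 2 * s * c" using sinh_double[of "b / 2"] by (simp add: s_def c_def)
  finally have "c * (w * exp x / sqrt ((1 + w * exp x)\<^sup>2 - 1)) = s"
    unfolding z using pos by (simp add: power2_eq_square)
  also have "s = sqrt (s\<^sup>2)" using pos by simp
  also have "s\<^sup>2 = w / 2 * (exp (x / 2))\<^sup>2" using z by (simp add: power2_eq_square flip: exp_add)
  also have "sqrt \<dots> = sqrt (w / 2) * exp (x / 2)" by (simp only: real_sqrt_mult real_sqrt_abs abs_exp_cancel)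
  finally show "cosh (b / 2) * (w * exp x / sqrt ((1 + w * exp x)\<^sup>2 - 1)) = sqrt (w / 2) * exp (x / 2)"
    by (simp add: c_def)
qed

text \<open>The integrand of \<open>laplace_int_cosh\<close> is even in b, so the integral is twice
  the one over b > 0, which the substitution maps to the whole line. The denominator cosh (b / 2)
  comes from the Jacobian.\<close>

lemma has_bochner_integral_laplace_exp:
  fixes w :: real
  assumes w: "w > 0" and \<mu>: "\<bar>Re \<mu>\<bar> < Re n"
  defines "g \<equiv> (\<lambda>x. arcosh (1 + w * exp x))"
  shows "has_bochner_integral lborel
    (\<lambda>x. cosh (\<mu> * of_real (g x)) / of_real (cosh (g x / 2)) * (exp (of_real x / 2) * of_real (1 + exp x) powr (- n)))
    (laplace_int \<mu> n (of_real w) * (of_real w powr (n - 1 / 2) / of_real (sqrt 2)))"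
proof -
  define F where "F = (\<lambda>b. cosh (\<mu> * of_real b) * (of_real (cosh b - 1) + of_real w) powr (- n))"
  define h where "h = (\<lambda>x. w * exp x / sqrt ((1 + w * exp x)\<^sup>2 - 1))"
  define L where "L = laplace_int \<mu> n (of_real w)"
  define \<phi> where "\<phi> = (\<lambda>x. cosh (\<mu> * of_real (g x)) / of_real (cosh (g x / 2)) * (exp (of_real x / 2) * of_real (1 + exp x) powr (- n)))"
  \<comment> \<open>Collects the constants of the substitution: sqrt (w / 2) from the Jacobian and
    w^(-n) from the base w (1 + exp x). Half of the full integral divided by K carries w^(n - 1/2) /
    sqrt 2.\<close>
  define K where "K = of_real (sqrt (w / 2)) * complex_of_real w powr (- n)"
  have F: "has_bochner_integral lborel F L"
    unfolding F_def L_def by (rule laplace_int_cosh) (use w \<mu> in auto)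
  have Fint: "integrable lborel (\<lambda>b. indicator {0..} b *\<^sub>R F b)"
    using F by (intro integrable_mult_indicator) (auto simp: has_bochner_integral_iff)
  define I where "I = (\<integral>b. indicator {0..} b *\<^sub>R F b \<partial>lborel)"
  have "has_bochner_integral lborel F (2 *\<^sub>R I)"
    by (rule has_bochner_integral_even_function) (use Fint in \<open>auto simp: has_bochner_integral_iff I_def F_def\<close>)
  then have LI: "L = 2 * I" using F by (simp add: has_bochner_integral_iff scaleR_conv_of_real)
  have range: "range g = {0<..}"
  proof (intro equalityI subsetI)
    fix b assume "b \<in> range g"
    then show "b \<in> {0<..}" using arcosh_exp_properties(2)[OF w] by (auto simp: g_def)
  next
    fix b :: real assume "b \<in> {0<..}"
    then have b: "b > 0" by simp
    then have "cosh b > 1" using cosh_real_strict_mono[of 0 b] by simp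
    then have "1 + w * exp (ln ((cosh b - 1) / w)) = cosh b" using w by simp
    then have "g (ln ((cosh b - 1) / w)) = b" using b by (simp add: g_def arcosh_cosh_real)
    then show "b \<in> range g" by (metis rangeI)
  qed
  have inj: "inj g"
  proof (rule injI)
    fix x y assume "g x = g y"
    then have "cosh (g x) - 1 = cosh (g y) - 1" by simp
    then have "w * exp x = w * exp y"
      unfolding g_def arcosh_exp_properties(1)[OF w] .
    then show "x = y" using w by simp
  qed
  have der: "(g has_field_derivative h x) (at x)" for x
  proof -
    have gt: "1 + w * exp x > 1" using w by simp
    have "((\<lambda>x. 1 + w * exp x) has_field_derivative w * exp x) (at x)"
      by (rule derivative_eq_intros refl | simp)+
    from DERIV_chain2[where f = arcosh and g = "\<lambda>x. 1 + w * exp x", OF arcosh_real_has_field_derivative[OF gt] this]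
    show ?thesis unfolding g_def h_def by simp
  qed
  have Fint': "integrable lborel (\<lambda>b. indicator {0<..} b *\<^sub>R F b)"
    using F by (intro integrable_mult_indicator) (auto simp: has_bochner_integral_iff)
  \<comment> \<open>The substitution reaches b > 0 only; removing the single point 0 leaves the
    integral unchanged.\<close>
  have I': "I = (\<integral>b. indicator {0<..} b *\<^sub>R F b \<partial>lborel)"
    unfolding I_def by (rule integral_discrete_difference[of "{0}"]) (auto simp: indicator_def)
  have "F absolutely_integrable_on range g \<and> integral (range g) F = I"
    unfolding range
  proof
    have *: "set_integrable lborel {0<..} F" using Fint' by (simp add: set_integrable_def)
    show "F absolutely_integrable_on {0<..}"
      unfolding set_integrable_def using integrable_completion[of "\<lambda>b. indicator {0<..} b *\<^sub>R F b" lborel]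
        borel_measurable_integrable[OF Fint'] Fint' by blast
    show "integral {0<..} F = I"
      using set_borel_integral_eq_integral(2)[OF *] by (simp add: I' set_lebesgue_integral_def)
  qed
  then have "(\<lambda>x. \<bar>h x\<bar> *\<^sub>R F (g x)) absolutely_integrable_on UNIV \<and> integral UNIV (\<lambda>x. \<bar>h x\<bar> *\<^sub>R F (g x)) = I"
    by (subst has_absolute_integral_change_of_variables_real[OF _ _ inj, of h]) (use der in auto)
  moreover have "\<bar>h x\<bar> *\<^sub>R F (g x) = K * \<phi> x" for x
  proof -
    have hpos: "h x \<ge> 0" using w by (auto simp: h_def intro!: divide_nonneg_nonneg)
    have b: "cosh (g x) - 1 = w * exp x" using arcosh_exp_properties(1)[OF w, of x] by (simp add: g_def)
    have "of_real (w * exp x) + complex_of_real w = of_real w * of_real (1 + exp x)" by (simp add: distrib_left)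
    moreover have "(of_real w * complex_of_real (1 + exp x)) powr (- n) = of_real w powr (- n) * of_real (1 + exp x) powr (- n)"
    proof (rule powr_times_pos_real[OF w])
      have "1 + exp x > 0" by (simp add: add_pos_pos)
      then show "complex_of_real (1 + exp x) \<noteq> 0" by (metis less_irrefl of_real_eq_0_iff)
    qed
    ultimately have F1: "F (g x) = cosh (\<mu> * of_real (g x)) * (of_real w powr (- n) * of_real (1 + exp x) powr (- n))"
      unfolding F_def b by simp
    have "h x * cosh (g x / 2) = sqrt (w / 2) * exp (x / 2)"
      using arcosh_exp_properties(3)[OF w, of x] by (simp add: g_def h_def mult.commute)
    then have "h x = sqrt (w / 2) * exp (x / 2) / cosh (g x / 2)" by (simp add: field_simps)
    then have "complex_of_real (h x) = of_real (sqrt (w / 2)) * exp (of_real x / 2) / of_real (cosh (g x / 2))"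
      using exp_of_real[of "x / 2", where ?'a = complex] by simp
    then show ?thesis
      using hpos unfolding F1 K_def \<phi>_def by (simp add: scaleR_conv_of_real)
  qed
  ultimately have "(\<lambda>x. K * \<phi> x) absolutely_integrable_on UNIV" "integral UNIV (\<lambda>x. K * \<phi> x) = I" by simp_all
  moreover have "(\<lambda>x. K * \<phi> x) \<in> borel_measurable borel"
  proof -
    have "g \<in> borel_measurable borel"
      using der by (intro borel_measurable_continuous_onI) (auto intro!: DERIV_isCont simp: continuous_on_eq_continuous_at)
    then show ?thesis unfolding \<phi>_def cosh_def by measurable
  qed
  ultimately have "integrable lborel (\<lambda>x. K * \<phi> x)"
    unfolding set_integrable_def by (subst (asm) integrable_completion) auto
  then have "has_bochner_integral lborel (\<lambda>x. K * \<phi> x) I"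
    unfolding has_bochner_integral_iff
    using integral_lborel[of "\<lambda>x. K * \<phi> x"] \<open>integral UNIV (\<lambda>x. K * \<phi> x) = I\<close> by (simp only:)
  moreover have K0: "K \<noteq> 0" using w by (simp add: K_def)
  ultimately have "has_bochner_integral lborel (\<lambda>x. K * \<phi> x / K) (I / K)"
    by (intro has_bochner_integral_divide)
  moreover have "I / K = L * (of_real w powr (n - 1 / 2) / of_real (sqrt 2))"
  proof -
    have "complex_of_real w powr (- n) * of_real w powr (n - 1 / 2) * of_real (sqrt w) = 1"
    proof -
      have "complex_of_real (sqrt w) = of_real w powr (1 / 2)"
        using powr_of_real[of w "1 / 2"] powr_half_sqrt[of w] w by simp
      then show ?thesis using w by (simp flip: powr_add)
    qed
    moreover have "complex_of_real (sqrt 2) * of_real (sqrt 2) = 2" by (simp flip: of_real_mult)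
    ultimately have "K * (of_real w powr (n - 1 / 2) / of_real (sqrt 2)) = 1 / 2"
      unfolding K_def real_sqrt_divide by (simp add: field_simps)
    then show ?thesis unfolding LI using K0 by (simp add: field_simps)
  qed
  ultimately show ?thesis using K0 unfolding \<phi>_def L_def by simp
qed

section \<open>The expansion and its remainder\<close>

text \<open>The kernel that goes with z^j = w^j exp (j x). Its integral is B(j + 1/2, \<nu> - j +
  1/2), convergent for Re \<nu> > j - 1/2; at j = N this is the hypothesis on \<nu>.\<close>

definition beta_kernel :: "complex \<Rightarrow> nat \<Rightarrow> real \<Rightarrow> complex" where
  "beta_kernel \<nu> j x = exp ((of_nat j + 1 / 2) * of_real x) * of_real (1 + exp x) powr (- (\<nu> + 1))"

definition beta_kernel_real :: "real \<Rightarrow> nat \<Rightarrow> real \<Rightarrow> real" where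
  "beta_kernel_real a j x = exp ((real j + 1 / 2) * x) * (1 + exp x) powr (- (a + 1))"

lemma beta_kernel_measurable [measurable]:
  "beta_kernel \<nu> j \<in> borel_measurable borel" "beta_kernel_real a j \<in> borel_measurable borel"
  unfolding beta_kernel_def[abs_def] beta_kernel_real_def[abs_def] by measurable

lemma norm_beta_kernel: "norm (beta_kernel \<nu> j x) = beta_kernel_real (Re \<nu>) j x"
proof -
  have "1 + exp x \<ge> 0" by (simp add: add_nonneg_nonneg)
  then have "norm (complex_of_real (1 + exp x) powr (- (\<nu> + 1))) = (1 + exp x) powr (- (Re \<nu> + 1))"
    by (subst norm_powr_real_powr) auto
  then show ?thesis
    by (simp only: beta_kernel_def beta_kernel_real_def norm_mult norm_exp_eq_Re) simp
qed

lemma beta_kernel_of_real: "beta_kernel (of_real a) j x = of_real (beta_kernel_real a j x)"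
proof -
  have "1 + exp x \<ge> 0" by (simp add: add_nonneg_nonneg)
  moreover have "- (complex_of_real a + 1) = of_real (- (a + 1))" by simp
  ultimately have "complex_of_real (1 + exp x) powr (- (complex_of_real a + 1)) = of_real ((1 + exp x) powr (- (a + 1)))"
    by (simp only: powr_of_real)
  moreover have "exp ((of_nat j + 1 / 2) * complex_of_real x) = of_real (exp ((real j + 1 / 2) * x))"
    using exp_of_real[of "(real j + 1 / 2) * x", where ?'a = complex] by simp
  ultimately show ?thesis by (simp only: beta_kernel_def beta_kernel_real_def of_real_mult)
qed

lemma has_bochner_integral_beta_kernel:
  assumes "Re \<nu> > real j - 1 / 2"
  shows "has_bochner_integral lborel (beta_kernel \<nu> j)
    (Gamma (of_nat j + 1 / 2) * Gamma (\<nu> - of_nat j + 1 / 2) / Gamma (\<nu> + 1))"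
proof -
  have "Re (\<nu> - of_nat j + 1 / 2) > 0" "Re (of_nat j + 1 / 2 :: complex) > 0"
    using assms by (simp_all add: add_nonneg_pos)
  from has_bochner_integral_Beta_exp[OF this]
  show ?thesis by (simp add: beta_kernel_def[abs_def] mult.commute)
qed

lemma has_bochner_integral_beta_kernel_real:
  assumes "a > real j - 1 / 2"
  shows "has_bochner_integral lborel (beta_kernel_real a j)
    (Gamma (real j + 1 / 2) * Gamma (a - real j + 1 / 2) / Gamma (a + 1))"
proof -
  have "of_nat j + 1 / 2 = complex_of_real (real j + 1 / 2)"
    "complex_of_real a - of_nat j + 1 / 2 = of_real (a - real j + 1 / 2)"
    "complex_of_real a + 1 = of_real (a + 1)" by simp_all
  then have "has_bochner_integral lborel (beta_kernel (of_real a) j)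
      (complex_of_real (Gamma (real j + 1 / 2) * Gamma (a - real j + 1 / 2) / Gamma (a + 1)))"
    using has_bochner_integral_beta_kernel[of j "of_real a"] assms
    by (simp only: Gamma_complex_of_real of_real_mult of_real_divide Re_complex_of_real)
  from has_bochner_integral_bounded_linear[OF bounded_linear_Re this]
  show ?thesis by (simp only: beta_kernel_of_real Re_complex_of_real)
qed

text \<open>Gamma (\<nu> + 1) stands in front of the remainder, whereas the integral of the moduli
  of the Beta kernel has Gamma (Re \<nu> + 1) in its denominator; this inequality lets them
  cancel.\<close>

lemma norm_Gamma_le:
  assumes "Re z > 0"
  shows "norm (Gamma z) \<le> Gamma (Re z)"
proof -
  have n: "norm (exp (z * of_real x - of_real (exp x))) = Re (exp (of_real (Re z) * of_real x - of_real (exp x)))" for x :: real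
    by (simp add: norm_exp_eq_Re Re_exp)
  have "norm (Gamma z) \<le> (\<integral>x. norm (exp (z * of_real x - of_real (exp x))) \<partial>lborel)"
    using has_bochner_integral_Gamma_exp[OF assms] integral_norm_bound[of lborel "\<lambda>x. exp (z * of_real x - of_real (exp x))"]
    by (simp add: has_bochner_integral_iff)
  also have "\<dots> = Gamma (Re z)"
    unfolding n
    using has_bochner_integral_bounded_linear[OF bounded_linear_Re has_bochner_integral_Gamma_exp[of "of_real (Re z)"]] assms
    by (intro has_bochner_integral_integral_eq) (simp add: Gamma_complex_of_real)
  finally show ?thesis .
qed

definition ferrers_stieltjes :: "complex \<Rightarrow> complex \<Rightarrow> nat \<Rightarrow> complex \<Rightarrow> complex" where
  "ferrers_stieltjes \<nu> \<mu> N w = (\<integral>x. beta_kernel \<nu> N x * stieltjes \<mu> N (w * of_real (exp x)) \<partial>lborel)"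

definition ferrers_remainder :: "complex \<Rightarrow> complex \<Rightarrow> nat \<Rightarrow> complex \<Rightarrow> complex" where
  "ferrers_remainder \<nu> \<mu> N w =
     (- w) ^ N * (cos (of_real pi * \<mu>) / of_real pi * (Gamma (\<nu> + 1) / of_real (sqrt pi))) * ferrers_stieltjes \<nu> \<mu> N w"

lemma Re_times_exp_pos: "Re w > 0 \<Longrightarrow> Re (w * of_real (exp x)) > 0"
  by simp

lemma stieltjes_exp_measurable:
  assumes "Re w > 0" "\<bar>Re \<mu>\<bar> < real N + 1 / 2"
  shows "(\<lambda>x. stieltjes \<mu> N (w * of_real (exp x))) \<in> borel_measurable borel"
proof (rule borel_measurable_continuous_onI)
  show "continuous_on UNIV (\<lambda>x. stieltjes \<mu> N (w * of_real (exp x)))"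
    by (rule continuous_on_compose2[OF holomorphic_on_imp_continuous_on[OF holomorphic_stieltjes[OF assms(2)]]])
       (use assms in \<open>auto intro!: continuous_intros\<close>)
qed

lemma norm_beta_stieltjes_le:
  assumes "Re w > 0" "\<bar>Re \<mu>\<bar> < real N + 1 / 2"
  shows "norm (beta_kernel \<nu> N x * stieltjes \<mu> N (w * of_real (exp x))) \<le>
    beta_kernel_real (Re \<nu>) N x * stieltjes_moment N (Re \<mu>)"
  unfolding norm_mult norm_beta_kernel
  using norm_stieltjes_le[OF less_imp_le[OF Re_times_exp_pos[OF assms(1)]] assms(2)]
  by (intro mult_left_mono) (auto simp: beta_kernel_real_def)

lemma integrable_beta_majorant:
  assumes "Re \<nu> > real N - 1 / 2"
  shows "integrable lborel (\<lambda>x. beta_kernel_real (Re \<nu>) N x * c)"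
  using has_bochner_integral_beta_kernel_real[OF assms] by (auto simp: has_bochner_integral_iff)

lemma integrable_beta_stieltjes:
  assumes "Re w > 0" "\<bar>Re \<mu>\<bar> < real N + 1 / 2" "Re \<nu> > real N - 1 / 2"
  shows "integrable lborel (\<lambda>x. beta_kernel \<nu> N x * stieltjes \<mu> N (w * of_real (exp x)))"
proof (rule Bochner_Integration.integrable_bound[OF integrable_beta_majorant[OF assms(3)]])
  note [measurable] = stieltjes_exp_measurable[OF assms(1,2)]
  show "(\<lambda>x. beta_kernel \<nu> N x * stieltjes \<mu> N (w * of_real (exp x))) \<in> borel_measurable lborel" by measurable
  show "AE x in lborel. norm (beta_kernel \<nu> N x * stieltjes \<mu> N (w * of_real (exp x))) \<le>
      norm (beta_kernel_real (Re \<nu>) N x * stieltjes_moment N (Re \<mu>))"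
    using order_trans[OF norm_beta_stieltjes_le[OF assms(1,2)] abs_ge_self] by (intro AE_I2) simp
qed

lemma holomorphic_ferrers_stieltjes:
  assumes "\<bar>Re \<mu>\<bar> < real N + 1 / 2" "Re \<nu> > real N - 1 / 2"
  shows "ferrers_stieltjes \<nu> \<mu> N holomorphic_on {w. Re w > 0}"
  unfolding ferrers_stieltjes_def[abs_def]
proof (rule holomorphic_on_lebesgue_integral)
  show "open {w. Re w > 0}" by (rule open_halfspace_Re_gt)
  show "(\<lambda>x. beta_kernel \<nu> N x * stieltjes \<mu> N (w * of_real (exp x))) \<in> borel_measurable lborel" if "w \<in> {w. Re w > 0}" for w
    using that by (intro borel_measurable_integrable integrable_beta_stieltjes assms) auto
  have "(\<lambda>w. stieltjes \<mu> N (w * of_real (exp x))) holomorphic_on {w. Re w > 0}" for x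
    by (rule holomorphic_on_compose_gen[unfolded o_def, where f = "\<lambda>w. w * of_real (exp x)",
          OF _ holomorphic_stieltjes[OF assms(1)]]) (auto intro!: holomorphic_intros)
  then show "(\<lambda>w. beta_kernel \<nu> N x * stieltjes \<mu> N (w * of_real (exp x))) holomorphic_on {w. Re w > 0}" for x
    by (intro holomorphic_intros)
  fix w assume "w \<in> {w. Re w > 0}"
  then obtain r where r: "r > 0" "cball w r \<subseteq> {w. Re w > 0}"
    using open_halfspace_Re_gt[of 0] open_contains_cball_eq by blast
  show "\<exists>r>0. \<exists>g. cball w r \<subseteq> {w. Re w > 0} \<and> integrable lborel g \<and>
      (\<forall>u\<in>cball w r. \<forall>x\<in>space lborel. norm (beta_kernel \<nu> N x * stieltjes \<mu> N (u * of_real (exp x))) \<le> g x)"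
  proof (intro exI conjI ballI)
    show "integrable lborel (\<lambda>x. beta_kernel_real (Re \<nu>) N x * stieltjes_moment N (Re \<mu>))"
      by (rule integrable_beta_majorant[OF assms(2)])
    show "norm (beta_kernel \<nu> N x * stieltjes \<mu> N (u * of_real (exp x))) \<le>
        beta_kernel_real (Re \<nu>) N x * stieltjes_moment N (Re \<mu>)" if "u \<in> cball w r" for u x
      using that r by (intro norm_beta_stieltjes_le assms) auto
  qed (use r in auto)
qed

text \<open>Scaled so that the n-th term of its expansion is exactly a_n Gamma (\<nu> - n + 1/2)
  w^n.\<close>

definition ferrers_laplace :: "complex \<Rightarrow> complex \<Rightarrow> complex \<Rightarrow> complex" where
  "ferrers_laplace \<nu> \<mu> w = Gamma (\<nu> + 1) / of_real (sqrt pi) *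
     (laplace_int \<mu> (\<nu> + 1) w * (w powr (\<nu> + 1 / 2) / of_real (sqrt 2)))"

lemma Gamma_half_pochhammer: "Gamma (of_nat j + 1 / 2 :: complex) = pochhammer (1 / 2) j * of_real (sqrt pi)"
proof -
  have "(1 / 2 :: complex) \<notin> \<int>\<^sub>\<le>\<^sub>0" by (rule not_nonpos_Ints_Re_pos) simp
  then have "pochhammer (1 / 2 :: complex) j = Gamma (1 / 2 + of_nat j) / Gamma (1 / 2)"
    by (rule pochhammer_Gamma)
  then show ?thesis by (simp add: Gamma_one_half_complex add.commute)
qed

text \<open>Termwise integration of \<open>cosh_ratio_expansion\<close> against the kernel. The j-th
  integral contains Gamma (j + 1/2) = (1/2)_j sqrt pi, which cancels the Pochhammer symbol and the
  root in the normalisation.\<close>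

lemma ferrers_laplace_expansion_real:
  fixes w :: real
  assumes w: "w > 0" and \<mu>: "\<bar>Re \<mu>\<bar> < real N + 1 / 2" and \<nu>: "Re \<nu> > real N - 1 / 2"
  shows "ferrers_laplace \<nu> \<mu> (of_real w) =
    (\<Sum>j<N. a_coeff j \<mu> * Gamma (\<nu> - of_nat j + 1 / 2) * of_real w ^ j) + ferrers_remainder \<nu> \<mu> N (of_real w)"
proof -
  define g where "g = (\<lambda>x. arcosh (1 + w * exp x))"
  define C where "C = cos (of_real pi * \<mu>) / complex_of_real pi"
  have \<mu>\<nu>: "\<bar>Re \<mu>\<bar> < Re (\<nu> + 1)" using \<mu> \<nu> by simp
  have G0: "Gamma (\<nu> + 1) \<noteq> 0" using \<mu>\<nu> by (intro Gamma_nonzero_Re_pos) auto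
  have A: "has_bochner_integral lborel
    (\<lambda>x. cosh (\<mu> * of_real (g x)) / of_real (cosh (g x / 2)) * (exp (of_real x / 2) * of_real (1 + exp x) powr (- (\<nu> + 1))))
    (laplace_int \<mu> (\<nu> + 1) (of_real w) * (of_real w powr (\<nu> + 1 - 1 / 2) / of_real (sqrt 2)))"
    unfolding g_def by (rule has_bochner_integral_laplace_exp[OF w \<mu>\<nu>])
  have B: "has_bochner_integral lborel
    (\<lambda>x. (\<Sum>j<N. a_coeff j \<mu> / pochhammer (1 / 2) j * of_real w ^ j * beta_kernel \<nu> j x) +
       (- of_real w) ^ N * C * (beta_kernel \<nu> N x * stieltjes \<mu> N (of_real w * of_real (exp x))))
    ((\<Sum>j<N. a_coeff j \<mu> / pochhammer (1 / 2) j * of_real w ^ j * (Gamma (of_nat j + 1 / 2) * Gamma (\<nu> - of_nat j + 1 / 2) / Gamma (\<nu> + 1))) +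
       (- of_real w) ^ N * C * ferrers_stieltjes \<nu> \<mu> N (of_real w))"
    unfolding ferrers_stieltjes_def
    using w \<mu> \<nu>
    by (intro has_bochner_integral_add has_bochner_integral_sum has_bochner_integral_mult_right
          has_bochner_integral_beta_kernel has_bochner_integral_integrable integrable_beta_stieltjes) auto
  have pt: "cosh (\<mu> * of_real (g x)) / of_real (cosh (g x / 2)) * (exp (of_real x / 2) * of_real (1 + exp x) powr (- (\<nu> + 1))) =
      (\<Sum>j<N. a_coeff j \<mu> / pochhammer (1 / 2) j * of_real w ^ j * beta_kernel \<nu> j x) +
       (- of_real w) ^ N * C * (beta_kernel \<nu> N x * stieltjes \<mu> N (of_real w * of_real (exp x)))" for x
  proof -
    have z: "complex_of_real (cosh (g x) - 1) = of_real w * of_real (exp x)"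
      using arcosh_exp_properties(1)[OF w, of x] by (simp add: g_def flip: of_real_mult)
    have k: "of_real (exp x) ^ j * (exp (of_real x / 2) * of_real (1 + exp x) powr (- (\<nu> + 1))) = beta_kernel \<nu> j x" for j
    proof -
      have "complex_of_real (exp x) ^ j = exp (of_nat j * of_real x)"
        by (simp add: exp_of_nat_mult exp_of_real)
      then show ?thesis by (simp add: beta_kernel_def distrib_right exp_add)
    qed
    have pm: "(- (complex_of_real w * of_real (exp x))) ^ N = (- of_real w) ^ N * of_real (exp x) ^ N"
      by (simp flip: power_mult_distrib)
    show ?thesis
      unfolding cosh_ratio_expansion[OF \<mu>] z k[symmetric] C_def[symmetric] pm distrib_right sum_distrib_right
      by (intro arg_cong2[of _ _ _ _ "(+)"] sum.cong refl) (simp_all add: power_mult_distrib mult_ac)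
  qed
  have "laplace_int \<mu> (\<nu> + 1) (of_real w) * (of_real w powr (\<nu> + 1 - 1 / 2) / of_real (sqrt 2)) =
    (\<Sum>j<N. a_coeff j \<mu> / pochhammer (1 / 2) j * of_real w ^ j * (Gamma (of_nat j + 1 / 2) * Gamma (\<nu> - of_nat j + 1 / 2) / Gamma (\<nu> + 1))) +
       (- of_real w) ^ N * C * ferrers_stieltjes \<nu> \<mu> N (of_real w)"
    using has_bochner_integral_eq[OF A B[folded pt]] .
  moreover have "\<nu> + 1 - 1 / 2 = \<nu> + 1 / 2" by simp
  ultimately have "ferrers_laplace \<nu> \<mu> (of_real w) = Gamma (\<nu> + 1) / of_real (sqrt pi) *
    ((\<Sum>j<N. a_coeff j \<mu> / pochhammer (1 / 2) j * of_real w ^ j * (Gamma (of_nat j + 1 / 2) * Gamma (\<nu> - of_nat j + 1 / 2) / Gamma (\<nu> + 1))) +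
       (- of_real w) ^ N * C * ferrers_stieltjes \<nu> \<mu> N (of_real w))"
    unfolding ferrers_laplace_def by (simp only:)
  also have "\<dots> = (\<Sum>j<N. a_coeff j \<mu> * Gamma (\<nu> - of_nat j + 1 / 2) * of_real w ^ j) + ferrers_remainder \<nu> \<mu> N (of_real w)"
  proof -
    have "Gamma (\<nu> + 1) / of_real (sqrt pi) * (a_coeff j \<mu> / pochhammer (1 / 2) j * of_real w ^ j *
        (Gamma (of_nat j + 1 / 2) * Gamma (\<nu> - of_nat j + 1 / 2) / Gamma (\<nu> + 1))) =
        a_coeff j \<mu> * Gamma (\<nu> - of_nat j + 1 / 2) * of_real w ^ j" for j
      unfolding Gamma_half_pochhammer using G0 pochhammer_half_nonzero[of j, where ?'a = complex] by (simp add: field_simps)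
    then show ?thesis
      unfolding distrib_left sum_distrib_left ferrers_remainder_def C_def by (simp add: mult_ac)
  qed
  finally show ?thesis .
qed

lemma ferrers_laplace_expansion:
  assumes w: "Re w > 0" and \<mu>: "\<bar>Re \<mu>\<bar> < real N + 1 / 2" and \<nu>: "Re \<nu> > real N - 1 / 2"
  shows "ferrers_laplace \<nu> \<mu> w =
    (\<Sum>j<N. a_coeff j \<mu> * Gamma (\<nu> - of_nat j + 1 / 2) * w ^ j) + ferrers_remainder \<nu> \<mu> N w"
proof (rule analytic_continuation_pos_real[where S = "{w. Re w > 0}" and f = "ferrers_laplace \<nu> \<mu>" and
      g = "\<lambda>w. (\<Sum>j<N. a_coeff j \<mu> * Gamma (\<nu> - of_nat j + 1 / 2) * w ^ j) + ferrers_remainder \<nu> \<mu> N w"])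
  have "\<bar>Re \<mu>\<bar> < Re (\<nu> + 1)" using \<mu> \<nu> by simp
  from has_field_derivative_laplace_int[OF _ this]
  have "laplace_int \<mu> (\<nu> + 1) holomorphic_on {w. Re w > 0}"
    unfolding holomorphic_on_open[OF open_halfspace_Re_gt] by blast
  then show "ferrers_laplace \<nu> \<mu> holomorphic_on {w. Re w > 0}"
    unfolding ferrers_laplace_def[abs_def]
    by (intro holomorphic_intros) (auto simp: complex_nonpos_Reals_iff)
  show "(\<lambda>w. (\<Sum>j<N. a_coeff j \<mu> * Gamma (\<nu> - of_nat j + 1 / 2) * w ^ j) + ferrers_remainder \<nu> \<mu> N w)
      holomorphic_on {w. Re w > 0}"
    unfolding ferrers_remainder_def by (intro holomorphic_intros holomorphic_ferrers_stieltjes \<mu> \<nu>)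
  show "open {w. Re w > 0}" by (rule open_halfspace_Re_gt)
  show "connected {w. Re w > 0}" by (intro convex_connected convex_halfspace_Re_gt)
qed (use w in \<open>simp_all add: ferrers_laplace_expansion_real[OF _ \<mu> \<nu>]\<close>)

text \<open>The resolvent identity 1 / D1 - 1 / D2 = (D2 - D1) / (D1 D2) brings out z2 - z1 and one
  factor \<open>stieltjes_ratio\<close>, which raises the weight to index N + 1; both denominators
  have modulus at least 1.\<close>

lemma norm_stieltjes_diff_le:
  assumes z: "Re z1 \<ge> 0" "Re z2 \<ge> 0" and \<mu>: "\<bar>Re \<mu>\<bar> < real N + 1 / 2"
  shows "norm (stieltjes \<mu> N z1 - stieltjes \<mu> N z2) \<le> norm (z1 - z2) * stieltjes_moment (Suc N) (Re \<mu>)"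
proof -
  define D where "D = (\<lambda>z y. 1 + z * complex_of_real (stieltjes_ratio y))"
  define k where "k = (\<lambda>N z y. exp (\<mu> * of_real y) * of_real (stieltjes_weight N y) / D z y)"
  have int: "integrable lborel (k N z1)" "integrable lborel (k N z2)"
    unfolding k_def D_def by (intro integrable_stieltjes_kernel z \<mu>)+
  have \<mu>': "\<bar>Re \<mu>\<bar> < real (Suc N) + 1 / 2" using \<mu> by simp
  have "stieltjes \<mu> N z1 - stieltjes \<mu> N z2 = (\<integral>y. k N z1 y - k N z2 y \<partial>lborel)"
    using int by (simp add: stieltjes_def k_def D_def)
  also have "norm \<dots> \<le> (\<integral>y. norm (z1 - z2) * (exp (Re \<mu> * y) * stieltjes_weight (Suc N) y) \<partial>lborel)"
  proof (rule Bochner_Integration.integral_norm_bound_integral)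
    show "integrable lborel (\<lambda>y. k N z1 y - k N z2 y)" using int by simp
    show "integrable lborel (\<lambda>y. norm (z1 - z2) * (exp (Re \<mu> * y) * stieltjes_weight (Suc N) y))"
      using has_bochner_integral_stieltjes_moment_real[OF \<mu>'] by (auto simp: has_bochner_integral_iff)
    fix y
    have D0: "D z1 y \<noteq> 0" "D z2 y \<noteq> 0" unfolding D_def using stieltjes_denom_nonzero z by blast+
    have D1: "norm (D z1 y) \<ge> 1" unfolding D_def by (rule norm_stieltjes_denom[OF z(1)])
    have "k N z1 y - k N z2 y = exp (\<mu> * of_real y) * of_real (stieltjes_weight N y) * (D z2 y - D z1 y) / (D z1 y * D z2 y)"
      unfolding k_def using D0 by (simp add: field_simps)
    also have "D z2 y - D z1 y = (z2 - z1) * of_real (stieltjes_ratio y)" by (simp add: D_def algebra_simps)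
    finally have "k N z1 y - k N z2 y = (z2 - z1) * k (Suc N) z2 y / D z1 y"
      unfolding k_def stieltjes_weight_Suc by (simp add: mult_ac)
    then have "norm (k N z1 y - k N z2 y) = norm (z1 - z2) * norm (k (Suc N) z2 y) / norm (D z1 y)"
      by (simp add: norm_mult norm_divide norm_minus_commute)
    also have "\<dots> \<le> norm (z1 - z2) * norm (k (Suc N) z2 y) / 1"
      using D1 by (intro divide_left_mono) auto
    also have "\<dots> \<le> norm (z1 - z2) * (exp (Re \<mu> * y) * stieltjes_weight (Suc N) y)"
      unfolding k_def D_def using norm_stieltjes_kernel_le[OF z(2), of \<mu> y "Suc N"] by (simp add: mult_left_mono)
    finally show "norm (k N z1 y - k N z2 y) \<le> norm (z1 - z2) * (exp (Re \<mu> * y) * stieltjes_weight (Suc N) y)" .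
  qed
  also have "\<dots> = norm (z1 - z2) * stieltjes_moment (Suc N) (Re \<mu>)"
    using has_bochner_integral_stieltjes_moment_real[OF \<mu>'] by (simp add: has_bochner_integral_iff)
  finally show ?thesis .
qed

section \<open>Limiting values of the quotient of a_N and the cosine\<close>

lemma Gamma_reflection_half_real: "Gamma (1 / 2 - x) * Gamma (1 / 2 + x) = pi / cos (pi * x)" for x :: real
proof -
  have "1 / 2 - complex_of_real x = of_real (1 / 2 - x)" "1 / 2 + complex_of_real x = of_real (1 / 2 + x)"
    "cos (complex_of_real pi * of_real x) = of_real (cos (pi * x))"
    using cos_of_real[of "pi * x", where ?'a = complex] by simp_all
  then have "complex_of_real (Gamma (1 / 2 - x) * Gamma (1 / 2 + x)) = of_real (pi / cos (pi * x))"
    using Gamma_reflection_half[of "of_real x"]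
    by (simp only: Gamma_complex_of_real of_real_mult of_real_divide)
  then show ?thesis by (simp only: of_real_eq_iff)
qed

lemma stieltjes_moment_pos: "\<bar>x\<bar> < real N + 1 / 2 \<Longrightarrow> stieltjes_moment N x > (0::real)"
  unfolding stieltjes_moment_def by (auto intro!: mult_pos_pos divide_pos_pos Gamma_real_pos)

text \<open>Unless 2 x is odd, neither 1/2 - x nor 1/2 + x is a pole of Gamma, so the moment formula
  applies. Absolute values remove the signs, since the moment is positive.\<close>

lemma a_cos_quotient:
  fixes x :: real
  assumes x: "\<bar>x\<bar> < real N + 1 / 2" and odd: "\<not> (\<exists>m::int. odd m \<and> 2 * x = of_int m)"
  shows "\<bar>a_coeff N x\<bar> / \<bar>cos (pi * x)\<bar> = pochhammer (1 / 2) N * stieltjes_moment N x / pi"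
proof -
  have "1 / 2 - x \<notin> \<int>\<^sub>\<le>\<^sub>0"
  proof
    assume "1 / 2 - x \<in> \<int>\<^sub>\<le>\<^sub>0"
    then obtain n where "1 / 2 - x = of_int n" by (auto elim!: nonpos_Ints_cases)
    then have "2 * x = of_int (1 - 2 * n)" by simp
    moreover have "odd (1 - 2 * n)" by simp
    ultimately show False using odd by blast
  qed
  moreover have "1 / 2 + x \<notin> \<int>\<^sub>\<le>\<^sub>0"
  proof
    assume "1 / 2 + x \<in> \<int>\<^sub>\<le>\<^sub>0"
    then obtain n where "1 / 2 + x = of_int n" by (auto elim!: nonpos_Ints_cases)
    then have "2 * x = of_int (2 * n - 1)" by simp
    moreover have "odd (2 * n - 1)" by simp
    ultimately show False using odd by blast
  qed
  ultimately have "pochhammer (1 / 2) N * stieltjes_moment N x = (-1) ^ N * a_coeff N x * (pi / cos (pi * x))"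
    unfolding Gamma_reflection_half_real[symmetric] by (rule stieltjes_moment_a_coeff)
  then have "\<bar>pochhammer (1 / 2) N * stieltjes_moment N x\<bar> = \<bar>a_coeff N x\<bar> * (pi / \<bar>cos (pi * x)\<bar>)"
    by (simp add: abs_mult power_abs)
  moreover have "pochhammer (1 / 2) N * stieltjes_moment N x > 0"
    using stieltjes_moment_pos[OF x] by (intro mult_pos_pos pochhammer_pos) auto
  ultimately show ?thesis by simp
qed

text \<open>The moment is continuous on |x| < N + 1/2, so the singularities of the quotient at odd 2
  x are removable there, and the limiting value is the value of the moment side.\<close>

lemma a_cos_ratio_eq:
  assumes x: "\<bar>x\<bar> < real N + 1 / 2"
  shows "a_cos_ratio N x = pochhammer (1 / 2) N * stieltjes_moment N x / pi"
proof (cases "\<exists>m::int. odd m \<and> 2 * x = of_int m")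
  case False
  then show ?thesis unfolding a_cos_ratio_def if_not_P[OF False] by (rule a_cos_quotient[OF x])
next
  case True
  then obtain m :: int where m: "odd m" "2 * x = of_int m" by blast
  have "eventually (\<lambda>t. \<bar>t\<bar> < real N + 1 / 2) (at x)"
    using x by (intro order_tendstoD(2)[of "\<lambda>t. \<bar>t\<bar>" "\<bar>x\<bar>"] tendsto_intros)
  moreover have "eventually (\<lambda>t. dist t x < 1 \<and> t \<noteq> x) (at x)"
    unfolding eventually_at by (intro exI[of _ 1]) auto
  ultimately have ev: "eventually (\<lambda>t. pochhammer (1 / 2) N * stieltjes_moment N t / pi = \<bar>a_coeff N t\<bar> / \<bar>cos (pi * t)\<bar>) (at x)"
  proof eventually_elim
    case (elim t)
    have "\<not> (\<exists>m::int. odd m \<and> 2 * t = of_int m)"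
    proof
      assume "\<exists>m::int. odd m \<and> 2 * t = of_int m"
      then obtain k :: int where k: "odd k" "2 * t = of_int k" by blast
      \<comment> \<open>Distinct odd integers differ by at least 2, so no other exceptional point
        lies within distance 1 of x.\<close>
      have "real_of_int (k - m) = 2 * (t - x)" using k m by simp
      then have "\<bar>real_of_int (k - m)\<bar> < 2" using elim by (simp only: abs_mult) (simp add: dist_real_def)
      then have "\<bar>k - m\<bar> < 2" by linarith
      moreover have "even (k - m)" using k m by simp
      ultimately have "k = m" by presburger
      then show False using k m elim by simp
    qed
    then show ?case using a_cos_quotient[of t N] elim by simp
  qed
  have pos: "real N + 1 / 2 - x > 0" "real N + 1 / 2 + x > 0" using x by (auto simp: abs_less_iff)
  have "((\<lambda>t. pochhammer (1 / 2) N * stieltjes_moment N t / pi) \<longlongrightarrow> pochhammer (1 / 2) N * stieltjes_moment N x / pi) (at x)"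
    unfolding stieltjes_moment_def using pos
    by (intro tendsto_intros) (auto elim!: nonpos_Ints_cases)
  then have "((\<lambda>t. \<bar>a_coeff N t\<bar> / \<bar>cos (pi * t)\<bar>) \<longlongrightarrow> pochhammer (1 / 2) N * stieltjes_moment N x / pi) (at x)"
    using ev by (rule Lim_transform_eventually)
  then have "Lim (at x) (\<lambda>t. \<bar>a_coeff N t\<bar> / \<bar>cos (pi * t)\<bar>) = pochhammer (1 / 2) N * stieltjes_moment N x / pi"
    by (intro tendsto_Lim) auto
  then show ?thesis unfolding a_cos_ratio_def if_P[OF True] .
qed

text \<open>The constants of the remainder after (- w)^N is split: the sign stays here, and w^N goes
  into the phase.\<close>

definition ferrers_prefactor :: "complex \<Rightarrow> complex \<Rightarrow> nat \<Rightarrow> complex" where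
  "ferrers_prefactor \<nu> \<mu> N = (-1) ^ N * (cos (of_real pi * \<mu>) / of_real pi * (Gamma (\<nu> + 1) / of_real (sqrt pi)))"

text \<open>The indices M and N are independent because the second pair of bounds combines the
  prefactor of index N with the integral of index N + 1.\<close>

lemma ferrers_prefactor_bound:
  assumes \<mu>: "\<bar>Re \<mu>\<bar> < real N + 1 / 2" and \<nu>: "Re \<nu> > real N - 1 / 2" and \<nu>1: "Re \<nu> > - 1"
  shows "norm (ferrers_prefactor \<nu> \<mu> M) * (\<integral>x. beta_kernel_real (Re \<nu>) N x * stieltjes_moment N (Re \<mu>) \<partial>lborel) \<le>
    norm (cos (of_real pi * \<mu>)) * a_cos_ratio N (Re \<mu>) * Gamma (Re \<nu> - real N + 1 / 2)"
proof -
  define G where "G = Gamma (Re \<nu> + 1)"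
  have G: "G > 0" unfolding G_def using \<nu>1 by (intro Gamma_real_pos) auto
  have m: "stieltjes_moment N (Re \<mu>) > 0" by (rule stieltjes_moment_pos[OF \<mu>])
  have half: "Gamma (real N + 1 / 2) = pochhammer (1 / 2) N * sqrt pi"
  proof -
    have "(1 / 2 :: real) \<notin> \<int>\<^sub>\<le>\<^sub>0" by (auto elim!: nonpos_Ints_cases)
    then have "pochhammer (1 / 2 :: real) N = Gamma (1 / 2 + real N) / Gamma (1 / 2)"
      by (rule pochhammer_Gamma)
    then show ?thesis by (simp add: Gamma_one_half_real add.commute)
  qed
  have GN: "Gamma (Re \<nu> - real N + 1 / 2) > 0" using \<nu> by (intro Gamma_real_pos) auto
  have poch: "pochhammer (1 / 2 :: real) N > 0" by (intro pochhammer_pos) auto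
  have I: "(\<integral>x. beta_kernel_real (Re \<nu>) N x * stieltjes_moment N (Re \<mu>) \<partial>lborel) =
      pochhammer (1 / 2) N * sqrt pi * Gamma (Re \<nu> - real N + 1 / 2) / G * stieltjes_moment N (Re \<mu>)"
    using has_bochner_integral_beta_kernel_real[OF \<nu>] unfolding half G_def by (simp add: has_bochner_integral_iff)
  have "norm (Gamma (\<nu> + 1)) \<le> G"
    using norm_Gamma_le[of "\<nu> + 1"] \<nu>1 by (simp add: G_def)
  then have "norm (ferrers_prefactor \<nu> \<mu> M) \<le> norm (cos (of_real pi * \<mu>)) / pi * (G / sqrt pi)"
  proof -
    have "norm (ferrers_prefactor \<nu> \<mu> M) = norm (cos (of_real pi * \<mu>)) / pi * (norm (Gamma (\<nu> + 1)) / sqrt pi)"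
      by (simp add: ferrers_prefactor_def norm_mult norm_divide norm_power)
    also have "\<dots> \<le> norm (cos (of_real pi * \<mu>)) / pi * (G / sqrt pi)"
      using \<open>norm (Gamma (\<nu> + 1)) \<le> G\<close> by (intro mult_left_mono divide_right_mono) auto
    finally show ?thesis .
  qed
  then have "norm (ferrers_prefactor \<nu> \<mu> M) * (pochhammer (1 / 2) N * sqrt pi * Gamma (Re \<nu> - real N + 1 / 2) / G * stieltjes_moment N (Re \<mu>))
      \<le> norm (cos (of_real pi * \<mu>)) / pi * (G / sqrt pi) * (pochhammer (1 / 2) N * sqrt pi * Gamma (Re \<nu> - real N + 1 / 2) / G * stieltjes_moment N (Re \<mu>))"
    using G m GN poch by (intro mult_right_mono) auto
  also have "\<dots> = norm (cos (of_real pi * \<mu>)) * a_cos_ratio N (Re \<mu>) * Gamma (Re \<nu> - real N + 1 / 2)"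
    unfolding a_cos_ratio_eq[OF \<mu>] using G by (simp add: field_simps)
  finally show ?thesis unfolding I .
qed

lemma norm_ferrers_stieltjes_le:
  assumes "Re w > 0" "\<bar>Re \<mu>\<bar> < real N + 1 / 2" "Re \<nu> > real N - 1 / 2"
  shows "norm (ferrers_stieltjes \<nu> \<mu> N w) \<le> (\<integral>x. beta_kernel_real (Re \<nu>) N x * stieltjes_moment N (Re \<mu>) \<partial>lborel)"
  unfolding ferrers_stieltjes_def
  by (rule Bochner_Integration.integral_norm_bound_integral)
     (intro integrable_beta_stieltjes integrable_beta_majorant norm_beta_stieltjes_le assms)+

text \<open>The arguments of the transform differ by (w1 - w2) exp x, and the factor exp x raises
  the Beta kernel to index N + 1. Its integrability is where Re \<nu> > N + 1/2 enters.\<close>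

lemma norm_ferrers_stieltjes_diff_le:
  assumes w: "Re w1 > 0" "Re w2 > 0" and \<mu>: "\<bar>Re \<mu>\<bar> < real N + 1 / 2" and \<nu>: "Re \<nu> > real N + 1 / 2"
  shows "norm (ferrers_stieltjes \<nu> \<mu> N w1 - ferrers_stieltjes \<nu> \<mu> N w2) \<le>
    norm (w1 - w2) * (\<integral>x. beta_kernel_real (Re \<nu>) (Suc N) x * stieltjes_moment (Suc N) (Re \<mu>) \<partial>lborel)"
proof -
  have \<nu>': "Re \<nu> > real N - 1 / 2" "Re \<nu> > real (Suc N) - 1 / 2" using \<nu> by simp_all
  note int = integrable_beta_stieltjes[OF w(1) \<mu> \<nu>'(1)] integrable_beta_stieltjes[OF w(2) \<mu> \<nu>'(1)]
  have "ferrers_stieltjes \<nu> \<mu> N w1 - ferrers_stieltjes \<nu> \<mu> N w2 =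
      (\<integral>x. beta_kernel \<nu> N x * stieltjes \<mu> N (w1 * of_real (exp x)) - beta_kernel \<nu> N x * stieltjes \<mu> N (w2 * of_real (exp x)) \<partial>lborel)"
    unfolding ferrers_stieltjes_def by (rule Bochner_Integration.integral_diff[OF int, symmetric])
  also have "norm \<dots> \<le> (\<integral>x. norm (w1 - w2) * (beta_kernel_real (Re \<nu>) (Suc N) x * stieltjes_moment (Suc N) (Re \<mu>)) \<partial>lborel)"
  proof (rule Bochner_Integration.integral_norm_bound_integral)
    show "integrable lborel (\<lambda>x. norm (w1 - w2) * (beta_kernel_real (Re \<nu>) (Suc N) x * stieltjes_moment (Suc N) (Re \<mu>)))"
      by (intro integrable_mult_right integrable_beta_majorant \<nu>')
    fix x
    have "norm (beta_kernel \<nu> N x * stieltjes \<mu> N (w1 * of_real (exp x)) - beta_kernel \<nu> N x * stieltjes \<mu> N (w2 * of_real (exp x))) =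
        beta_kernel_real (Re \<nu>) N x * norm (stieltjes \<mu> N (w1 * of_real (exp x)) - stieltjes \<mu> N (w2 * of_real (exp x)))"
      by (simp add: norm_beta_kernel[symmetric] norm_mult[symmetric] right_diff_distrib)
    also have "\<dots> \<le> beta_kernel_real (Re \<nu>) N x * (norm (w1 * of_real (exp x) - w2 * of_real (exp x)) * stieltjes_moment (Suc N) (Re \<mu>))"
      using w by (intro mult_left_mono norm_stieltjes_diff_le \<mu>) (auto simp: beta_kernel_real_def)
    also have "norm (w1 * of_real (exp x) - w2 * of_real (exp x)) = norm (w1 - w2) * exp x"
      by (simp add: norm_mult flip: left_diff_distrib)
    also have "beta_kernel_real (Re \<nu>) N x * (norm (w1 - w2) * exp x * stieltjes_moment (Suc N) (Re \<mu>)) =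
        norm (w1 - w2) * (beta_kernel_real (Re \<nu>) (Suc N) x * stieltjes_moment (Suc N) (Re \<mu>))"
    proof -
      have "beta_kernel_real (Re \<nu>) (Suc N) x = beta_kernel_real (Re \<nu>) N x * exp x"
      proof -
        have "(real (Suc N) + 1 / 2) * x = (real N + 1 / 2) * x + x" by (simp add: algebra_simps)
        then show ?thesis by (simp only: beta_kernel_real_def exp_add mult_ac)
      qed
      then show ?thesis by simp
    qed
    finally show "norm (beta_kernel \<nu> N x * stieltjes \<mu> N (w1 * of_real (exp x)) - beta_kernel \<nu> N x * stieltjes \<mu> N (w2 * of_real (exp x)))
      \<le> norm (w1 - w2) * (beta_kernel_real (Re \<nu>) (Suc N) x * stieltjes_moment (Suc N) (Re \<mu>))" .
  qed (use int in simp)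
  also have "\<dots> = norm (w1 - w2) * (\<integral>x. beta_kernel_real (Re \<nu>) (Suc N) x * stieltjes_moment (Suc N) (Re \<mu>) \<partial>lborel)"
    by simp
  finally show ?thesis .
qed

section \<open>Phases on the line Re w = 1\<close>

lemma ferrers_arg:
  fixes \<zeta> \<sigma> :: real
  assumes \<zeta>: "0 < \<zeta>" "\<zeta> < pi" and \<sigma>: "\<sigma> = 1 \<or> \<sigma> = - 1"
  defines "w \<equiv> 1 + \<sigma> * \<i> * of_real (cot \<zeta>)"
  shows "w = exp (\<sigma> * \<i> * of_real (pi / 2 - \<zeta>)) / of_real (sin \<zeta>)"
    and "w powr s = exp (s * (\<sigma> * \<i> * of_real (pi / 2 - \<zeta>))) * of_real (sin \<zeta>) powr (- s)"
proof -
  have sin: "sin \<zeta> > 0" using \<zeta> by (intro sin_gt_zero)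
  have e: "exp (\<sigma> * \<i> * of_real (pi / 2 - \<zeta>)) = of_real (sin \<zeta>) + \<sigma> * \<i> * of_real (cos \<zeta>)"
  proof -
    have "exp (\<sigma> * \<i> * of_real (pi / 2 - \<zeta>)) = cis (\<sigma> * (pi / 2 - \<zeta>))"
      by (simp add: cis_conv_exp mult_ac)
    also have "\<dots> = of_real (sin \<zeta>) + \<sigma> * \<i> * of_real (cos \<zeta>)"
      using \<sigma> by (auto simp: complex_eq_iff cos_diff sin_diff minus_diff_commute)
    finally show ?thesis .
  qed
  show w: "w = exp (\<sigma> * \<i> * of_real (pi / 2 - \<zeta>)) / of_real (sin \<zeta>)"
    unfolding e w_def using sin by (simp add: cot_def field_simps)
  \<comment> \<open>The exponent is purely imaginary and below pi/2 in modulus, so the principal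
    logarithm returns it.\<close>
  have "Ln (exp (\<sigma> * \<i> * of_real (pi / 2 - \<zeta>))) = \<sigma> * \<i> * of_real (pi / 2 - \<zeta>)"
    using \<sigma> \<zeta> by (intro Ln_exp) auto
  then have Ln: "Ln w = \<sigma> * \<i> * of_real (pi / 2 - \<zeta>) - of_real (ln (sin \<zeta>))"
    unfolding w using sin by (subst Ln_divide_of_real) auto
  have "w \<noteq> 0" unfolding w using sin by simp
  then have "w powr s = exp (s * (\<sigma> * \<i> * of_real (pi / 2 - \<zeta>)) + - s * of_real (ln (sin \<zeta>)))"
    unfolding powr_def Ln by (simp add: right_diff_distrib)
  also have "\<dots> = exp (s * (\<sigma> * \<i> * of_real (pi / 2 - \<zeta>))) * exp (- s * of_real (ln (sin \<zeta>)))"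
    by (rule exp_add)
  also have "exp (- s * of_real (ln (sin \<zeta>))) = of_real (sin \<zeta>) powr (- s)"
    using sin by (simp add: powr_def Ln_of_real)
  finally show "w powr s = exp (s * (\<sigma> * \<i> * of_real (pi / 2 - \<zeta>))) * of_real (sin \<zeta>) powr (- s)" .
qed

text \<open>The angles add up: (\<nu> + 1/2) (pi/2 - \<zeta>) from the power of w, the phase at n =
  0, and pi/2 from the factor i give (\<nu> + 1 + \<mu>) pi/2, the exponent in
  \<open>laplace_J\<close>. The powers of sin \<zeta> leave an inverse square root.\<close>

lemma laplace_J_eq_ferrers_laplace:
  fixes \<zeta> \<sigma> :: real
  assumes \<zeta>: "0 < \<zeta>" "\<zeta> < pi" and \<sigma>: "\<sigma> = 1 \<or> \<sigma> = - 1"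
  defines "w \<equiv> 1 + \<sigma> * \<i> * of_real (cot \<zeta>)"
  shows "laplace_J \<sigma> \<nu> \<mu> (of_real (ln (tan (\<zeta> / 2)))) =
    of_real (sqrt (2 / (pi * sin \<zeta>))) * (\<sigma> * \<i>) * (exp (\<sigma> * \<i> * ferrers_phase \<zeta> \<mu> \<nu> 0) * ferrers_laplace \<nu> \<mu> w)"
proof -
  define S where "S = sin \<zeta>"
  define t where "t = ln (tan (\<zeta> / 2))"
  define L where "L = laplace_int \<mu> (\<nu> + 1) w"
  define si where "si = complex_of_real \<sigma> * \<i>"
  have S: "S > 0" unfolding S_def using \<zeta> by (intro sin_gt_zero)
  have "1 - si * sinh (of_real t) = w"
    unfolding sinh_complex_of_real t_def half_angle_substitution(2)[OF \<zeta>] by (simp add: w_def si_def)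
  moreover have "cosh (complex_of_real t) powr (\<nu> + 1) = of_real S powr (- (\<nu> + 1))"
  proof -
    have "cosh (complex_of_real t) = of_real (1 / S)"
      unfolding cosh_complex_of_real t_def half_angle_substitution(1)[OF \<zeta>] S_def ..
    also have "Ln (of_real (1 / S)) = - of_real (ln S)" using S by (subst Ln_of_real) (auto simp: ln_div)
    finally show ?thesis using S by (simp add: powr_def Ln_of_real algebra_simps)
  qed
  ultimately have J: "laplace_J \<sigma> \<nu> \<mu> (of_real t) =
      1 / of_real pi * Gamma (\<nu> + 1) * exp (si * of_real pi * (\<nu> + 1 + \<mu>) / 2) * of_real S powr (- (\<nu> + 1)) * L"
    unfolding laplace_J_def laplace_sol_def L_def si_def by simp
  have si: "si = exp (si * of_real pi / 2)"
    using powr_sigma_i[OF \<sigma>, of 1] by (simp add: si_def)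
  have ph: "si * (exp (si * ferrers_phase \<zeta> \<mu> \<nu> 0) * exp ((\<nu> + 1 / 2) * (si * of_real (pi / 2 - \<zeta>)))) =
      exp (si * of_real pi * (\<nu> + 1 + \<mu>) / 2)"
  proof -
    have "si * (exp (si * ferrers_phase \<zeta> \<mu> \<nu> 0) * exp ((\<nu> + 1 / 2) * (si * of_real (pi / 2 - \<zeta>)))) =
        exp (si * of_real pi / 2 + (si * ferrers_phase \<zeta> \<mu> \<nu> 0 + (\<nu> + 1 / 2) * (si * of_real (pi / 2 - \<zeta>))))"
      unfolding exp_add si[symmetric] ..
    also have "si * of_real pi / 2 + (si * ferrers_phase \<zeta> \<mu> \<nu> 0 + (\<nu> + 1 / 2) * (si * of_real (pi / 2 - \<zeta>))) =
        si * of_real pi * (\<nu> + 1 + \<mu>) / 2"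
      unfolding ferrers_phase_def by (simp add: field_simps)
    finally show ?thesis .
  qed
  have half: "of_real S powr (- (\<nu> + 1)) = of_real S powr (- (\<nu> + 1 / 2)) / complex_of_real (sqrt S)"
  proof -
    have "complex_of_real (sqrt S) = of_real S powr (1 / 2)"
      using powr_of_real[of S "1 / 2"] powr_half_sqrt[of S] S by simp
    moreover have "- (\<nu> + 1) = - (\<nu> + 1 / 2) - 1 / 2" by simp
    ultimately show ?thesis by (simp only: powr_diff)
  qed
  have sq: "complex_of_real (sqrt (2 / (pi * S))) / (of_real (sqrt pi) * of_real (sqrt 2)) = 1 / of_real pi / of_real (sqrt S)"
  proof -
    have "sqrt (2 / (pi * S)) / (sqrt pi * sqrt 2) = 1 / pi / sqrt S"
    proof -
      have "sqrt (2 / (pi * S)) / (sqrt pi * sqrt 2) = 1 / (sqrt pi * sqrt pi) / sqrt S"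
        by (simp add: real_sqrt_divide real_sqrt_mult)
      then show ?thesis by simp
    qed
    then show ?thesis by (metis of_real_1 of_real_divide of_real_mult)
  qed
  have "of_real (sqrt (2 / (pi * S))) * si * (exp (si * ferrers_phase \<zeta> \<mu> \<nu> 0) * ferrers_laplace \<nu> \<mu> w) =
      (of_real (sqrt (2 / (pi * S))) / (of_real (sqrt pi) * of_real (sqrt 2))) *
      (si * (exp (si * ferrers_phase \<zeta> \<mu> \<nu> 0) * exp ((\<nu> + 1 / 2) * (si * of_real (pi / 2 - \<zeta>))))) *
      of_real S powr (- (\<nu> + 1 / 2)) * Gamma (\<nu> + 1) * L"
    unfolding ferrers_laplace_def L_def w_def si_def ferrers_arg(2)[OF \<zeta> \<sigma>] S_def by (simp add: mult_ac)
  also have "\<dots> = laplace_J \<sigma> \<nu> \<mu> (of_real t)"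
    unfolding sq ph J half by (simp add: mult_ac)
  finally show ?thesis by (simp add: S_def si_def t_def)
qed

lemma laplace_J_expansion:
  fixes \<zeta> \<sigma> :: real
  assumes \<zeta>: "0 < \<zeta>" "\<zeta> < pi" and \<sigma>: "\<sigma> = 1 \<or> \<sigma> = - 1"
    and \<mu>: "\<bar>Re \<mu>\<bar> < real N + 1 / 2" and \<nu>: "Re \<nu> > real N - 1 / 2"
  shows "laplace_J \<sigma> \<nu> \<mu> (of_real (ln (tan (\<zeta> / 2)))) = of_real (sqrt (2 / (pi * sin \<zeta>))) * (\<sigma> * \<i>) *
    ((\<Sum>n<N. a_coeff n \<mu> * Gamma (\<nu> - of_nat n + 1 / 2) * (exp (\<sigma> * \<i> * ferrers_phase \<zeta> \<mu> \<nu> n) / of_real (sin \<zeta> ^ n))) +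
     exp (\<sigma> * \<i> * ferrers_phase \<zeta> \<mu> \<nu> N) / of_real (sin \<zeta> ^ N) *
       (ferrers_prefactor \<nu> \<mu> N * ferrers_stieltjes \<nu> \<mu> N (1 + \<sigma> * \<i> * of_real (cot \<zeta>))))"
proof -
  define w where "w = 1 + \<sigma> * \<i> * of_real (cot \<zeta>)"
  have w: "Re w > 0" by (simp add: w_def)
  \<comment> \<open>Multiplication by w^j adds j (pi/2 - \<zeta>) to the phase and divides by sin^j
    \<zeta>, which leads from \<open>ferrers_phase\<close> at 0 to the one at j.\<close>
  have ph: "exp (\<sigma> * \<i> * ferrers_phase \<zeta> \<mu> \<nu> 0) * w ^ j = exp (\<sigma> * \<i> * ferrers_phase \<zeta> \<mu> \<nu> j) / of_real (sin \<zeta> ^ j)" for j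
  proof -
    have "w ^ j = exp (of_nat j * (\<sigma> * \<i> * of_real (pi / 2 - \<zeta>))) / of_real (sin \<zeta> ^ j)"
      unfolding w_def ferrers_arg(1)[OF \<zeta> \<sigma>] power_divide by (simp only: exp_of_nat_mult of_real_power)
    moreover have "exp (\<sigma> * \<i> * ferrers_phase \<zeta> \<mu> \<nu> 0) * exp (of_nat j * (\<sigma> * \<i> * of_real (pi / 2 - \<zeta>))) =
        exp (\<sigma> * \<i> * ferrers_phase \<zeta> \<mu> \<nu> j)"
    proof -
      have "\<sigma> * \<i> * ferrers_phase \<zeta> \<mu> \<nu> 0 + of_nat j * (\<sigma> * \<i> * of_real (pi / 2 - \<zeta>)) = \<sigma> * \<i> * ferrers_phase \<zeta> \<mu> \<nu> j"
        unfolding ferrers_phase_def by (simp add: field_simps)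
      then show ?thesis by (simp only: exp_add[symmetric])
    qed
    ultimately show ?thesis by (simp only: times_divide_eq_right)
  qed
  have rem: "ferrers_remainder \<nu> \<mu> N w = w ^ N * (ferrers_prefactor \<nu> \<mu> N * ferrers_stieltjes \<nu> \<mu> N w)"
    unfolding ferrers_remainder_def ferrers_prefactor_def power_minus[of w] by (simp only: mult_ac)
  have "exp (\<sigma> * \<i> * ferrers_phase \<zeta> \<mu> \<nu> 0) * ferrers_laplace \<nu> \<mu> w =
      (\<Sum>n<N. a_coeff n \<mu> * Gamma (\<nu> - of_nat n + 1 / 2) * (exp (\<sigma> * \<i> * ferrers_phase \<zeta> \<mu> \<nu> 0) * w ^ n)) +
      (exp (\<sigma> * \<i> * ferrers_phase \<zeta> \<mu> \<nu> 0) * w ^ N) * (ferrers_prefactor \<nu> \<mu> N * ferrers_stieltjes \<nu> \<mu> N w)"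
    unfolding ferrers_laplace_expansion[OF w \<mu> \<nu>] rem distrib_left sum_distrib_left by (simp only: mult_ac)
  note this[unfolded ph, unfolded w_def]
  then show ?thesis
    using laplace_J_eq_ferrers_laplace[OF \<zeta> \<sigma>, of \<nu> \<mu>] by (simp only:)
qed

text \<open>The same pair of remainders has to satisfy both kinds of bounds, so those under the
  stronger condition on \<nu> form an implication inside the existential quantifier.\<close>

theorem theorem4p1:
  fixes \<zeta> :: real and N :: nat and \<mu> \<nu> :: complex
  assumes "0 < \<zeta>" and "\<zeta> < pi"
    and "\<bar>Re \<mu>\<bar> < real N + 1 / 2"
    and "Re \<nu> > real N - 1 / 2"
  shows "\<exists>RP RQ :: complex.
    ferrers_P \<nu> \<mu> (cos \<zeta>) =
      of_real (sqrt (2 / (pi * sin \<zeta>))) / Gamma (\<nu> - \<mu> + 1) *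
        ((\<Sum>n<N. a_coeff n \<mu> * Gamma (\<nu> - of_nat n + 1 / 2) *
            (cos (ferrers_phase \<zeta> \<mu> \<nu> n) / of_real (sin \<zeta> ^ n))) + RP) \<and>
    ferrers_Q \<nu> \<mu> (cos \<zeta>) =
      - of_real (sqrt (pi / (2 * sin \<zeta>))) / Gamma (\<nu> - \<mu> + 1) *
        ((\<Sum>n<N. a_coeff n \<mu> * Gamma (\<nu> - of_nat n + 1 / 2) *
            (sin (ferrers_phase \<zeta> \<mu> \<nu> n) / of_real (sin \<zeta> ^ n))) + RQ) \<and>
    cmod RP \<le> cmod (cos (of_real pi * \<mu>)) * a_cos_ratio N (Re \<mu>) *
      Gamma (Re \<nu> - real N + 1 / 2) * (cosh (Im (ferrers_phase \<zeta> \<mu> \<nu> N)) / sin \<zeta> ^ N) \<and>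
    cmod RQ \<le> cmod (cos (of_real pi * \<mu>)) * a_cos_ratio N (Re \<mu>) *
      Gamma (Re \<nu> - real N + 1 / 2) * (cosh (Im (ferrers_phase \<zeta> \<mu> \<nu> N)) / sin \<zeta> ^ N) \<and>
    (Re \<nu> > real N + 1 / 2 \<longrightarrow>
      cmod RP \<le>
        cmod (cos (of_real pi * \<mu>)) * a_cos_ratio N (Re \<mu>) *
          Gamma (Re \<nu> - real N + 1 / 2) *
          (cmod (cos (ferrers_phase \<zeta> \<mu> \<nu> N)) / sin \<zeta> ^ N)
        + cmod (cos (of_real pi * \<mu>)) * a_cos_ratio (N + 1) (Re \<mu>) *
          Gamma (Re \<nu> - real N - 1 / 2) *
          (cmod (sin (ferrers_phase \<zeta> \<mu> \<nu> N)) / sin \<zeta> ^ (N + 1)) \<and>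
      cmod RQ \<le>
        cmod (cos (of_real pi * \<mu>)) * a_cos_ratio N (Re \<mu>) *
          Gamma (Re \<nu> - real N + 1 / 2) *
          (cmod (sin (ferrers_phase \<zeta> \<mu> \<nu> N)) / sin \<zeta> ^ N)
        + cmod (cos (of_real pi * \<mu>)) * a_cos_ratio (N + 1) (Re \<mu>) *
          Gamma (Re \<nu> - real N - 1 / 2) *
          (cmod (cos (ferrers_phase \<zeta> \<mu> \<nu> N)) / sin \<zeta> ^ (N + 1)))"
proof -
  note \<zeta> = assms(1,2) and \<mu> = assms(3) and \<nu> = assms(4)
  define S where "S = sin \<zeta>"
  define \<alpha> where "\<alpha> = ferrers_phase \<zeta> \<mu> \<nu>"
  define M where "M = ferrers_prefactor \<nu> \<mu> N"
  define w where "w = (\<lambda>\<sigma>::real. 1 + \<sigma> * \<i> * of_real (cot \<zeta>))"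
  define I where "I = (\<lambda>\<sigma>. ferrers_stieltjes \<nu> \<mu> N (w \<sigma>))"
  \<comment> \<open>The part of the remainder that belongs to one sign \<sigma>.\<close>
  define T where "T = (\<lambda>\<sigma>::real. exp (\<sigma> * \<i> * \<alpha> N) / of_real (S ^ N) * (M * I \<sigma>))"
  define A where "A = (\<lambda>n. a_coeff n \<mu> * Gamma (\<nu> - of_nat n + 1 / 2))"
  define G where "G = Gamma (\<nu> - \<mu> + 1)"
  define t where "t = ln (tan (\<zeta> / 2))"
  define c where "c = complex_of_real (sqrt (2 / (pi * S)))"
  define B where "B = norm (cos (of_real pi * \<mu>)) * a_cos_ratio N (Re \<mu>) * Gamma (Re \<nu> - real N + 1 / 2)"
  define B' where "B' = norm (cos (of_real pi * \<mu>)) * a_cos_ratio (N + 1) (Re \<mu>) * Gamma (Re \<nu> - real N - 1 / 2)"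
  \<comment> \<open>Half sums of exp (i \<alpha>) and exp (- i \<alpha>) turn the main terms into
    cosines, and differences divided by 2 i turn them into sines; the remainders follow the same
    pattern.\<close>
  define RP where "RP = (T 1 + T (- 1)) / 2"
  define RQ where "RQ = (T 1 - T (- 1)) / (2 * \<i>)"
  have S: "S > 0" unfolding S_def using \<zeta> by (intro sin_gt_zero)
  \<comment> \<open>The hypotheses chain to |Re \<mu>| < N + 1/2 < Re \<nu> + 1, the convergence
    condition of the Laplace-type integral.\<close>
  have \<mu>\<nu>: "\<bar>Re \<mu>\<bar> < Re \<nu> + 1" using \<mu> \<nu> by simp
  have wpos: "Re (w \<sigma>) > 0" for \<sigma> by (simp add: w_def)
  have J: "laplace_J \<sigma> \<nu> \<mu> (of_real t) = c * (\<sigma> * \<i>) *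
      ((\<Sum>n<N. A n * (exp (\<sigma> * \<i> * \<alpha> n) / of_real (S ^ n))) + T \<sigma>)" if "\<sigma> = 1 \<or> \<sigma> = - 1" for \<sigma>
    unfolding c_def A_def \<alpha>_def S_def T_def M_def I_def w_def t_def
    by (rule laplace_J_expansion[OF \<zeta> that \<mu> \<nu>])
  have J1: "laplace_J 1 \<nu> \<mu> (of_real t) = c * \<i> *
      ((\<Sum>n<N. A n * (exp (\<i> * \<alpha> n) / of_real (S ^ n))) + T 1)"
    using J[of 1] by simp
  \<comment> \<open>The factor \<sigma> i changes sign with \<sigma>; so the difference in P adds
    the two expansions, and the sum in Q subtracts them.\<close>
  have J2: "laplace_J (- 1) \<nu> \<mu> (of_real t) = - (c * \<i> *
      ((\<Sum>n<N. A n * (exp (- (\<i> * \<alpha> n)) / of_real (S ^ n))) + T (- 1)))"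
    using J[of "-1"] by simp
  have P: "ferrers_P \<nu> \<mu> (cos \<zeta>) = c / G * ((\<Sum>n<N. A n * (cos (\<alpha> n) / of_real (S ^ n))) + RP)"
  proof -
    have "(\<Sum>n<N. A n * (cos (\<alpha> n) / of_real (S ^ n))) =
        ((\<Sum>n<N. A n * (exp (\<i> * \<alpha> n) / of_real (S ^ n))) + (\<Sum>n<N. A n * (exp (- (\<i> * \<alpha> n)) / of_real (S ^ n)))) / 2"
      unfolding sum.distrib[symmetric] sum_divide_distrib cos_exp_eq
      by (intro sum.cong refl) (simp add: add_divide_distrib distrib_left mult_ac)
    moreover have "(c * \<i> * a - - (c * \<i> * b)) / (2 * \<i>) / G = c / G * ((a + b) / 2)" for a b
    proof -
      have "c * \<i> * a - - (c * \<i> * b) = \<i> * (c * (a + b))" by (simp add: algebra_simps)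
      then show ?thesis by simp
    qed
    ultimately show ?thesis
      unfolding ferrers_P_laplace[OF \<zeta> \<mu>\<nu>] t_def[symmetric] J1 J2 RP_def G_def[symmetric]
      by (simp only: add_divide_distrib[symmetric] add_ac)
  qed
  \<comment> \<open>The constant of Q goes under the root: (pi/2) sqrt (2 / (pi S)) = sqrt (pi / (2
    S)).\<close>
  have c': "of_real pi / 4 * c * 2 = complex_of_real (sqrt (pi / (2 * S)))"
  proof -
    have "pi / 2 * sqrt (2 / (pi * S)) = sqrt ((pi / 2)\<^sup>2 * (2 / (pi * S)))"
      unfolding real_sqrt_mult[of "(pi / 2)\<^sup>2"] real_sqrt_abs by simp
    also have "(pi / 2)\<^sup>2 * (2 / (pi * S)) = pi / (2 * S)" by (simp add: power2_eq_square field_simps)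
    finally have "complex_of_real (pi / 2 * sqrt (2 / (pi * S))) = of_real (sqrt (pi / (2 * S)))" by simp
    then show ?thesis by (simp add: c_def)
  qed
  have Q: "ferrers_Q \<nu> \<mu> (cos \<zeta>) = - of_real (sqrt (pi / (2 * S))) / G * ((\<Sum>n<N. A n * (sin (\<alpha> n) / of_real (S ^ n))) + RQ)"
  proof -
    have "(\<Sum>n<N. A n * (sin (\<alpha> n) / of_real (S ^ n))) =
        ((\<Sum>n<N. A n * (exp (\<i> * \<alpha> n) / of_real (S ^ n))) - (\<Sum>n<N. A n * (exp (- (\<i> * \<alpha> n)) / of_real (S ^ n)))) / (2 * \<i>)"
      unfolding sum_subtractf[symmetric] sum_divide_distrib sin_exp_eq
      by (intro sum.cong refl) (simp add: diff_divide_distrib right_diff_distrib mult_ac)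
    moreover have "of_real pi / 4 * (c * \<i> * a + - (c * \<i> * b)) / G = - (of_real pi / 4 * c * 2) / G * ((a - b) / (2 * \<i>))" for a b
    proof -
      have "c * \<i> * a + - (c * \<i> * b) = \<i> * (c * (a - b))" by (simp add: algebra_simps)
      moreover have "(a - b) / (2 * \<i>) = - (\<i> * (a - b) / 2)" by (simp add: divide_simps)
      ultimately show ?thesis by simp
    qed
    moreover have "a + T 1 - (b + T (- 1)) = (a - b) + (T 1 - T (- 1))" for a b by simp
    ultimately show ?thesis
      unfolding ferrers_Q_laplace[OF \<zeta> \<mu>\<nu>] t_def[symmetric] J1 J2 RQ_def G_def[symmetric] c'[symmetric]
      by (simp only: add_divide_distrib[symmetric])
  qed
  have "- 1 < Re \<nu>" using \<mu>\<nu> by linarith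
  note prefactor = ferrers_prefactor_bound[OF _ _ this]
  have MI: "norm M * norm (I \<sigma>) \<le> B" for \<sigma>
  proof -
    have "norm M * norm (I \<sigma>) \<le> norm M * (\<integral>x. beta_kernel_real (Re \<nu>) N x * stieltjes_moment N (Re \<mu>) \<partial>lborel)"
      unfolding I_def by (intro mult_left_mono norm_ferrers_stieltjes_le wpos \<mu> \<nu>) auto
    also have "\<dots> \<le> B" unfolding M_def B_def by (rule prefactor[OF \<mu> \<nu>])
    finally show ?thesis .
  qed
  \<comment> \<open>The modulus of exp (i \<sigma> \<alpha>) is exp (- \<sigma> Im \<alpha>);
    averaging over both signs produces cosh (Im \<alpha>).\<close>
  have Tb: "norm (T 1) \<le> exp (- Im (\<alpha> N)) / S ^ N * B" "norm (T (- 1)) \<le> exp (Im (\<alpha> N)) / S ^ N * B"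
    unfolding T_def norm_mult norm_divide norm_exp_eq_Re using S MI
    by (auto simp: norm_power intro!: mult_left_mono divide_right_mono)
  have Tsum: "norm (T 1) + norm (T (- 1)) \<le> 2 * (B * (cosh (Im (\<alpha> N)) / S ^ N))"
  proof -
    have "exp (- Im (\<alpha> N)) / S ^ N * B + exp (Im (\<alpha> N)) / S ^ N * B = 2 * (B * (cosh (Im (\<alpha> N)) / S ^ N))"
      by (simp add: cosh_field_def add_divide_distrib distrib_left mult_ac)
    with add_mono[OF Tb] show ?thesis by (simp only:)
  qed
  have RP1: "norm RP \<le> B * (cosh (Im (\<alpha> N)) / S ^ N)"
  proof -
    have "norm RP = norm (T 1 + T (- 1)) / 2" by (simp add: RP_def norm_divide)
    then show ?thesis using norm_triangle_ineq[of "T 1" "T (- 1)"] Tsum by linarith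
  qed
  have RQ1: "norm RQ \<le> B * (cosh (Im (\<alpha> N)) / S ^ N)"
  proof -
    have "norm RQ = norm (T 1 - T (- 1)) / 2" by (simp add: RQ_def norm_divide norm_mult)
    then show ?thesis using norm_triangle_ineq4[of "T 1" "T (- 1)"] Tsum by linarith
  qed
  \<comment> \<open>Even and odd parts of the remainder integral: I \<sigma> = X - \<sigma> i Y.
    Rewriting the exponentials through cos and sin pairs cos \<alpha> with X and sin \<alpha> with Y
    in \<open>RP\<close>, and sin \<alpha> with X and cos \<alpha> with Y in \<open>RQ\<close>. X is
    bounded by the mean of the two values, Y through their difference.\<close>
  define X where "X = (I 1 + I (- 1)) / 2"
  define Y where "Y = (I (- 1) - I 1) / (2 * \<i>)"
  have IX: "I 1 = X - \<i> * Y" "I (- 1) = X + \<i> * Y"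
  proof -
    have "\<i> * (z / (2 * \<i>)) = z / 2" for z :: complex by simp
    then have "\<i> * Y = (I (- 1) - I 1) / 2" unfolding Y_def .
    then show "I 1 = X - \<i> * Y" "I (- 1) = X + \<i> * Y"
      by (simp_all add: X_def add_divide_distrib diff_divide_distrib)
  qed
  have MX: "norm M * norm X \<le> B"
  proof -
    have "norm X \<le> (norm (I 1) + norm (I (- 1))) / 2"
      unfolding X_def using norm_triangle_ineq[of "I 1" "I (- 1)"] by (simp add: norm_divide)
    then have "norm M * norm X \<le> norm M * ((norm (I 1) + norm (I (- 1))) / 2)" by (intro mult_left_mono) auto
    also have "\<dots> \<le> B" using MI[of 1] MI[of "-1"] by (simp add: distrib_left)
    finally show ?thesis .
  qed
  have MY: "norm M * norm Y \<le> B' / S" if \<nu>2: "Re \<nu> > real N + 1 / 2"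
  proof -
    define K where "K = (\<integral>x. beta_kernel_real (Re \<nu>) (Suc N) x * stieltjes_moment (Suc N) (Re \<mu>) \<partial>lborel)"
    have MK: "norm M * K \<le> B'"
    proof -
      have "\<bar>Re \<mu>\<bar> < real (Suc N) + 1 / 2" "Re \<nu> > real (Suc N) - 1 / 2" using \<mu> \<nu>2 by simp_all
      note prefactor[OF this, of N]
      moreover have "Re \<nu> - real (Suc N) + 1 / 2 = Re \<nu> - real N - 1 / 2" by simp
      ultimately show ?thesis unfolding K_def M_def B'_def by (simp only: Suc_eq_plus1)
    qed
    have K0: "K \<ge> 0"
      unfolding K_def using \<mu> stieltjes_moment_pos[of "Re \<mu>" "Suc N"]
      by (intro Bochner_Integration.integral_nonneg) (auto simp: beta_kernel_real_def)
    \<comment> \<open>Halving this distance leaves |cot \<zeta>| \<le> 1 / sin \<zeta>, the source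
      of the extra power of the sine in the second term of the bounds.\<close>
    have "norm (w (- 1) - w 1) = 2 * \<bar>cot \<zeta>\<bar>" by (simp add: w_def norm_mult)
    then have "norm (I (- 1) - I 1) \<le> 2 * \<bar>cot \<zeta>\<bar> * K"
      using norm_ferrers_stieltjes_diff_le[OF wpos[of "-1"] wpos[of 1] \<mu> \<nu>2] by (simp add: I_def K_def)
    then have "norm Y \<le> \<bar>cot \<zeta>\<bar> * K" by (simp add: Y_def norm_divide norm_mult)
    also have "\<dots> \<le> 1 / S * K"
    proof (rule mult_right_mono[OF _ K0])
      show "\<bar>cot \<zeta>\<bar> \<le> 1 / S"
        using S by (simp add: cot_def S_def abs_divide divide_right_mono)
    qed
    finally have "norm M * norm Y \<le> norm M * (1 / S * K)" by (intro mult_left_mono) auto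
    also have "\<dots> \<le> B' / S" using MK S by (simp add: divide_right_mono)
    finally show ?thesis .
  qed
  have div_2i: "z / (2 * \<i>) = - (\<i> * z / 2)" for z :: complex by (simp add: divide_simps)
  define E F where "E = exp (\<i> * \<alpha> N)" and "F = exp (- (\<i> * \<alpha> N))"
  have trig: "cos (\<alpha> N) = (E + F) / 2" "sin (\<alpha> N) = - (\<i> * (E - F) / 2)"
    by (simp_all only: cos_exp_eq sin_exp_eq E_def F_def div_2i)
  have T12: "T 1 = M / of_real (S ^ N) * (E * (X - \<i> * Y))" "T (- 1) = M / of_real (S ^ N) * (F * (X + \<i> * Y))"
    by (simp_all add: T_def E_def F_def IX)
  have RPX: "RP = M / of_real (S ^ N) * (cos (\<alpha> N) * X + sin (\<alpha> N) * Y)"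
  proof -
    have "(E * (X - \<i> * Y) + F * (X + \<i> * Y)) / 2 = cos (\<alpha> N) * X + sin (\<alpha> N) * Y"
      unfolding trig by (simp add: algebra_simps add_divide_distrib diff_divide_distrib)
    then show ?thesis unfolding RP_def T12 by (simp only: distrib_left[symmetric] times_divide_eq_right[symmetric])
  qed
  have RQX: "RQ = M / of_real (S ^ N) * (sin (\<alpha> N) * X - cos (\<alpha> N) * Y)"
  proof -
    have "(E * (X - \<i> * Y) - F * (X + \<i> * Y)) / (2 * \<i>) = - (\<i> * (E * (X - \<i> * Y) - F * (X + \<i> * Y)) / 2)"
      by (rule div_2i)
    also have "\<dots> = sin (\<alpha> N) * X - cos (\<alpha> N) * Y"
      unfolding trig by (simp add: algebra_simps add_divide_distrib diff_divide_distrib)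
    finally show ?thesis
      unfolding RQ_def T12 by (simp only: right_diff_distrib[symmetric] times_divide_eq_right[symmetric])
  qed
  have comb: "norm M / S ^ N * (u * norm X + v * norm Y) \<le> B * (u / S ^ N) + B' * (v / S ^ (N + 1))"
    if "Re \<nu> > real N + 1 / 2" "u \<ge> 0" "v \<ge> 0" for u v
  proof -
    have "norm M / S ^ N * (u * norm X + v * norm Y) = (norm M * norm X) * (u / S ^ N) + (norm M * norm Y) * (v / S ^ N)"
      by (simp add: distrib_left mult_ac add_divide_distrib)
    also have "\<dots> \<le> B * (u / S ^ N) + B' / S * (v / S ^ N)"
      using MX MY[OF that(1)] that S by (intro add_mono mult_right_mono) auto
    finally show ?thesis by (simp add: mult_ac)
  qed
  have RP2: "norm RP \<le> B * (norm (cos (\<alpha> N)) / S ^ N) + B' * (norm (sin (\<alpha> N)) / S ^ (N + 1))"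
    if "Re \<nu> > real N + 1 / 2"
  proof -
    have "norm RP \<le> norm M / S ^ N * (norm (cos (\<alpha> N)) * norm X + norm (sin (\<alpha> N)) * norm Y)"
      unfolding RPX norm_mult norm_divide using S norm_triangle_ineq[of "cos (\<alpha> N) * X" "sin (\<alpha> N) * Y"]
      by (intro mult_mono) (auto simp: norm_mult norm_power)
    also have "\<dots> \<le> B * (norm (cos (\<alpha> N)) / S ^ N) + B' * (norm (sin (\<alpha> N)) / S ^ (N + 1))"
      by (rule comb[OF that]) auto
    finally show ?thesis .
  qed
  have RQ2: "norm RQ \<le> B * (norm (sin (\<alpha> N)) / S ^ N) + B' * (norm (cos (\<alpha> N)) / S ^ (N + 1))"
    if "Re \<nu> > real N + 1 / 2"
  proof -
    have "norm RQ \<le> norm M / S ^ N * (norm (sin (\<alpha> N)) * norm X + norm (cos (\<alpha> N)) * norm Y)"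
      unfolding RQX norm_mult norm_divide using S norm_triangle_ineq4[of "sin (\<alpha> N) * X" "cos (\<alpha> N) * Y"]
      by (intro mult_mono) (auto simp: norm_mult norm_power)
    also have "\<dots> \<le> B * (norm (sin (\<alpha> N)) / S ^ N) + B' * (norm (cos (\<alpha> N)) / S ^ (N + 1))"
      by (rule comb[OF that]) auto
    finally show ?thesis .
  qed
  show ?thesis
    unfolding S_def[symmetric] \<alpha>_def[symmetric] G_def[symmetric] B_def[symmetric] B'_def[symmetric]
    using P Q RP1 RQ1 RP2 RQ2 unfolding c_def A_def by (intro exI[of _ RP] exI[of _ RQ]) blast
qed

end
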